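(* Let $\overline p(n)$ be the number of overpartitions of $n$. With $S=S(n):=\pi\sqrt n$, set $$A(n):=\frac{\pi^2}{2}\left(\frac{1}{S-1}-\frac{3}{S^2}\right),\qquad \delta(n):=\frac{\pi^2}{2}\left(\frac{1}{2S(S-1)^2}-\frac{3}{S^4}\right)^{1/2}.$$ Then for every degree $m\ge2$, the sequence $\overline p(n)$ is log-polynomial with data $\{A(n),-1,\delta(n)\}$. Consequently, $\overline p(n)$ is Hermite-Jensen of every positive integer degree with data $\{A(n),-1,\delta(n)\}$. It is also Hermite-Jensen of every positive integer degree with the data $\{A^*(n),-1,\delta^*(n)\}$, where $$A^*(n):=\frac{\pi}{2n^{1/2}},\qquad\delta^*(n):=\frac{\sqrt\pi}{8^{1/2}n^{3/4}}.$$
   Context: An overpartition of $n$ is a partition of $n$ in which the first occurrence of each part size may or may not be overlined. Equivalently, $\sum_n\overline p(n)q^n=\prod_{j\ge1}\frac{1+q^j}{1-q^j}$. Jensen polynomials: $J_\alpha^{d,n}(X)=\sum_{j=0}^d\binom{d}{j}\alpha(n+j)X^j$ and $K_\alpha^{d,n}(X)=X^dJ_\alpha^{d,n}(1/X)$. $H_d$ is the physicists' Hermite polynomial, $e^{2Xt-t^2}=\sum_d H_d(X)t^d/d!$. Log-polynomial: let $m\ge2$ be an integer and $\kappa\in\{1,-1\}$. A sequence of positive reals $\alpha(n)$ is log-polynomial of degree $m$ with data $\{A(n),\kappa,\delta(n)\}$ if there are real sequences $A(n),\delta(n),g_k(n)$ ($3\le k\le m$) such that $$\log\left(\frac{\alpha(n+j)}{\alpha(n)}\right)=A(n)j+\kappa\delta(n)^2j^2+\sum_{k=3}^m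 g_k(n)j^k+o(\delta(n)^{m+1})\quad(n\to\infty)$$ for $j=1,\dots,m+1$. In addition, $\delta(n)>0$, $\delta(n)\to0$ and $g_k(n)=o(\delta(n)^k)$. Hermite-Jensen: a sequence of positive reals $\alpha(n)$ is Hermite-Jensen of degree $d\ge1$ with data $\{A(n),\kappa,\delta(n)\}$ if, as $n\to\infty$, both $$\frac{\delta(n)^{-d}}{\alpha(n)}J_\alpha^{d,n}\!\left(\frac{\delta(n)X-1}{e^{A(n)}}\right)\quad\text{and}\quad\frac{(e^{A(n)}\delta(n))^{-d}}{\alpha(n)}K_\alpha^{d,n}\!\left(e^{A(n)}(\delta(n)X-1)\right)$$ converge coefficientwise to $H_d(X/2)$ if $\kappa=-1$, and to $i^{-d}H_d(iX/2)$ if $\kappa=1$. *)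

theory Defs
  imports Complex_Main "HOL-Library.Multiset" "HOL-Library.Landau_Symbols"
    "HOL-Computational_Algebra.Polynomial"
begin

definition partitions :: "nat \<Rightarrow> nat multiset set" where
  "partitions n = {P. (\<forall>x\<in>#P. 0 < x) \<and> sum_mset P = n}"

text \<open>An overpartition: a partition together with the set of part sizes whose
  first occurrence is overlined.\<close>
definition overpartitions :: "nat \<Rightarrow> (nat multiset \<times> nat set) set" where
  "overpartitions n = {(P, Ov). P \<in> partitions n \<and> Ov \<subseteq> set_mset P}"

definition overpart :: "nat \<Rightarrow> real" where
  "overpart n = real (card (overpartitions n))"

text \<open>Physicists' Hermite polynomial: coefficient of t^d/d! in exp(2Xt - t^2),
  i.e. H_d(X) = d! * sum_{k <= d/2} (-1)^k (2X)^(d-2k) / (k! (d-2k)!).\<close>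
definition hermite :: "nat \<Rightarrow> complex poly" where
  "hermite d = (\<Sum>k\<le>d div 2.
      monom (fact d * (-1)^k * 2^(d - 2*k) / (fact k * fact (d - 2*k))) (d - 2*k))"

definition jensen_poly :: "(nat \<Rightarrow> real) \<Rightarrow> nat \<Rightarrow> nat \<Rightarrow> real poly" where
  "jensen_poly \<alpha> d n = (\<Sum>j\<le>d. monom (real (d choose j) * \<alpha> (n + j)) j)"

definition jensen_poly_rev :: "(nat \<Rightarrow> real) \<Rightarrow> nat \<Rightarrow> nat \<Rightarrow> real poly" where
  "jensen_poly_rev \<alpha> d n = (\<Sum>j\<le>d. monom (real (d choose j) * \<alpha> (n + j)) (d - j))"

definition log_polynomial ::
  "nat \<Rightarrow> (nat \<Rightarrow> real) \<Rightarrow> (nat \<Rightarrow> real) \<Rightarrow> int \<Rightarrow> (nat \<Rightarrow> real) \<Rightarrow> bool" where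
  "log_polynomial m \<alpha> A \<kappa> \<delta> \<longleftrightarrow>
     2 \<le> m \<and> \<kappa> \<in> {1, -1} \<and> (\<forall>n. 0 < \<alpha> n) \<and>
     (\<forall>\<^sub>F n in sequentially. 0 < \<delta> n) \<and> \<delta> \<longlonglongrightarrow> 0 \<and>
     (\<exists>g :: nat \<Rightarrow> nat \<Rightarrow> real.
        (\<forall>k\<in>{3..m}. g k \<in> o[sequentially](\<lambda>n. \<delta> n ^ k)) \<and>
        (\<forall>j\<in>{1..m+1}.
           (\<lambda>n. ln (\<alpha> (n + j) / \<alpha> n) - (A n * real j + real_of_int \<kappa> * \<delta> n ^ 2 * real j ^ 2
                 + (\<Sum>k=3..m. g k n * real j ^ k)))
           \<in> o[sequentially](\<lambda>n. \<delta> n ^ (m + 1))))"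

definition hj_limit :: "nat \<Rightarrow> int \<Rightarrow> complex poly" where
  "hj_limit d \<kappa> =
     (if \<kappa> = -1 then pcompose (hermite d) [:0, 1/2:]
      else smult (inverse (\<i> ^ d)) (pcompose (hermite d) [:0, \<i>/2:]))"

definition coeffwise_tendsto :: "(nat \<Rightarrow> real poly) \<Rightarrow> complex poly \<Rightarrow> bool" where
  "coeffwise_tendsto P Q \<longleftrightarrow>
     (\<forall>k. (\<lambda>n. complex_of_real (coeff (P n) k)) \<longlonglongrightarrow> coeff Q k)"

definition hermite_jensen ::
  "nat \<Rightarrow> (nat \<Rightarrow> real) \<Rightarrow> (nat \<Rightarrow> real) \<Rightarrow> int \<Rightarrow> (nat \<Rightarrow> real) \<Rightarrow> bool" where
  "hermite_jensen d \<alpha> A \<kappa> \<delta> \<longleftrightarrow>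
     1 \<le> d \<and> \<kappa> \<in> {1, -1} \<and> (\<forall>n. 0 < \<alpha> n) \<and>
     coeffwise_tendsto
       (\<lambda>n. smult (inverse (\<delta> n ^ d)) (smult (inverse (\<alpha> n))
          (pcompose (jensen_poly \<alpha> d n) [: - inverse (exp (A n)), \<delta> n / exp (A n) :])))
       (hj_limit d \<kappa>) \<and>
     coeffwise_tendsto
       (\<lambda>n. smult (inverse ((exp (A n) * \<delta> n) ^ d)) (smult (inverse (\<alpha> n))
          (pcompose (jensen_poly_rev \<alpha> d n) [: - exp (A n), exp (A n) * \<delta> n :])))
       (hj_limit d \<kappa>)"

definition S_op :: "nat \<Rightarrow> real" where "S_op n = pi * sqrt (real n)"

definition A_op :: "nat \<Rightarrow> real" where
  "A_op n = pi^2 / 2 * (1 / (S_op n - 1) - 3 / (S_op n)^2)"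

definition delta_op :: "nat \<Rightarrow> real" where
  "delta_op n = pi^2 / 2 * sqrt (1 / (2 * S_op n * (S_op n - 1)^2) - 3 / (S_op n)^4)"

definition A_star :: "nat \<Rightarrow> real" where
  "A_star n = pi / (2 * sqrt (real n))"

definition delta_star :: "nat \<Rightarrow> real" where
  "delta_star n = sqrt pi / (sqrt 8 * real n powr (3/4))"

end

theory Submission
  imports Defs "HOL-Complex_Analysis.Complex_Analysis" "HOL-Probability.Probability"
    "HOL-Real_Asymp.Real_Asymp"
begin

text \<open>
  The generating function \<open>P(q) = \<Sum> overpart n q\<^sup>n\<close> satisfies \<open>P(q) \<theta>\<^sub>4(q) = 1\<close> (Gauss), so the theta
  transformation gives \<open>P(e\<^sup>-\<^sup>t)\<close> near \<open>t = 0\<close> up to an exponentially small relative error. For fixed \<open>n\<close>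
  the function \<open>P(e\<^sup>-\<^sup>t) e\<^sup>n\<^sup>t\<close> has an explicit primitive on \<open>Re t > 0\<close> whose increment over a period is
  \<open>2 \<pi> i overpart n\<close>. That increment is split along a vertical line with a detour on the arc
  \<open>t = (\<pi> / (2 \<surd>n)) e\<^sup>2\<^sup>i\<^sup>\<phi>\<close>, \<open>|\<phi>| \<le> \<pi> / 6\<close>, where the substitution \<open>v = sin \<phi>\<close> makes the leading term an exact
  Gaussian. With \<open>S = \<pi> \<surd>n\<close> this yields \<open>overpart n = e\<^sup>S (1 - 1/S) / (8 n) + O(e\<^bsup>0.87 S\<^esup>)\<close>.

  The logarithm of the main term is analytic in \<open>n\<close>, so Cauchy's estimates give its Taylor coefficients: they
  are \<open>A_op\<close>, \<open>- delta_op\<^sup>2\<close> and, in degree \<open>k \<ge> 3\<close>, \<open>O(n\<^bsup>1/2 - k\<^esup>)\<close>, which is \<open>o(delta_op\<^sup>k)\<close>. The coefficients of the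
  rescaled Jensen polynomials are finite differences in \<open>j\<close> of \<open>overpart (n + j) e\<^bsup>-A j\<^esup> / overpart n\<close>, a perturbation
  of \<open>exp (- (\<delta> j)\<^sup>2)\<close>; differencing leaves the Taylor coefficients of \<open>exp (- x\<^sup>2)\<close>, which are those of the
  Hermite polynomials.
\<close>

section \<open>The generating function\<close>

text \<open>Data of arbitrary degree require an error below every power of n, hence an estimate with
  exponentially small relative error; a single expansion of the logarithm then serves all m and d.
  Two facts shape the geometry. On the circle |t| = x with x = pi / (2 sqrt n), the exponent n t +
  pi^2 / (4 t) is the real number S cos (2 phi), so no phase has to be controlled apart from that of
  the slowly varying factor. The arc stops at phi = pi / 6, where Re t has fallen to x / 2. On the
  line Re t = x / 2 the bound by absolute values is exp (S) from the generating function times exp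
  (S / 4) from exp (n t), which is larger than the main term, so more than S / 4 must be gained in
  the exponent. The theta transformation does not give this uniformly up to |Im t| = pi, because the
  argument of the dual theta series approaches the unit circle. The gain is therefore taken from the
  infinite product, and the exponent 0.87 is 1 + 1/4 minus a gain of at least 0.38.\<close>

text \<open>Bounding the part sizes turns the generating function into a finite product, with
  unchanged coefficients in degrees n <= N.\<close>

definition parts_upto :: "nat \<Rightarrow> nat \<Rightarrow> nat multiset set" where
  "parts_upto N n = {P. set_mset P \<subseteq> {1..N} \<and> sum_mset P = n}"

text \<open>The number of ways to overline one partition: each distinct part size is marked or not,
  independently.\<close>

definition part_weight :: "nat multiset \<Rightarrow> real" where
  "part_weight P = 2 ^ card (set_mset P)"

definition overpart_upto :: "nat \<Rightarrow> nat \<Rightarrow> real" where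
  "overpart_upto N n = (\<Sum>P\<in>parts_upto N n. part_weight P)"

lemma partitions_eq_parts_upto: "n \<le> N \<Longrightarrow> partitions n = parts_upto N n"
proof -
  assume "n \<le> N"
  moreover have "x \<le> sum_mset P" if "x \<in># P" for x and P :: "nat multiset"
    using that by (metis le_add1 multi_member_split sum_mset.add_mset)
  ultimately show ?thesis
    unfolding partitions_def parts_upto_def by (force simp: Suc_le_eq)
qed

lemma size_le_sum_mset: "(\<forall>x\<in>#P. 0 < x) \<Longrightarrow> size P \<le> sum_mset (P :: nat multiset)"
  by (induction P) (auto simp: Suc_le_eq intro: add_le_mono[of 1, simplified])

lemma finite_parts_upto: "finite (parts_upto N n)"
proof -
  have "parts_upto N n \<subseteq> (\<Union>k\<le>n. {P. set_mset P \<subseteq> {1..N} \<and> size P = k})"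
    using size_le_sum_mset unfolding parts_upto_def by (fastforce simp: Suc_le_eq subset_iff)
  moreover have "finite {P. set_mset P \<subseteq> {1..N} \<and> size P = k}" for k
  proof -
    have "{P. set_mset P \<subseteq> {1..N} \<and> size P = k} \<subseteq> mset ` {xs. set xs \<subseteq> {1..N} \<and> length xs = k}"
    proof
      fix P assume P: "P \<in> {P. set_mset P \<subseteq> {1..N} \<and> size P = k}"
      obtain xs where "mset xs = P" using ex_mset by blast
      thus "P \<in> mset ` {xs. set xs \<subseteq> {1..N} \<and> length xs = k}" using P by auto
    qed
    thus ?thesis using finite_lists_length_eq[of "{1..N}" k] finite_surj by blast
  qed
  ultimately show ?thesis by (meson finite_UN_I finite_atMost finite_subset)
qed

lemma overpart_eq_overpart_upto:
  assumes "n \<le> N"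
  shows "overpart n = overpart_upto N n"
proof -
  have "overpartitions n = Sigma (parts_upto N n) (\<lambda>P. Pow (set_mset P))"
    unfolding overpartitions_def partitions_eq_parts_upto[OF assms] by auto
  hence "card (overpartitions n) = (\<Sum>P\<in>parts_upto N n. card (Pow (set_mset P)))"
    by (simp add: card_SigmaI finite_parts_upto)
  thus ?thesis
    by (simp add: overpart_def overpart_upto_def part_weight_def card_Pow)
qed

lemma parts_upto_Suc:
  "parts_upto (Suc N) n = parts_upto N n \<union>
     (if Suc N \<le> n then add_mset (Suc N) ` parts_upto (Suc N) (n - Suc N) else {})"
proof (intro equalityI subsetI)
  fix P assume P: "P \<in> parts_upto (Suc N) n"
  show "P \<in> parts_upto N n \<union>
     (if Suc N \<le> n then add_mset (Suc N) ` parts_upto (Suc N) (n - Suc N) else {})"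
  proof (cases "Suc N \<in># P")
    case True
    then obtain Q where Q: "P = add_mset (Suc N) Q" by (meson multi_member_split)
    have "Q \<in> parts_upto (Suc N) (n - Suc N)" "Suc N \<le> n"
      using P Q by (auto simp: parts_upto_def)
    thus ?thesis using Q by auto
  next
    case False
    thus ?thesis using P by (auto simp: parts_upto_def atLeastAtMostSuc_conv)
  qed
qed (auto simp: parts_upto_def split: if_splits)

lemma suc_notin_parts_upto: "P \<in> parts_upto N n \<Longrightarrow> Suc N \<notin># P"
  by (auto simp: parts_upto_def)

text \<open>Coefficient form of (1 - q^M) F_M = (1 + q^M) F_N with M = N + 1. One more part M keeps
  the weight if M already occurs and doubles it otherwise; the doubled ones are the partitions with
  parts at most N, which gives the second summand.\<close>

lemma overpart_upto_Suc:
  "overpart_upto (Suc N) n = overpart_upto N n +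
     (if Suc N \<le> n then overpart_upto (Suc N) (n - Suc N) + overpart_upto N (n - Suc N) else 0)"
proof (cases "Suc N \<le> n")
  case True
  let ?A = "parts_upto (Suc N) (n - Suc N)"
  have "overpart_upto (Suc N) n = overpart_upto N n + (\<Sum>P\<in>add_mset (Suc N) ` ?A. part_weight P)"
    unfolding overpart_upto_def parts_upto_Suc[of N n] using True
    by (subst sum.union_disjoint) (auto simp: finite_parts_upto dest: suc_notin_parts_upto)
  also have "(\<Sum>P\<in>add_mset (Suc N) ` ?A. part_weight P) = (\<Sum>P\<in>?A. part_weight (add_mset (Suc N) P))"
    by (subst sum.reindex) (auto simp: inj_on_def)
  also have "\<dots> = (\<Sum>P\<in>?A. part_weight P + (if Suc N \<in># P then 0 else part_weight P))"
    by (intro sum.cong) (auto simp: part_weight_def insert_absorb)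
  also have "\<dots> = overpart_upto (Suc N) (n - Suc N) + (\<Sum>P\<in>?A. if Suc N \<in># P then 0 else part_weight P)"
    by (simp add: sum.distrib overpart_upto_def)
  also have "(\<Sum>P\<in>?A. if Suc N \<in># P then 0 else part_weight P) = (\<Sum>P\<in>parts_upto N (n - Suc N). part_weight P)"
    by (intro sum.mono_neutral_cong_right finite_parts_upto)
       (auto simp: parts_upto_def atLeastAtMostSuc_conv)
  finally show ?thesis using True by (simp add: overpart_upto_def)
next
  case False
  thus ?thesis using parts_upto_Suc[of N n] by (simp add: overpart_upto_def)
qed

lemma overpart_upto_nonneg: "0 \<le> overpart_upto N n"
  unfolding overpart_upto_def part_weight_def by (intro sum_nonneg) auto

lemma overpart_upto_le_overpart: "overpart_upto N n \<le> overpart n"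
proof -
  have "overpart_upto N n \<le> overpart_upto (max N n) n"
    unfolding overpart_upto_def part_weight_def
    by (intro sum_mono2 finite_parts_upto) (force simp: parts_upto_def)+
  thus ?thesis by (simp add: overpart_eq_overpart_upto[of n "max N n"])
qed

lemma overpart_pos: "0 < overpart n"
proof -
  have "replicate_mset n 1 \<in> parts_upto n n"
    by (cases n) (auto simp: parts_upto_def sum_mset_replicate_mset)
  hence "0 < overpart_upto n n"
    unfolding overpart_upto_def part_weight_def
    by (intro sum_pos2[OF finite_parts_upto]) auto
  thus ?thesis by (simp add: overpart_eq_overpart_upto[of n n])
qed

lemma overpart_upto_0: "overpart_upto 0 n = (if n = 0 then 1 else 0)"
proof -
  have "parts_upto 0 n = (if n = 0 then {{#}} else {})"
    by (auto simp: parts_upto_def)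
  thus ?thesis by (simp add: overpart_upto_def part_weight_def)
qed

text \<open>Induction on N. Summability comes first: the recurrence yields the new factor only by
  solving for a sum that is known to converge.\<close>

lemma overpart_upto_sums:
  fixes q :: complex
  assumes q: "norm q < 1"
  shows "summable (\<lambda>n. overpart_upto N n * norm q ^ n)"
    and "(\<lambda>n. of_real (overpart_upto N n) * q ^ n) sums (\<Prod>j=1..N. (1 + q ^ j) / (1 - q ^ j))"
proof (induction N)
  case 0
  have "(\<lambda>n. if n = 0 then 1 else 0 :: complex) sums 1" "(\<lambda>n. if n = 0 then 1 else 0 :: real) sums 1"
    using sums_single[of 0 "\<lambda>_. 1"] by auto
  hence "(\<lambda>n. complex_of_real (overpart_upto 0 n) * q ^ n) sums 1"
        "(\<lambda>n. overpart_upto 0 n * norm q ^ n) sums 1"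
    by (auto simp: overpart_upto_0 if_distrib[of "\<lambda>x. x * _"] if_distrib[of of_real] cong: if_cong)
  thus "summable (\<lambda>n. overpart_upto 0 n * norm q ^ n)"
    "(\<lambda>n. of_real (overpart_upto 0 n) * q ^ n) sums (\<Prod>j=1..0. (1 + q ^ j) / (1 - q ^ j))"
    by (auto simp: sums_iff)
next
  case (Suc N)
  let ?r = "norm q"
  let ?M = "Suc N"
  define U where "U = (\<Sum>n. overpart_upto N n * ?r ^ n)"
  have U: "(\<lambda>n. overpart_upto N n * ?r ^ n) sums U" using Suc unfolding U_def by (simp add: summable_sums)
  have U_le: "(\<Sum>n<K. overpart_upto N n * ?r ^ n) \<le> U" for K
    unfolding U_def by (intro sum_le_suminf Suc) (auto intro!: mult_nonneg_nonneg overpart_upto_nonneg)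
  have rM: "?r ^ ?M < 1" using q by (simp add: power_less_one_iff del: power_Suc)
  have part: "(\<Sum>n<K. overpart_upto ?M n * ?r ^ n) \<le> (1 + ?r ^ ?M) * U / (1 - ?r ^ ?M)" for K
  proof -
    let ?T = "\<Sum>n<K. overpart_upto ?M n * ?r ^ n"
    let ?g = "\<lambda>n. overpart_upto ?M n + overpart_upto N n"
    have "?T = (\<Sum>n<K. overpart_upto N n * ?r ^ n) + (\<Sum>n<K. if ?M \<le> n then ?g (n - ?M) * ?r ^ n else 0)"
      unfolding sum.distrib[symmetric] by (intro sum.cong refl, subst overpart_upto_Suc) (auto simp: algebra_simps)
    also have "(\<Sum>n<K. if ?M \<le> n then ?g (n - ?M) * ?r ^ n else 0) = (\<Sum>n\<in>{?M..<K}. ?g (n - ?M) * ?r ^ n)"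
      by (intro sum.mono_neutral_cong_right) auto
    also have "\<dots> = (\<Sum>n<K-?M. ?g n * ?r ^ (n + ?M))"
      by (rule sum.reindex_bij_witness[of _ "\<lambda>n. n + ?M" "\<lambda>n. n - ?M"]) auto
    also have "\<dots> \<le> (\<Sum>n<K. ?g n * ?r ^ (n + ?M))"
      by (intro sum_mono2 mult_nonneg_nonneg add_nonneg_nonneg overpart_upto_nonneg) auto
    also have "\<dots> = ?r ^ ?M * (?T + (\<Sum>n<K. overpart_upto N n * ?r ^ n))"
      by (simp add: sum.distrib sum_distrib_left power_add algebra_simps)
    \<comment> \<open>The partial sum is bounded by r^M < 1 times itself plus terms bounded
      independently of K, so the inequality can be solved for it.\<close>
    finally have "?T \<le> (\<Sum>n<K. overpart_upto N n * ?r ^ n) + ?r ^ ?M * (?T + (\<Sum>n<K. overpart_upto N n * ?r ^ n))"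
      by simp
    also have "\<dots> \<le> U + ?r ^ ?M * (?T + U)"
      using U_le[of K] by (intro add_mono mult_left_mono) auto
    finally have "?T * (1 - ?r ^ ?M) \<le> (1 + ?r ^ ?M) * U" by (simp add: algebra_simps)
    thus ?thesis using rM by (simp add: pos_le_divide_eq)
  qed
  show S: "summable (\<lambda>n. overpart_upto ?M n * ?r ^ n)"
    by (rule bounded_imp_summable[OF _ part[of "Suc _", unfolded lessThan_Suc_atMost]])
       (auto intro!: mult_nonneg_nonneg overpart_upto_nonneg)
  have S': "summable (\<lambda>n. of_real (overpart_upto ?M n) * q ^ n)"
    by (rule summable_norm_cancel) (use S in \<open>simp add: norm_mult norm_power overpart_upto_nonneg\<close>)
  define T where "T = (\<Sum>n. of_real (overpart_upto ?M n) * q ^ n)"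
  define V where "V = (\<Prod>j=1..N. (1 + q ^ j) / (1 - q ^ j))"
  have T: "(\<lambda>n. of_real (overpart_upto ?M n) * q ^ n) sums T" using S' unfolding T_def by (simp add: summable_sums)
  have V: "(\<lambda>n. of_real (overpart_upto N n) * q ^ n) sums V" using Suc unfolding V_def by blast
  let ?h = "\<lambda>n. if ?M \<le> n then of_real (overpart_upto ?M (n - ?M) + overpart_upto N (n - ?M)) * q ^ n else 0"
  have "(\<lambda>n. ?h (n + ?M)) sums (q ^ ?M * (T + V))"
    using sums_mult[OF sums_add[OF T V], of "q ^ ?M"] by (simp add: power_add algebra_simps)
  hence "?h sums (q ^ ?M * (T + V))"
    by (subst (asm) sums_iff_shift) (auto simp: sum.neutral)
  from sums_add[OF V this] have "(\<lambda>n. of_real (overpart_upto ?M n) * q ^ n) sums (V + q ^ ?M * (T + V))"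
    by (rule sums_cong[THEN iffD1, rotated]) (subst (2) overpart_upto_Suc, auto simp: algebra_simps)
  with T have "T = V + q ^ ?M * (T + V)" using sums_unique2 by blast
  moreover have "1 - q ^ ?M \<noteq> 0"
  proof
    assume "1 - q ^ ?M = 0"
    hence "norm (q ^ ?M) = 1" by simp
    thus False using rM by (simp add: norm_power del: power_Suc)
  qed
  ultimately have "T = V * ((1 + q ^ ?M) / (1 - q ^ ?M))" by (simp add: field_simps)
  thus "(\<lambda>n. of_real (overpart_upto ?M n) * q ^ n) sums (\<Prod>j=1..?M. (1 + q ^ j) / (1 - q ^ j))"
    using T by (simp add: V_def)
qed

section \<open>The generating function in the unit disc: convergence, product formula, size\<close>

definition overpart_gf :: "complex \<Rightarrow> complex" where
  "overpart_gf q = (\<Sum>n. of_real (overpart n) * q ^ n)"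

text \<open>The point is that the bound does not depend on N: 1 + x <= exp x turns the product into
  a geometric series.\<close>

lemma prod_ratio_le_exp:
  fixes r :: real
  assumes "0 \<le> r" "r < 1"
  shows "(\<Prod>j=1..N. (1 + r ^ j) / (1 - r ^ j)) \<le> exp (2 / (1 - r)\<^sup>2)"
proof -
  have "(\<Prod>j=1..N. (1 + r ^ j) / (1 - r ^ j)) \<le> (\<Prod>j=1..N. exp (2 * r ^ j / (1 - r)))"
  proof (intro prod_mono conjI)
    fix j assume j: "j \<in> {1..N}"
    have le: "r ^ j \<le> r" using assms j by (metis atLeastAtMost_iff less_imp_le power_decreasing power_one_right)
    have 0: "0 \<le> r ^ j" using assms by simp
    show "0 \<le> (1 + r ^ j) / (1 - r ^ j)" using le 0 assms by simp
    have "(1 + r ^ j) / (1 - r ^ j) = 1 + 2 * r ^ j / (1 - r ^ j)" using le assms by (simp add: field_simps)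
    also have "\<dots> \<le> 1 + 2 * r ^ j / (1 - r)" using le 0 assms by (intro add_mono divide_left_mono) auto
    also have "\<dots> \<le> exp (2 * r ^ j / (1 - r))" by (rule exp_ge_add_one_self)
    finally show "(1 + r ^ j) / (1 - r ^ j) \<le> exp (2 * r ^ j / (1 - r))" .
  qed
  also have "\<dots> = exp (2 / (1 - r) * (\<Sum>j=1..N. r ^ j))"
    by (simp add: exp_sum[symmetric] sum_distrib_left)
  also have "\<dots> \<le> exp (2 / (1 - r) * (1 / (1 - r)))"
  proof -
    have "(\<Sum>j=1..N. r ^ j) \<le> (\<Sum>j. r ^ j)"
      using assms by (intro sum_le_suminf summable_geometric) auto
    also have "(\<Sum>j. r ^ j) = 1 / (1 - r)" using assms by (intro suminf_geometric) auto
    finally show ?thesis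
      using assms by (intro exp_le_cancel_iff[THEN iffD2] mult_left_mono) auto
  qed
  finally show ?thesis by (simp add: power2_eq_square)
qed

text \<open>Up to index N the coefficients are those of the truncated series, whose full sum is a
  finite product bounded independently of N.\<close>

lemma overpart_summable:
  assumes "0 \<le> r" "r < 1"
  shows "summable (\<lambda>n. overpart n * r ^ n)"
proof (rule bounded_imp_summable)
  fix N
  have "(\<lambda>n. Re (of_real (overpart_upto N n) * of_real r ^ n)) sums
          Re (\<Prod>j=1..N. (1 + of_real r ^ j) / (1 - of_real r ^ j))"
    using assms by (intro sums_Re overpart_upto_sums) auto
  also have "(\<Prod>j=1..N. (1 + complex_of_real r ^ j) / (1 - of_real r ^ j))
      = of_real (\<Prod>j=1..N. (1 + r ^ j) / (1 - r ^ j))" by simp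
  finally have s: "(\<lambda>n. overpart_upto N n * r ^ n) sums (\<Prod>j=1..N. (1 + r ^ j) / (1 - r ^ j))"
    by (simp only: Re_complex_of_real flip: of_real_power of_real_mult)
  have "(\<Sum>n\<le>N. overpart n * r ^ n) = (\<Sum>n\<le>N. overpart_upto N n * r ^ n)"
    by (intro sum.cong) (auto simp: overpart_eq_overpart_upto)
  also have "\<dots> \<le> (\<Sum>n. overpart_upto N n * r ^ n)"
    using s assms by (intro sum_le_suminf) (auto simp: sums_iff overpart_upto_nonneg)
  also have "\<dots> = (\<Prod>j=1..N. (1 + r ^ j) / (1 - r ^ j))" using s by (simp add: sums_iff)
  also have "\<dots> \<le> exp (2 / (1 - r)\<^sup>2)" by (rule prod_ratio_le_exp[OF assms])
  finally show "(\<Sum>n\<le>N. overpart n * r ^ n) \<le> exp (2 / (1 - r)\<^sup>2)" .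
qed (use assms less_imp_le[OF overpart_pos] in auto)

lemma overpart_gf_sums:
  assumes "norm q < 1"
  shows "(\<lambda>n. of_real (overpart n) * q ^ n) sums overpart_gf q"
  unfolding overpart_gf_def
proof (intro summable_sums summable_norm_cancel[of "\<lambda>n. of_real (overpart n) * q ^ n"])
  show "summable (\<lambda>n. norm (of_real (overpart n) * q ^ n))"
    using overpart_summable[of "norm q"] assms less_imp_le[OF overpart_pos]
    by (simp add: norm_mult norm_power)
qed

text \<open>Tannery's theorem: for fixed k the truncated coefficients are eventually constant in N,
  and the untruncated ones dominate them.\<close>

lemma overpart_gf_prod:
  assumes "norm q < 1"
  shows "(\<lambda>N. \<Prod>j=1..N. (1 + q ^ j) / (1 - q ^ j)) \<longlonglongrightarrow> overpart_gf q"
proof -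
  let ?a = "\<lambda>k N. complex_of_real (overpart_upto N k) * q ^ k"
  have "(\<lambda>N. \<Sum>k. ?a k N) \<longlonglongrightarrow> (\<Sum>k. of_real (overpart k) * q ^ k)"
  proof (rule tannerys_theorem[THEN conjunct2, THEN conjunct2])
    fix k show "(\<lambda>N. ?a k N) \<longlonglongrightarrow> of_real (overpart k) * q ^ k"
      by (rule tendsto_eventually)
         (use eventually_ge_at_top[of k] in eventually_elim, simp add: overpart_eq_overpart_upto)
    show "\<forall>\<^sub>F (k, N) in sequentially \<times>\<^sub>F sequentially. norm (?a k N) \<le> overpart k * norm q ^ k"
      by (intro always_eventually)
         (auto simp: norm_mult norm_power overpart_upto_nonneg overpart_upto_le_overpart intro!: mult_right_mono)
  qed (use overpart_summable[of "norm q"] assms in auto)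
  moreover have "(\<Sum>k. ?a k N) = (\<Prod>j=1..N. (1 + q ^ j) / (1 - q ^ j))" for N
    using overpart_upto_sums(2)[OF assms] by (simp add: sums_iff)
  ultimately show ?thesis by (simp add: overpart_gf_def)
qed

text \<open>ln ((1 + z) / (1 - z)) is twice the sum of z^n / n over odd n. All coefficients are
  nonnegative, so passing from z to |z| gains a multiple of |z|^n - Re (z^n) >= 0 in each degree;
  only the gain of degree 1 is kept.\<close>

lemma norm_ratio_le:
  fixes z :: complex
  assumes z: "norm z < 1"
  shows "norm ((1 + z) / (1 - z)) \<le> (1 + norm z) / (1 - norm z) * exp (2 * (Re z - norm z))"
proof -
  define c :: "nat \<Rightarrow> real" where "c n = (1 - (-1) ^ n) / real n" for n
  have c0: "0 \<le> c n" for n by (cases "even n") (auto simp: c_def)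
  have key: "(\<lambda>n. of_real (c n) * w ^ n) sums (Ln (1 + w) - Ln (1 - w))" if "norm w < 1" for w
  proof -
    have "(-1) ^ Suc n / of_nat n * w ^ n - (-1) ^ Suc n / of_nat n * (- w) ^ n = of_real (c n) * w ^ n" for n
      by (cases "even n") (auto simp: c_def)
    thus ?thesis using sums_diff[OF Ln_series[of w] Ln_series[of "-w"]] that by simp
  qed
  have nr: "norm ((1 + w) / (1 - w)) = exp (Re (Ln (1 + w) - Ln (1 - w)))" if "norm w < 1" for w :: complex
  proof -
    have "1 + w \<noteq> 0" "1 - w \<noteq> 0" using that by (auto simp: add_eq_0_iff)
    thus ?thesis by (simp add: norm_divide exp_diff flip: norm_exp_eq_Re)
  qed
  let ?r = "complex_of_real (norm z)"
  define d where "d = Re (Ln (1 + ?r) - Ln (1 - ?r)) - Re (Ln (1 + z) - Ln (1 - z))"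
  have "(\<lambda>n. c n * (norm z ^ n - Re (z ^ n))) sums d"
    using sums_diff[OF sums_Re[OF key[of ?r]] sums_Re[OF key[OF z]]] z unfolding d_def
    by (simp add: algebra_simps flip: of_real_power of_real_mult)
  moreover have "0 \<le> c n * (norm z ^ n - Re (z ^ n))" for n
    using complex_Re_le_cmod[of "z ^ n"] by (intro mult_nonneg_nonneg c0) (simp add: norm_power)
  ultimately have "(\<Sum>n\<in>{1}. c n * (norm z ^ n - Re (z ^ n))) \<le> d"
    using sum_le_suminf[of "\<lambda>n. c n * (norm z ^ n - Re (z ^ n))" "{1}"] by (simp add: sums_iff)
  hence "2 * (norm z - Re z) \<le> d" by (simp add: c_def)
  hence "exp (Re (Ln (1 + z) - Ln (1 - z))) \<le> exp (Re (Ln (1 + ?r) - Ln (1 - ?r)) + 2 * (Re z - norm z))"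
    unfolding d_def by (intro exp_le_cancel_iff[THEN iffD2]) (simp add: algebra_simps)
  also have "\<dots> = norm ((1 + ?r) / (1 - ?r)) * exp (2 * (Re z - norm z))"
    using nr[of ?r] z by (simp add: exp_add)
  also have "(1 + ?r) / (1 - ?r) = of_real ((1 + norm z) / (1 - norm z))" by simp
  also have "norm (complex_of_real ((1 + norm z) / (1 - norm z))) = (1 + norm z) / (1 - norm z)"
    using z by (simp only: norm_of_real) simp
  finally show ?thesis using nr[OF z] by simp
qed

text \<open>With the previous bound applied to every q^j, the gains add up to geometric series. No
  modular information enters, so the bound also serves for t far from the real axis.\<close>

lemma norm_overpart_gf_le:
  assumes q: "norm q < 1"
  shows "norm (overpart_gf q) \<le> norm (overpart_gf (of_real (norm q))) *
           exp (2 * (Re (q / (1 - q)) - norm q / (1 - norm q)))"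
proof (rule LIMSEQ_le)
  let ?r = "norm q"
  show "(\<lambda>N. norm (\<Prod>j=1..N. (1 + q ^ j) / (1 - q ^ j))) \<longlonglongrightarrow> norm (overpart_gf q)"
    using q by (intro tendsto_intros overpart_gf_prod)
  have geo: "(\<lambda>N. \<Sum>j=1..N. w ^ j) \<longlonglongrightarrow> w / (1 - w)" if "norm w < 1" for w :: complex
  proof -
    have "(\<lambda>N. \<Sum>j<N. w ^ Suc j) \<longlonglongrightarrow> w * (1 / (1 - w))"
      using sums_mult[OF geometric_sums[OF that], of w] by (simp add: sums_def)
    moreover have "(\<Sum>j<N. w ^ Suc j) = (\<Sum>j=1..N. w ^ j)" for N
      by (rule sum.reindex_bij_witness[of _ "\<lambda>j. j - 1" Suc]) auto
    ultimately show ?thesis by simp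
  qed
  have "(\<lambda>N. Re (\<Sum>j=1..N. q ^ j) - Re (\<Sum>j=1..N. of_real ?r ^ j)) \<longlonglongrightarrow>
          Re (q / (1 - q)) - Re (of_real ?r / (1 - of_real ?r))"
    using q by (intro tendsto_intros geo) auto
  also have "Re (of_real ?r / (1 - of_real ?r)) = ?r / (1 - ?r)"
    by (metis Re_complex_of_real of_real_1 of_real_diff of_real_divide)
  finally have "(\<lambda>N. \<Sum>j=1..N. Re (q ^ j) - ?r ^ j) \<longlonglongrightarrow> Re (q / (1 - q)) - ?r / (1 - ?r)"
    by (simp add: sum_subtractf flip: of_real_power)
  thus "(\<lambda>N. norm (\<Prod>j=1..N. (1 + complex_of_real ?r ^ j) / (1 - of_real ?r ^ j)) *
           exp (2 * (\<Sum>j=1..N. Re (q ^ j) - ?r ^ j)))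
     \<longlonglongrightarrow> norm (overpart_gf (of_real ?r)) * exp (2 * (Re (q / (1 - q)) - ?r / (1 - ?r)))"
    using q by (intro tendsto_intros overpart_gf_prod) auto
  have "norm (\<Prod>j=1..N. (1 + q ^ j) / (1 - q ^ j)) \<le>
      norm (\<Prod>j=1..N. (1 + complex_of_real ?r ^ j) / (1 - of_real ?r ^ j)) *
           exp (2 * (\<Sum>j=1..N. Re (q ^ j) - ?r ^ j))" for N
  proof -
    have "norm (\<Prod>j=1..N. (1 + q ^ j) / (1 - q ^ j)) = (\<Prod>j=1..N. norm ((1 + q ^ j) / (1 - q ^ j)))"
      by (simp add: prod_norm)
    also have "\<dots> \<le> (\<Prod>j=1..N. (1 + ?r ^ j) / (1 - ?r ^ j) * exp (2 * (Re (q ^ j) - ?r ^ j)))"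
    proof (intro prod_mono conjI norm_ge_zero)
      fix j assume "j \<in> {1..N}"
      hence "norm (q ^ j) < 1" using q by (simp add: norm_power power_less_one_iff)
      from norm_ratio_le[OF this] show "norm ((1 + q ^ j) / (1 - q ^ j)) \<le>
          (1 + ?r ^ j) / (1 - ?r ^ j) * exp (2 * (Re (q ^ j) - ?r ^ j))"
        by (simp add: norm_power)
    qed
    also have "\<dots> = (\<Prod>j=1..N. (1 + ?r ^ j) / (1 - ?r ^ j)) * exp (2 * (\<Sum>j=1..N. Re (q ^ j) - ?r ^ j))"
      by (simp only: prod.distrib exp_sum sum_distrib_left finite_atLeastAtMost)
    also have "(\<Prod>j=1..N. (1 + ?r ^ j) / (1 - ?r ^ j)) \<le> \<bar>\<Prod>j=1..N. (1 + ?r ^ j) / (1 - ?r ^ j)\<bar>" by simp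
    also have "\<dots> = norm (complex_of_real (\<Prod>j=1..N. (1 + ?r ^ j) / (1 - ?r ^ j)))"
      by (rule norm_of_real[symmetric])
    also have "complex_of_real (\<Prod>j=1..N. (1 + ?r ^ j) / (1 - ?r ^ j)) =
        (\<Prod>j=1..N. (1 + complex_of_real ?r ^ j) / (1 - of_real ?r ^ j))" by simp
    finally show ?thesis by simp
  qed
  thus "\<exists>N. \<forall>n\<ge>N. norm (\<Prod>j=1..n. (1 + q ^ j) / (1 - q ^ j)) \<le>
      norm (\<Prod>j=1..n. (1 + complex_of_real ?r ^ j) / (1 - of_real ?r ^ j)) *
           exp (2 * (\<Sum>j=1..n. Re (q ^ j) - ?r ^ j))" by blast
qed

section \<open>Gauss's identity\<close>

lemma one_plus_power_neq_0:
  fixes q :: complex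
  assumes "norm q < 1"
  shows "1 + q ^ j \<noteq> 0"
proof (cases "j = 0")
  case False
  hence "norm (q ^ j) < 1" using assms by (simp add: norm_power power_less_one_iff)
  thus ?thesis by (auto simp: add_eq_0_iff)
qed auto

lemma one_minus_power_neq_0:
  fixes q :: complex
  assumes "norm q < 1" "j > 0"
  shows "1 - q ^ j \<noteq> 0"
proof -
  have "norm (q ^ j) < 1" using assms by (simp add: norm_power power_less_one_iff)
  thus ?thesis by auto
qed

text \<open>A finite form of Gauss's identity: the difference of the right-hand sides for \<open>n + 1\<close> and \<open>n\<close>
  telescopes in \<open>s\<close>.\<close>

lemma gauss_finite:
  fixes q :: complex
  assumes q: "norm q < 1"
  defines "Q \<equiv> \<lambda>n. \<Prod>j=1..n. (1 - q ^ j) / (1 + q ^ j)"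
  shows "1 + 2 * (\<Sum>k=1..n. (-1) ^ k * q ^ k\<^sup>2) =
           (\<Sum>s\<le>n. (-1) ^ s * (Q n / Q s) * (2 / (1 + q ^ s)) * q ^ (s * (n + 1)))"
proof (induction n)
  case 0
  show ?case by (simp add: Q_def)
next
  case (Suc n)
  have Q0: "Q m \<noteq> 0" for m
    using one_plus_power_neq_0[OF q] one_minus_power_neq_0[OF q] by (auto simp: Q_def)
  have QS: "Q (Suc m) = Q m * ((1 - q ^ Suc m) / (1 + q ^ Suc m))" for m
    by (simp add: Q_def)
  have p0: "1 + q ^ m \<noteq> 0" for m by (rule one_plus_power_neq_0[OF q])
  have m0: "1 - q ^ Suc m \<noteq> 0" for m by (rule one_minus_power_neq_0[OF q]) simp
  define t where "t m s = (-1) ^ s * (Q m / Q s) * (2 / (1 + q ^ s)) * q ^ (s * (m + 1))" for m s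
  define x where "x = q ^ Suc n"
  define c where "c = 2 * Q n * inverse (1 + x)"
  define i where "i m = inverse (Q m)" for m
  have x0: "inverse (1 + x) * (1 + x) = 1" using p0[of "Suc n"] by (simp add: x_def)
  have step: "t (Suc n) s - t n s = (-1) ^ Suc s * c * x ^ s * ((1 - q ^ s) / (1 + q ^ s) * i s + x * i s)" for s
  proof -
    have e: "q ^ (s * (n + 1)) = x ^ s" "q ^ (s * (Suc n + 1)) = x ^ s * q ^ s"
      by (simp_all flip: power_mult power_add add: algebra_simps x_def)
    have "inverse (1 + q ^ s) * (1 + q ^ s) = 1" using p0[of s] by simp
    \<comment> \<open>The step as a polynomial identity: u and v stand for the inverses of 1 + x and
      1 + q^s, y for q^s, X for x^s.\<close>
    moreover have "a * (b * ((1 - x) * u) * d) * (2 * v) * (X * y) - a * (b * d) * (2 * v) * X =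
        - 1 * a * (2 * b * u) * X * ((1 - y) * v * d + x * d)"
      if "u * (1 + x) = 1" "v * (1 + y) = 1" for a b d u v X y :: complex
      using that by algebra
    ultimately show ?thesis
      unfolding t_def e QS x_def[symmetric] c_def i_def divide_inverse power_Suc[of "-1"] using x0 by blast
  qed
  \<comment> \<open>For s >= 1, (1 - q^s) / (1 + q^s) times \<open>i s\<close> is
    \<open>i (s - 1)\<close>, so each increment is a difference of consecutive boundary terms; at s
    = 0 the factor 1 - q^0 vanishes.\<close>
  have tele: "(\<Sum>s\<le>K. t (Suc n) s - t n s) = (-1) ^ Suc K * c * x ^ Suc K * i K" for K
  proof (induction K)
    case 0
    show ?case using step[of 0] by (simp add: i_def)
  next
    case (Suc K)
    have e: "(1 - q ^ Suc K) / (1 + q ^ Suc K) * i (Suc K) = i K"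
      using m0[of K] p0[of "Suc K"] by (simp add: QS i_def inverse_eq_divide del: power_Suc)
    have "t (Suc n) (Suc K) - t n (Suc K) = (-1) ^ Suc (Suc K) * c * x ^ Suc K * (i K + x * i (Suc K))"
      using step[of "Suc K"] e by (simp only:)
    thus ?case by (simp only: sum.atMost_Suc Suc) (simp add: algebra_simps)
  qed
  have tt: "t (Suc n) (Suc n) = (-1) ^ Suc n * 2 * inverse (1 + x) * x ^ Suc (Suc n)"
  proof -
    have "q ^ (Suc n * (Suc n + 1)) = x ^ Suc (Suc n)"
      unfolding x_def by (simp only: power_mult[symmetric] Suc_eq_plus1)
    thus ?thesis using Q0 by (simp add: t_def x_def divide_inverse)
  qed
  have cQ: "c * i n = 2 * inverse (1 + x)" using Q0[of n] by (simp add: c_def i_def)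
  have "(\<Sum>s\<le>Suc n. t (Suc n) s) = (\<Sum>s\<le>n. t n s) + (\<Sum>s\<le>n. t (Suc n) s - t n s) + t (Suc n) (Suc n)"
    by (simp add: sum_subtractf)
  \<comment> \<open>The boundary term and the new top term share the factor 2 / (1 + x); their sum
    carries 1 + x, which cancels it.\<close>
  also have "\<dots> = (\<Sum>s\<le>n. t n s) + 2 * ((-1) ^ Suc n * x ^ Suc n)"
  proof -
    have "S + - 1 * a * c * (x * X) * j + - 1 * a * 2 * u * (x * (x * X)) = S + 2 * (- 1 * a * (x * X))"
      if "c * j = 2 * u" "u * (1 + x) = 1" for S a X j u :: complex
      using that by algebra
    from this[OF cQ x0] show ?thesis unfolding tele tt power_Suc .
  qed
  also have "x ^ Suc n = q ^ (Suc n)\<^sup>2"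
    unfolding x_def by (simp only: power_mult[symmetric] power2_eq_square)
  finally show ?case using Suc by (simp add: t_def algebra_simps)
qed

text \<open>Bounds uniform in n for the partial products and their inverses: they give the
  nonvanishing of the generating function and the decay of the remainder in Gauss's
  identity.\<close>

lemma norm_prod_ratio_le:
  fixes q :: complex
  assumes q: "norm q < 1"
  shows "norm (\<Prod>j=1..n. (1 - q ^ j) / (1 + q ^ j)) \<le> exp (2 / (1 - norm q)\<^sup>2)"
    and "norm (inverse (\<Prod>j=1..n. (1 - q ^ j) / (1 + q ^ j))) \<le> exp (2 / (1 - norm q)\<^sup>2)"
proof -
  have le: "norm ((1 + w ^ j) / (1 - w ^ j)) \<le> (1 + norm q ^ j) / (1 - norm q ^ j)"
           "norm ((1 - w ^ j) / (1 + w ^ j)) \<le> (1 + norm q ^ j) / (1 - norm q ^ j)"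
    if "norm w = norm q" "j > 0" for w :: complex and j
  proof -
    have "norm q ^ j < 1" using q that by (simp add: power_less_one_iff)
    moreover have "norm (1 + w ^ j) \<le> 1 + norm q ^ j" "norm (1 - w ^ j) \<le> 1 + norm q ^ j"
      using norm_triangle_ineq[of 1 "w ^ j"] norm_triangle_ineq4[of 1 "w ^ j"] that by (auto simp: norm_power)
    moreover have "1 - norm q ^ j \<le> norm (1 + w ^ j)" "1 - norm q ^ j \<le> norm (1 - w ^ j)"
      using norm_diff_ineq[of 1 "w ^ j"] norm_triangle_ineq2[of 1 "w ^ j"] that by (auto simp: norm_power)
    ultimately show "norm ((1 + w ^ j) / (1 - w ^ j)) \<le> (1 + norm q ^ j) / (1 - norm q ^ j)"
           "norm ((1 - w ^ j) / (1 + w ^ j)) \<le> (1 + norm q ^ j) / (1 - norm q ^ j)"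
      unfolding norm_divide by (auto intro!: frac_le)
  qed
  have "norm (\<Prod>j=1..n. (1 - q ^ j) / (1 + q ^ j)) \<le> (\<Prod>j=1..n. (1 + norm q ^ j) / (1 - norm q ^ j))"
    unfolding prod_norm[symmetric] by (intro prod_mono conjI norm_ge_zero le) auto
  also have "\<dots> \<le> exp (2 / (1 - norm q)\<^sup>2)" using q by (intro prod_ratio_le_exp) auto
  finally show "norm (\<Prod>j=1..n. (1 - q ^ j) / (1 + q ^ j)) \<le> exp (2 / (1 - norm q)\<^sup>2)" .
  have "inverse (\<Prod>j=1..n. (1 - q ^ j) / (1 + q ^ j)) = (\<Prod>j=1..n. (1 + q ^ j) / (1 - q ^ j))"
    by (simp add: prod_inversef[symmetric])
  also have "norm \<dots> \<le> (\<Prod>j=1..n. (1 + norm q ^ j) / (1 - norm q ^ j))"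
    unfolding prod_norm[symmetric] by (intro prod_mono conjI norm_ge_zero le) auto
  also have "\<dots> \<le> exp (2 / (1 - norm q)\<^sup>2)" using q by (intro prod_ratio_le_exp) auto
  finally show "norm (inverse (\<Prod>j=1..n. (1 - q ^ j) / (1 + q ^ j))) \<le> exp (2 / (1 - norm q)\<^sup>2)" .
qed

text \<open>The inverses of the partial products stay bounded, so the partial products, and with
  them their limit, stay away from 0.\<close>

lemma overpart_gf_neq_0:
  assumes q: "norm q < 1"
  shows "overpart_gf q \<noteq> 0"
proof
  assume 0: "overpart_gf q = 0"
  define P where "P = (\<lambda>N. \<Prod>j=1..N. (1 + q ^ j) / (1 - q ^ j))"
  define Q where "Q = (\<lambda>N. \<Prod>j=1..N. (1 - q ^ j) / (1 + q ^ j))"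
  define B where "B = exp (2 / (1 - norm q)\<^sup>2)"
  have "P N * Q N = 1" for N
    using one_plus_power_neq_0[OF q] one_minus_power_neq_0[OF q]
    by (simp add: P_def Q_def flip: prod.distrib)
  hence one: "norm (P N) * norm (Q N) = 1" for N by (metis norm_mult norm_one)
  have QB: "norm (Q N) \<le> B" for N unfolding Q_def B_def by (rule norm_prod_ratio_le[OF q])
  have ge: "1 \<le> norm (P N) * B" for N
    using mult_left_mono[OF QB, of "norm (P N)" N] one[of N] by simp
  have "(\<lambda>N. norm (P N) * B) \<longlonglongrightarrow> norm (overpart_gf q) * B"
    unfolding P_def by (intro tendsto_intros overpart_gf_prod q)
  hence "1 \<le> norm (overpart_gf q) * B" by (rule LIMSEQ_le_const) (use ge in blast)
  thus False using 0 by simp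
qed

text \<open>In the finite form the term s = 0 is \<open>Q n\<close>, which tends to the inverse of
  the generating function. The n terms with s >= 1 are each O(|q|^(n + 1)), and n |q|^n tends to
  0.\<close>

lemma gauss_identity:
  fixes q :: complex
  assumes q: "norm q < 1"
  shows "(\<lambda>n. 1 + 2 * (\<Sum>k=1..n. (-1) ^ k * q ^ k\<^sup>2)) \<longlonglongrightarrow> inverse (overpart_gf q)"
proof -
  define Q where "Q = (\<lambda>n. \<Prod>j=1..n. (1 - q ^ j) / (1 + q ^ j))"
  define B where "B = exp (2 / (1 - norm q)\<^sup>2)"
  define t where "t n s = (-1) ^ s * (Q n / Q s) * (2 / (1 + q ^ s)) * q ^ (s * (n + 1))" for n s
  have "(\<lambda>n. inverse (\<Prod>j=1..n. (1 + q ^ j) / (1 - q ^ j))) \<longlonglongrightarrow> inverse (overpart_gf q)"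
    by (intro tendsto_intros overpart_gf_prod overpart_gf_neq_0 q)
  also have "(\<lambda>n. inverse (\<Prod>j=1..n. (1 + q ^ j) / (1 - q ^ j))) = Q"
    unfolding Q_def by (simp add: prod_inversef[symmetric])
  finally have Q: "Q \<longlonglongrightarrow> inverse (overpart_gf q)" .
  have bound: "norm (t n s) \<le> 2 * B\<^sup>2 / (1 - norm q) * norm q ^ (n + 1)" if "s \<in> {1..n}" for n s
  proof -
    have "norm (q ^ s) \<le> norm q" using q that power_decreasing[of 1 s "norm q"] by (simp add: norm_power)
    hence "1 - norm q \<le> norm (1 + q ^ s)" using norm_diff_ineq[of 1 "q ^ s"] by simp
    hence "norm (2 / (1 + q ^ s)) \<le> 2 / (1 - norm q)"
      using q by (auto simp: norm_divide intro!: frac_le)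
    moreover have "norm (Q n) * norm (inverse (Q s)) \<le> B * B"
      unfolding Q_def B_def by (intro mult_mono norm_prod_ratio_le q) auto
    moreover have "norm q ^ (s * (n + 1)) \<le> norm q ^ (n + 1)"
      using q that by (intro power_decreasing) (auto simp del: mult_Suc_right)
    ultimately have "norm (Q n) * norm (inverse (Q s)) * norm (2 / (1 + q ^ s)) * norm q ^ (s * (n + 1))
       \<le> (B * B) * (2 / (1 - norm q)) * norm q ^ (n + 1)"
      using q by (intro mult_mono[of _ "B * B * (2 / (1 - norm q))"] mult_mono[of _ "B * B"]) auto
    moreover have "norm (t n s) = norm (Q n) * norm (inverse (Q s)) * norm (2 / (1 + q ^ s)) * norm q ^ (s * (n + 1))"
      by (simp add: t_def norm_mult norm_divide norm_power norm_inverse divide_inverse)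
    ultimately show ?thesis by (simp add: power2_eq_square mult_ac)
  qed
  have "(\<lambda>n. \<Sum>s=1..n. t n s) \<longlonglongrightarrow> 0"
  proof (rule Lim_null_comparison)
    show "\<forall>\<^sub>F n in sequentially. norm (\<Sum>s=1..n. t n s) \<le>
        2 * B\<^sup>2 / (1 - norm q) * (real n * norm q ^ n) * norm q"
    proof (intro always_eventually allI)
      fix n
      from sum_norm_bound[of "{1..n}" "t n", OF bound]
      show "norm (\<Sum>s=1..n. t n s) \<le> 2 * B\<^sup>2 / (1 - norm q) * (real n * norm q ^ n) * norm q"
        by (simp add: mult_ac)
    qed
    have "(\<lambda>n. real n * norm q ^ n) \<longlonglongrightarrow> 0" using q by (intro powser_times_n_limit_0) auto
    from tendsto_mult_right[OF tendsto_mult_left[OF this, of "2 * B\<^sup>2 / (1 - norm q)"], of "norm q"]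
    show "(\<lambda>n. 2 * B\<^sup>2 / (1 - norm q) * (real n * norm q ^ n) * norm q) \<longlonglongrightarrow> 0" by simp
  qed
  from tendsto_add[OF Q this] have "(\<lambda>n. Q n + (\<Sum>s=1..n. t n s)) \<longlonglongrightarrow> inverse (overpart_gf q)" by simp
  moreover have "Q n + (\<Sum>s=1..n. t n s) = 1 + 2 * (\<Sum>k=1..n. (-1) ^ k * q ^ k\<^sup>2)" for n
  proof -
    have "(\<Sum>s\<le>n. t n s) = t n 0 + (\<Sum>s=1..n. t n s)"
      by (simp add: atMost_atLeast0 sum.atLeast_Suc_atMost)
    moreover have "t n 0 = Q n" by (simp add: t_def Q_def)
    ultimately show ?thesis using gauss_finite[OF q, of n] by (simp add: t_def Q_def)
  qed
  ultimately show ?thesis by simp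
qed

section \<open>The theta transformation\<close>

text \<open>A roots-of-unity filter sampled at odd multiples, that is, with a half-integer shift.
  The shift produces the sign (-1)^(b div l), and this makes the resulting theta series
  alternate.\<close>

lemma sum_cos_odd_multiples:
  fixes b l :: nat
  assumes l: "l > 0"
  shows "(\<Sum>k<l. cos (pi * (2 * real k + 1) * real b / real l)) =
           (if l dvd b then real l * (-1) ^ (b div l) else 0)"
proof (cases "l dvd b")
  case True
  then obtain j where j: "b = l * j" by blast
  have "cos (pi * (2 * real k + 1) * real b / real l) = (-1) ^ j" for k
  proof -
    have "cos (pi * (2 * real k + 1) * real b / real l) = cos (real ((2 * k + 1) * j) * pi)"
      using l by (intro arg_cong[of _ _ cos]) (simp add: j, simp add: distrib_right)
    also have "\<dots> = (-1) ^ ((2 * k + 1) * j)" by (rule cos_npi)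
    also have "\<dots> = (-1) ^ j" by (simp add: power_add power_mult)
    finally show ?thesis .
  qed
  thus ?thesis using l j by simp
next
  case False
  define x where "x = pi * real b / real l"
  \<comment> \<open>Multiplication by 2 sin x makes the cosine sum telescope; sin x is nonzero
    because l does not divide b.\<close>
  have "2 * sin x * (\<Sum>k<n. cos ((2 * real k + 1) * x)) = sin (2 * real n * x)" for n
  proof (induction n)
    case (Suc n)
    have "sin (2 * real (Suc n) * x) - sin (2 * real n * x) = 2 * sin x * cos ((2 * real n + 1) * x)"
    proof -
      have "(2 * real (Suc n) * x - 2 * real n * x) / 2 = x"
        "(2 * real (Suc n) * x + 2 * real n * x) / 2 = (2 * real n + 1) * x" by (simp_all add: algebra_simps)
      thus ?thesis by (subst sin_diff_sin) (simp only:)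
    qed
    with Suc show ?case by (simp add: algebra_simps)
  qed simp
  moreover have "sin (2 * real l * x) = 0"
    using l sin_2npi[of b] by (simp add: x_def mult_ac)
  moreover have "sin x \<noteq> 0"
  proof
    assume "sin x = 0"
    then obtain i where "x = of_int i * pi" using sin_zero_iff_int2 by blast
    hence "real_of_int (int b) = of_int (i * int l)" using l by (simp add: x_def field_simps)
    hence "int b = i * int l" by (simp only: of_int_eq_iff)
    hence "int l dvd int b" by simp
    thus False using False by simp
  qed
  ultimately have "2 * sin x * (\<Sum>k<l. cos ((2 * real k + 1) * x)) = 0" "2 * sin x \<noteq> 0" by simp_all
  hence "(\<Sum>k<l. cos ((2 * real k + 1) * x)) = 0" by (simp only: mult_eq_0_iff) blast
  thus ?thesis using False by (simp add: x_def mult_ac)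
qed

lemma cos_power_even:
  "(2 * cos x) ^ (2 * m) =
     real (2 * m choose m) + 2 * (\<Sum>b=1..m. real (2 * m choose (m + b)) * cos (2 * real b * x))"
proof -
  have "complex_of_real (2 * cos x) = cis x + cis (- x)" by (simp add: complex_eq_iff)
  hence "complex_of_real ((2 * cos x) ^ (2 * m)) = (cis x + cis (- x)) ^ (2 * m)" by (simp only: of_real_power)
  also have "\<dots> = (\<Sum>a\<le>2*m. of_nat (2 * m choose a) * cis x ^ a * cis (- x) ^ (2 * m - a))"
    by (rule binomial_ring)
  also have "\<dots> = (\<Sum>a\<le>2*m. of_nat (2 * m choose a) * cis ((2 * real a - 2 * real m) * x))"
    by (intro sum.cong refl) (auto simp: Complex.DeMoivre cis_mult of_nat_diff algebra_simps simp del: cis_mult[symmetric])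
  finally have "Re (complex_of_real ((2 * cos x) ^ (2 * m))) = Re \<dots>" by (rule arg_cong)
  hence "(2 * cos x) ^ (2 * m) = (\<Sum>a\<le>2*m. real (2 * m choose a) * cos ((2 * real a - 2 * real m) * x))"
    by (simp only: Re_complex_of_real Re_sum) simp
  also have "{..2*m} = insert m ({..<m} \<union> {m+1..2*m})" by auto
  also have "(\<Sum>a\<in>insert m ({..<m} \<union> {m+1..2*m}). real (2 * m choose a) * cos ((2 * real a - 2 * real m) * x)) =
     real (2 * m choose m) + ((\<Sum>a<m. real (2 * m choose a) * cos ((2 * real a - 2 * real m) * x)) +
     (\<Sum>a=m+1..2*m. real (2 * m choose a) * cos ((2 * real a - 2 * real m) * x)))"
    by (subst sum.insert, simp, simp, subst sum.union_disjoint) auto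
  also have "(\<Sum>a<m. real (2 * m choose a) * cos ((2 * real a - 2 * real m) * x)) =
      (\<Sum>b=1..m. real (2 * m choose (m + b)) * cos (2 * real b * x))"
  proof (rule sum.reindex_bij_witness[of _ "\<lambda>b. m - b" "\<lambda>a. m - a"])
    fix a assume a: "a \<in> {..<m}"
    have "2 * m choose (m + (m - a)) = 2 * m choose a"
      using binomial_symmetric[of a "2 * m"] a by (simp add: mult_2)
    moreover have "cos ((2 * real a - 2 * real m) * x) = cos (- ((2 * real a - 2 * real m) * x))" by simp
    moreover have "- ((2 * real a - 2 * real m) * x) = 2 * real (m - a) * x"
      using a by (simp add: of_nat_diff algebra_simps)
    ultimately show "real (2 * m choose (m + (m - a))) * cos (2 * real (m - a) * x) =
       real (2 * m choose a) * cos ((2 * real a - 2 * real m) * x)" by simp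
  qed auto
  also have "(\<Sum>a=m+1..2*m. real (2 * m choose a) * cos ((2 * real a - 2 * real m) * x)) =
      (\<Sum>b=1..m. real (2 * m choose (m + b)) * cos (2 * real b * x))"
    by (rule sum.reindex_bij_witness[of _ "\<lambda>b. m + b" "\<lambda>a. a - m"]) (auto simp: algebra_simps)
  finally show ?thesis by simp
qed

text \<open>Polya's route to the theta transformation: a roots-of-unity filter applied to the binomial
  expansion of \<open>(2 cos x) ^ (2 m)\<close>, with \<open>m \<sim> l\<^sup>2 / t\<close> and \<open>l \<rightarrow> \<infinity>\<close>.\<close>

lemma polya_identity:
  fixes l m :: nat
  assumes l: "l > 0"
  shows "(\<Sum>k<l. (2 * cos (pi * (2 * real k + 1) / (2 * real l))) ^ (2 * m)) =
           real l * (real (2 * m choose m) + 2 * (\<Sum>j=1..m. (-1) ^ j * real (2 * m choose (m + l * j))))"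
proof -
  have "(\<Sum>k<l. (2 * cos (pi * (2 * real k + 1) / (2 * real l))) ^ (2 * m)) =
     real l * real (2 * m choose m) + 2 * (\<Sum>k<l. \<Sum>b=1..m. real (2 * m choose (m + b)) *
        cos (pi * (2 * real k + 1) * real b / real l))"
  proof -
    have "2 * real b * (pi * (2 * real k + 1) / (2 * real l)) = pi * (2 * real k + 1) * real b / real l" for b k
      by simp
    thus ?thesis
      by (simp only: cos_power_even sum.distrib) (simp flip: sum_distrib_left)
  qed
  also have "(\<Sum>k<l. \<Sum>b=1..m. real (2 * m choose (m + b)) * cos (pi * (2 * real k + 1) * real b / real l)) =
     (\<Sum>b=1..m. real (2 * m choose (m + b)) * (\<Sum>k<l. cos (pi * (2 * real k + 1) * real b / real l)))"
    by (subst sum.swap) (simp add: sum_distrib_left)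
  also have "\<dots> = (\<Sum>b\<in>{b\<in>{1..m}. l dvd b}. real (2 * m choose (m + b)) * (real l * (-1) ^ (b div l)))"
    unfolding sum_cos_odd_multiples[OF l] by (intro sum.mono_neutral_cong_right) auto
  also have "\<dots> = (\<Sum>j\<in>{j\<in>{1..m}. l * j \<le> m}. real (2 * m choose (m + l * j)) * (real l * (-1) ^ j))"
    using l by (intro sum.reindex_bij_witness[of _ "\<lambda>j. l * j" "\<lambda>b. b div l"])
      (auto simp: Suc_le_eq div_greater_zero_iff dvd_imp_le intro: order.trans[OF div_le_dividend])
  \<comment> \<open>For l * j > m the lower index exceeds 2 m, so the added binomials are 0.\<close>
  also have "\<dots> = (\<Sum>j=1..m. real (2 * m choose (m + l * j)) * (real l * (-1) ^ j))"
    by (intro sum.mono_neutral_left) auto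
  finally show ?thesis by (simp add: sum_distrib_left algebra_simps)
qed

text \<open>Valid for all a: beyond a = m both sides are 0, the right one through its factor i =
  m.\<close>

lemma central_binomial_ratio:
  "real (2 * m choose (m + a)) / real (2 * m choose m) = (\<Prod>i<a. (real m - real i) / (real m + real i + 1))"
proof (induction a)
  case (Suc a)
  have "Suc (m + a) * (2 * m choose Suc (m + a)) = (2 * m - (m + a)) * (2 * m choose (m + a))"
    by (simp only: binomial_absorption binomial_absorb_comp)
  hence "real (Suc (m + a)) * real (2 * m choose Suc (m + a)) = real (m - a) * real (2 * m choose (m + a))"
    by (simp only: of_nat_mult[symmetric]) simp
  moreover have "real (m - a) * real (2 * m choose (m + a)) = (real m - real a) * real (2 * m choose (m + a))"
    by (cases "a \<le> m") (auto simp: of_nat_diff)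
  ultimately have "real (2 * m choose (m + Suc a)) = real (2 * m choose (m + a)) * ((real m - real a) / (real m + real a + 1))"
    by (simp add: field_simps)
  with Suc show ?case by (simp flip: Suc times_divide_eq_left)
qed simp

text \<open>The dominating bound for Tannery's theorem: each factor is at most 1 - i / m <= exp (- i
  / m).\<close>

lemma central_binomial_ratio_le:
  assumes m: "m > 0"
  shows "real (2 * m choose (m + a)) / real (2 * m choose m) \<le> exp (- (real a * (real a - 1) / (2 * real m)))"
proof (cases "a \<le> m")
  case True
  have "(\<Prod>i<a. (real m - real i) / (real m + real i + 1)) \<le> (\<Prod>i<a. exp (- (real i / real m)))"
  proof (intro prod_mono conjI)
    fix i assume i: "i \<in> {..<a}"
    show "0 \<le> (real m - real i) / (real m + real i + 1)" using i True by simp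
    have "(real m - real i) / (real m + real i + 1) \<le> (real m - real i) / real m"
      using i True m by (intro divide_left_mono) auto
    also have "\<dots> = 1 + (- (real i / real m))" using m by (simp add: field_simps)
    also have "\<dots> \<le> exp (- (real i / real m))" by (rule exp_ge_add_one_self)
    finally show "(real m - real i) / (real m + real i + 1) \<le> exp (- (real i / real m))" .
  qed
  also have "\<dots> = exp (- ((\<Sum>i<a. real i) / real m))"
    by (simp add: exp_sum[symmetric] sum_negf sum_divide_distrib)
  also have "(\<Sum>i<a. real i) = real a * (real a - 1) / 2"
    by (induction a) (auto simp: field_simps)
  finally show ?thesis unfolding central_binomial_ratio by simp
next
  case False
  thus ?thesis by (simp add: binomial_eq_0)
qed

text \<open>The pointwise limit: for a of order sqrt m the ratio behaves like exp (- a^2 / m). The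
  logarithm of factor i is - (2 i + 1) / m up to O(a^2 / m^2), and the first a odd numbers sum to
  a^2.\<close>

lemma central_binomial_ratio_ln:
  assumes a: "2 * a \<le> m" "m > 0"
  shows "real (2 * m choose (m + a)) / real (2 * m choose m) > 0"
    and "\<bar>ln (real (2 * m choose (m + a)) / real (2 * m choose m)) + real a ^ 2 / real m\<bar> \<le> 4 * real a ^ 3 / real m ^ 2"
proof -
  let ?R = "real (2 * m choose (m + a)) / real (2 * m choose m)"
  show pos: "?R > 0"
    using a by (intro divide_pos_pos) auto
  have fac: "\<bar>ln ((real m - real i) / (real m + real i + 1)) + (2 * real i + 1) / real m\<bar> \<le> 4 * real a ^ 2 / real m ^ 2"
    if "i < a" for i
  proof -
    have m0: "real m > 0" using a by simp
    have i: "real i + 1 \<le> real a" using that by linarith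
    have "real (2 * a) \<le> real m" using a by (simp only: of_nat_le_iff)
    hence i2: "2 * (real i + 1) \<le> real m" using i by simp
    have e1: "1 + (- (real i / real m)) = (real m - real i) / real m"
      and e2: "1 + (real i + 1) / real m = (real m + real i + 1) / real m"
      using m0 by (simp_all add: field_simps)
    have "(real m - real i) / (real m + real i + 1) = (1 + (- (real i / real m))) / (1 + (real i + 1) / real m)"
      unfolding e1 e2 using m0 by simp
    moreover have "1 + (- (real i / real m)) > 0" unfolding e1 using m0 i2 by simp
    moreover have "1 + (real i + 1) / real m > 0" unfolding e2 using m0 by simp
    ultimately have e: "ln ((real m - real i) / (real m + real i + 1)) =
        ln (1 + (- (real i / real m))) - ln (1 + (real i + 1) / real m)"
      by (simp only: ln_divide_pos)
    have "\<bar>ln (1 + (- (real i / real m))) - (- (real i / real m))\<bar> \<le> 2 * (- (real i / real m))\<^sup>2"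
      using m0 i2 by (intro abs_ln_one_plus_x_minus_x_bound) (simp add: pos_divide_le_eq)
    also have "\<dots> \<le> 2 * (real a / real m)\<^sup>2"
      using i m0 by (auto intro!: power_mono divide_right_mono)
    finally have 1: "\<bar>ln (1 + (- (real i / real m))) + real i / real m\<bar> \<le> 2 * (real a / real m)\<^sup>2" by simp
    have "\<bar>ln (1 + (real i + 1) / real m) - (real i + 1) / real m\<bar> \<le> 2 * ((real i + 1) / real m)\<^sup>2"
      using m0 i2 by (intro abs_ln_one_plus_x_minus_x_bound) (simp add: pos_divide_le_eq)
    also have "\<dots> \<le> 2 * (real a / real m)\<^sup>2"
      using i m0 by (intro mult_left_mono power_mono divide_right_mono) auto
    finally have 2: "\<bar>ln (1 + (real i + 1) / real m) - (real i + 1) / real m\<bar> \<le> 2 * (real a / real m)\<^sup>2" .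
    have 3: "(2 * real i + 1) / real m = real i / real m + (real i + 1) / real m" by (simp add: add_divide_distrib)
    have 4: "4 * real a ^ 2 / real m ^ 2 = 2 * (real a / real m)\<^sup>2 + 2 * (real a / real m)\<^sup>2" by (simp add: power_divide)
    show ?thesis unfolding e 3 4 using 1 2 by linarith
  qed
  have "ln (?R) = (\<Sum>i<a. ln ((real m - real i) / (real m + real i + 1)))"
    unfolding central_binomial_ratio using a by (intro ln_prod) auto
  moreover have "(\<Sum>i<a. (2 * real i + 1) / real m) = real a ^ 2 / real m"
    unfolding sum_divide_distrib[symmetric] by (induction a) (auto simp: power2_eq_square field_simps)
  ultimately have "\<bar>ln (?R) + real a ^ 2 / real m\<bar> =
     \<bar>\<Sum>i<a. ln ((real m - real i) / (real m + real i + 1)) + (2 * real i + 1) / real m\<bar>"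
    by (simp add: sum.distrib)
  also have "\<dots> \<le> (\<Sum>i<a. 4 * real a ^ 2 / real m ^ 2)"
    by (intro order.trans[OF sum_abs] sum_mono fac) auto
  also have "\<dots> = 4 * real a ^ 3 / real m ^ 2" by (simp add: power3_eq_cube power2_eq_square)
  finally show "\<bar>ln (?R) + real a ^ 2 / real m\<bar> \<le> 4 * real a ^ 3 / real m ^ 2" .
qed

text \<open>The square of the normalised central binomial, times 2 m + 1, is the reciprocal of the
  m-th partial Wallis product.\<close>

lemma central_binomial_asymp:
  "(\<lambda>m. sqrt (real m) * real (2 * m choose m) / 4 ^ m) \<longlonglongrightarrow> 1 / sqrt pi"
proof -
  define c where "c m = real (2 * m choose m) / 4 ^ m" for m
  have cS: "c (Suc m) = c m * ((2 * real m + 1) / (2 * real m + 2))" for m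
  proof -
    have "real (2 * Suc m choose Suc m) = real (2 * m choose m) * (2 * (2 * real m + 1) / (real m + 1))"
    proof -
      have "real (2 * Suc m choose Suc m) = fact (Suc (Suc (2 * m))) / (fact (Suc m) * fact (Suc m))"
      proof -
        have "2 * Suc m = Suc (Suc (2 * m))" "Suc (Suc (2 * m)) - Suc m = Suc m" by simp_all
        thus ?thesis using binomial_fact[of "Suc m" "2 * Suc m", where 'a = real] by simp
      qed
      also have "\<dots> = fact (2 * m) / (fact m * fact m) * (2 * (2 * real m + 1) / (real m + 1))"
        unfolding fact_Suc by (simp add: divide_simps) (simp add: algebra_simps)
      also have "fact (2 * m) / (fact m * fact m) = real (2 * m choose m)"
        using binomial_fact[of m "2 * m", where 'a = real] by (simp add: mult_2)
      finally show ?thesis .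
    qed
    thus ?thesis unfolding c_def by (simp only: power_Suc) (simp add: divide_simps, simp add: algebra_simps)
  qed
  have w: "c m ^ 2 * (2 * real m + 1) = inverse (\<Prod>k=1..m. (4 * real k ^ 2) / (4 * real k ^ 2 - 1))" for m
  proof (induction m)
    case (Suc m)
    have "c (Suc m) ^ 2 * (2 * real (Suc m) + 1) =
       (c m ^ 2 * (2 * real m + 1)) * ((2 * real m + 1) * (2 * real m + 3) / (2 * real m + 2) ^ 2)"
      unfolding cS by (simp add: power_mult_distrib power_divide) (simp add: power2_eq_square algebra_simps)
    also have "(2 * real m + 1) * (2 * real m + 3) / (2 * real m + 2) ^ 2 =
        inverse ((4 * real (Suc m) ^ 2) / (4 * real (Suc m) ^ 2 - 1))"
      by (simp add: power2_eq_square algebra_simps)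
    finally show ?case unfolding Suc by (simp add: inverse_eq_divide)
  qed (simp add: c_def)
  have "(\<lambda>m. inverse (\<Prod>k=1..m. (4 * real k ^ 2) / (4 * real k ^ 2 - 1))) \<longlonglongrightarrow> inverse (pi / 2)"
    by (intro tendsto_intros wallis) auto
  hence "(\<lambda>m. c m ^ 2 * (2 * real m + 1)) \<longlonglongrightarrow> inverse (pi / 2)" by (simp add: w)
  moreover have "(\<lambda>m. real m / (2 * real m + 1)) \<longlonglongrightarrow> 1 / 2" by real_asymp
  ultimately have "(\<lambda>m. c m ^ 2 * (2 * real m + 1) * (real m / (2 * real m + 1))) \<longlonglongrightarrow> inverse (pi / 2) * (1 / 2)"
    by (rule tendsto_mult)
  also have "(\<lambda>m. c m ^ 2 * (2 * real m + 1) * (real m / (2 * real m + 1))) = (\<lambda>m. real m * c m ^ 2)"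
    by (auto simp: fun_eq_iff field_simps)
  finally have "(\<lambda>m. sqrt (real m * c m ^ 2)) \<longlonglongrightarrow> sqrt (inverse (pi / 2) * (1 / 2))"
    by (rule tendsto_real_sqrt)
  thus ?thesis by (simp add: real_sqrt_mult real_sqrt_divide c_def real_sqrt_inverse inverse_eq_divide)
qed

text \<open>The difference has derivative x sin x. It serves the Gaussian bound on the cosine and a
  lower bound on the sine on the vertical line.\<close>

lemma mult_cos_le_sin:
  fixes z :: real
  assumes z: "0 \<le> z" "z \<le> pi"
  shows "z * cos z \<le> sin z"
proof -
  have "sin 0 - 0 * cos 0 \<le> sin z - z * cos z"
  proof (rule DERIV_nonneg_imp_nondecreasing[OF z(1)])
    fix x assume "0 \<le> x" "x \<le> z"
    hence "0 \<le> x * sin x" using z by (intro mult_nonneg_nonneg sin_ge_zero) auto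
    moreover have "((\<lambda>x. sin x - x * cos x) has_real_derivative x * sin x) (at x)"
      by (auto intro!: derivative_eq_intros)
    ultimately show "\<exists>d. ((\<lambda>x. sin x - x * cos x) has_real_derivative d) (at x) \<and> 0 \<le> d" by blast
  qed
  thus ?thesis by simp
qed

lemma cos_le_exp:
  fixes y :: real
  assumes "0 \<le> y" "y \<le> pi"
  shows "cos y \<le> exp (- (y\<^sup>2 / 2))"
proof -
  have "cos y * exp (y\<^sup>2 / 2) \<le> cos 0 * exp (0\<^sup>2 / 2)"
  proof (rule DERIV_nonpos_imp_nonincreasing[OF assms(1)])
    fix x assume x: "0 \<le> x" "x \<le> y"
    have "((\<lambda>x. cos x * exp (x\<^sup>2 / 2)) has_real_derivative - (sin x - x * cos x) * exp (x\<^sup>2 / 2)) (at x)"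
      by (auto intro!: derivative_eq_intros simp: algebra_simps)
    moreover have "- (sin x - x * cos x) * exp (x\<^sup>2 / 2) \<le> 0"
      using mult_cos_le_sin[of x] x assms by (intro mult_nonpos_nonneg) auto
    ultimately show "\<exists>d. ((\<lambda>x. cos x * exp (x\<^sup>2 / 2)) has_real_derivative d) (at x) \<and> d \<le> 0" by blast
  qed
  thus ?thesis by (simp add: exp_minus field_simps)
qed

text \<open>Tannery's theorem states its domination on a product filter; the bounds here hold for
  all k at once.\<close>

lemma eventually_prod_sequentiallyI:
  assumes "\<forall>\<^sub>F p in F. \<forall>k. P k p"
  shows "\<forall>\<^sub>F (k, p) in sequentially \<times>\<^sub>F F. P k p"
  unfolding eventually_prod_filter
  by (rule exI[of _ "\<lambda>_. True"], rule exI[of _ "\<lambda>p. \<forall>k. P k p"]) (use assms in auto)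

text \<open>The limits needed for Polya's identity with l = 2 p and m close to l^2 / t. An even l
  lets the reflection k -> l - 1 - k split the cosine sum into two equal halves. With this m the
  k-th cosine power tends to exp (- pi^2 (k + 1/2)^2 / t) and the j-th binomial ratio to exp (- t
  j^2); Tannery's theorem handles both sums.\<close>

lemma theta_sides_limits:
  fixes t :: real
  assumes t: "t > 0"
  defines "m \<equiv> (\<lambda>p::nat. nat \<lfloor>4 * real p ^ 2 / t\<rfloor>)"
  shows "(\<lambda>p. \<Sum>k<p. cos (pi * (2 * real k + 1) / (4 * real p)) ^ (2 * m p)) \<longlonglongrightarrow>
           (\<Sum>k. exp (- (pi\<^sup>2 * (real k + 1/2)\<^sup>2 / t)))"
    and "(\<lambda>p. \<Sum>j. (-1) ^ j * (real (2 * m p choose (m p + 2 * p * j)) / real (2 * m p choose m p))) \<longlonglongrightarrow>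
           (\<Sum>j. (-1) ^ j * exp (- (t * real j ^ 2)))"
    and "summable (\<lambda>j. (-1) ^ j * exp (- (t * real j ^ 2)))"
    and "(\<lambda>p. sqrt (real (m p)) / real p) \<longlonglongrightarrow> 2 / sqrt t"
    and "filterlim m at_top at_top"
proof -
  have m_lim: "(\<lambda>p. real (m p) / real p ^ 2) \<longlonglongrightarrow> 4 / t"
    unfolding m_def using t by real_asymp (simp add: field_simps)
  show m_top: "filterlim m at_top at_top"
    unfolding m_def using t by real_asymp
  have m_le: "real (m p) \<le> 4 * real p ^ 2 / t" for p
    unfolding m_def using t by (simp add: of_nat_nat)
  \<comment> \<open>Half of the limiting constant 4 / t, enough for domination.\<close>
  have m_ge: "\<forall>\<^sub>F p in sequentially. 2 * real p ^ 2 / t \<le> real (m p)"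
  proof -
    have "\<forall>\<^sub>F p in sequentially. 2 / t < real (m p) / real p ^ 2"
      using t by (intro order_tendstoD(1)[OF m_lim] divide_strict_right_mono) auto
    thus ?thesis using eventually_gt_at_top[of 0]
      by eventually_elim (simp add: pos_less_divide_eq less_imp_le)
  qed
  have m_pos: "\<forall>\<^sub>F p in sequentially. m p > 0"
    using m_top unfolding filterlim_at_top by (auto simp: Suc_le_eq dest: spec[of _ "Suc 0"])
  have "(\<lambda>p. sqrt (real (m p) / real p ^ 2)) \<longlonglongrightarrow> sqrt (4 / t)"
    by (rule tendsto_real_sqrt[OF m_lim])
  thus "(\<lambda>p. sqrt (real (m p)) / real p) \<longlonglongrightarrow> 2 / sqrt t"
    by (simp add: real_sqrt_divide)
  let ?e = "\<lambda>k. exp (- (pi\<^sup>2 * (real k + 1/2)\<^sup>2 / t))"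
  let ?c = "\<lambda>k p. cos (pi * (2 * real k + 1) / (4 * real p)) ^ (2 * m p)"
  let ?a = "\<lambda>k p. if k < p then ?c k p else 0"
  have "(\<lambda>p. \<Sum>k. ?a k p) \<longlonglongrightarrow> (\<Sum>k. ?e k)"
  proof (rule tannerys_theorem[THEN conjunct2, THEN conjunct2])
    fix k
    define c where "c = pi * (2 * real k + 1) / 4"
    have "(\<lambda>p. real p ^ 2 * ln (cos (c / real p))) \<longlonglongrightarrow> - (c\<^sup>2 / 2)"
      by real_asymp (simp add: field_simps power2_eq_square)
    from tendsto_mult[OF tendsto_mult_left[OF m_lim, of 2] this]
    have "(\<lambda>p. exp (2 * (real (m p) / real p ^ 2) * (real p ^ 2 * ln (cos (c / real p))))) \<longlonglongrightarrow>
        exp (2 * (4 / t) * - (c\<^sup>2 / 2))" by (rule tendsto_exp)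
    also have "2 * (4 / t) * - (c\<^sup>2 / 2) = - (pi\<^sup>2 * (real k + 1/2)\<^sup>2 / t)"
      using t by (simp add: c_def power2_eq_square field_simps)
    finally show "(\<lambda>p. ?a k p) \<longlonglongrightarrow> ?e k"
    proof (rule Lim_transform_eventually)
      have "(\<lambda>p. cos (c / real p)) \<longlonglongrightarrow> 1" by real_asymp
      hence "\<forall>\<^sub>F p in sequentially. cos (c / real p) > 0" by (rule order_tendstoD) simp
      thus "\<forall>\<^sub>F p in sequentially. exp (2 * (real (m p) / real p ^ 2) * (real p ^ 2 * ln (cos (c / real p)))) = ?a k p"
        using eventually_gt_at_top[of k]
      proof eventually_elim
        case (elim p)
        have "exp (2 * (real (m p) / real p ^ 2) * (real p ^ 2 * ln (cos (c / real p)))) =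
            exp (real (2 * m p) * ln (cos (c / real p)))" using elim by simp
        also have "\<dots> = cos (c / real p) ^ (2 * m p)" using elim by (simp only: exp_of_nat_mult exp_ln)
        finally show ?case using elim by (simp add: c_def)
      qed
    qed
  next
    \<comment> \<open>From m y^2 >= (2 p^2 / t) y^2 = pi^2 (k + 1/2)^2 / (2 t), followed by (k +
      1/2)^2 >= k.\<close>
    let ?c = "pi\<^sup>2 / (2 * t)"
    have c0: "?c > 0" using t by simp
    have "summable (\<lambda>k. exp (- ?c) ^ k)" using c0 by (intro summable_geometric) simp
    thus "summable (\<lambda>k. exp (- (?c * real k)))" by (simp add: mult.commute flip: exp_of_nat_mult)
    have "\<forall>\<^sub>F p in sequentially. \<forall>k. norm (?a k p) \<le> exp (- (?c * real k))"
      using m_ge eventually_gt_at_top[of 0]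
    proof eventually_elim
      case (elim p)
      show ?case
      proof
        fix k
        define y where "y = pi * (2 * real k + 1) / (4 * real p)"
        show "norm (?a k p) \<le> exp (- (?c * real k))"
        proof (cases "k < p")
          case True
          hence "2 * real k + 1 \<le> 2 * real p" by linarith
          hence "pi * (2 * real k + 1) \<le> pi * (2 * real p)" by (intro mult_left_mono) auto
          hence y2: "y \<le> pi / 2" using elim by (simp add: y_def field_simps)
          have y0: "0 \<le> y" by (simp add: y_def)
          have "\<bar>cos y ^ (2 * m p)\<bar> = cos y ^ (2 * m p)" by (simp add: power_mult)
          also have "\<dots> \<le> exp (- (y\<^sup>2 / 2)) ^ (2 * m p)"
            using y0 y2 by (intro power_mono cos_le_exp cos_ge_zero) auto
          also have "\<dots> = exp (- (real (m p) * y\<^sup>2))" by (simp flip: exp_of_nat_mult)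
          also have "\<dots> \<le> exp (- (2 * real p ^ 2 / t * y\<^sup>2))"
            using elim by (intro exp_le_cancel_iff[THEN iffD2] le_imp_neg_le mult_right_mono) auto
          also have "2 * real p ^ 2 / t * y\<^sup>2 = ?c * (real k + 1/2)\<^sup>2"
            using elim t by (simp add: y_def power2_eq_square field_simps)
          also have "exp (- (?c * (real k + 1/2)\<^sup>2)) \<le> exp (- (?c * real k))"
            using c0 by (intro exp_le_cancel_iff[THEN iffD2] le_imp_neg_le mult_left_mono)
              (auto simp: power2_eq_square algebra_simps)
          finally show ?thesis using True by (simp add: y_def)
        qed simp
      qed
    qed
    thus "\<forall>\<^sub>F (k, p) in sequentially \<times>\<^sub>F sequentially. norm (?a k p) \<le> exp (- (?c * real k))"
      by (rule eventually_prod_sequentiallyI)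
  qed auto
  moreover have "(\<Sum>k. ?a k p) = (\<Sum>k<p. ?c k p)" for p
    by (subst suminf_finite[of "{..<p}"]) auto
  ultimately show "(\<lambda>p. \<Sum>k<p. ?c k p) \<longlonglongrightarrow>
           (\<Sum>k. ?e k)" by simp
  let ?r = "\<lambda>j p. real (2 * m p choose (m p + 2 * p * j)) / real (2 * m p choose m p)"
  have tan2: "(\<forall>\<^sub>F p in sequentially. summable (\<lambda>j. norm ((-1) ^ j * ?r j p))) \<and>
     summable (\<lambda>j. norm ((-1) ^ j * exp (- (t * real j ^ 2)))) \<and>
     (\<lambda>p. \<Sum>j. (-1) ^ j * ?r j p) \<longlonglongrightarrow> (\<Sum>j. (-1) ^ j * exp (- (t * real j ^ 2)))"
  proof (rule tannerys_theorem)
    fix j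
    have ev: "\<forall>\<^sub>F p in sequentially. 2 * (2 * p * j) \<le> m p"
    proof -
      have "(\<lambda>p. 4 * real j / real p * (1 / 1)) \<longlonglongrightarrow> 0" by real_asymp
      hence "\<forall>\<^sub>F p in sequentially. 4 * real j / real p < 2 / t" using t by (intro order_tendstoD) auto
      thus ?thesis using m_ge eventually_gt_at_top[of 0]
      proof eventually_elim
        case (elim p)
        have "4 * real j * real p \<le> 2 * real p ^ 2 / t" using elim t by (simp add: field_simps power2_eq_square)
        hence "real (2 * (2 * p * j)) \<le> real (m p)" using elim by (simp add: mult_ac)
        thus ?case by (simp only: of_nat_le_iff)
      qed
    qed
    have lim1: "(\<lambda>p. real (2 * p * j) ^ 2 / real (m p)) \<longlonglongrightarrow> t * real j ^ 2"
    proof -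
      have "(\<lambda>p. 4 * real j ^ 2 * inverse (real (m p) / real p ^ 2)) \<longlonglongrightarrow> 4 * real j ^ 2 * inverse (4 / t)"
        using t by (intro tendsto_intros m_lim) auto
      moreover have "4 * real j ^ 2 * inverse (real (m p) / real p ^ 2) = real (2 * p * j) ^ 2 / real (m p)" for p
        by (simp add: power_mult_distrib mult_ac)
      ultimately show ?thesis using t by (simp only:) (simp add: mult.commute)
    qed
    have lim2: "(\<lambda>p. 4 * real (2 * p * j) ^ 3 / real (m p) ^ 2) \<longlonglongrightarrow> 0"
    proof -
      have "(\<lambda>p. 32 * real j ^ 3 * inverse (real (m p) / real p ^ 2) ^ 2 * (1 / real p)) \<longlonglongrightarrow>
          32 * real j ^ 3 * inverse (4 / t) ^ 2 * 0"
        using t by (intro tendsto_intros m_lim lim_1_over_n) auto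
      moreover have "\<forall>\<^sub>F p in sequentially. 32 * real j ^ 3 * inverse (real (m p) / real p ^ 2) ^ 2 * (1 / real p) =
          4 * real (2 * p * j) ^ 3 / real (m p) ^ 2"
        using eventually_gt_at_top[of 0]
        by eventually_elim (simp add: power_mult_distrib field_simps power2_eq_square power3_eq_cube)
      ultimately show ?thesis by (simp add: Lim_transform_eventually)
    qed
    have "(\<lambda>p. ln (?r j p) + real (2 * p * j) ^ 2 / real (m p)) \<longlonglongrightarrow> 0"
    proof (rule Lim_null_comparison[OF _ lim2])
      show "\<forall>\<^sub>F p in sequentially. norm (ln (?r j p) + real (2 * p * j) ^ 2 / real (m p)) \<le> 4 * real (2 * p * j) ^ 3 / real (m p) ^ 2"
        using ev m_pos by eventually_elim (simp only: real_norm_def central_binomial_ratio_ln)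
    qed
    from tendsto_diff[OF this lim1] have "(\<lambda>p. exp (ln (?r j p))) \<longlonglongrightarrow> exp (- (t * real j ^ 2))"
      by (intro tendsto_exp) simp
    hence "(\<lambda>p. ?r j p) \<longlonglongrightarrow> exp (- (t * real j ^ 2))"
    proof (rule Lim_transform_eventually)
      show "\<forall>\<^sub>F p in sequentially. exp (ln (?r j p)) = ?r j p"
        using ev m_pos by eventually_elim (rule exp_ln, rule central_binomial_ratio_ln(1))
    qed
    thus "(\<lambda>p. (-1) ^ j * ?r j p) \<longlonglongrightarrow> (-1) ^ j * exp (- (t * real j ^ 2))" by (rule tendsto_mult_left)
  next
    have "summable (\<lambda>j. exp t * exp (- t) ^ j)" using t by (intro summable_mult summable_geometric) simp
    thus "summable (\<lambda>j. exp (t - t * real j))" by (simp add: mult.commute exp_diff exp_minus field_simps flip: exp_of_nat_mult)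
    have "\<forall>\<^sub>F p in sequentially. \<forall>j. norm ((-1) ^ j * ?r j p) \<le> exp (t - t * real j)"
      using m_pos eventually_gt_at_top[of 0]
    proof eventually_elim
      case (elim p)
      show ?case
      proof
        fix j
        let ?a = "real (2 * p * j)"
        have "norm ((-1) ^ j * ?r j p) = ?r j p" by (simp only: norm_mult norm_power) simp
        also have "\<dots> \<le> exp (- (?a * (?a - 1) / (2 * real (m p))))" by (rule central_binomial_ratio_le[OF elim(1)])
        also have "\<dots> \<le> exp (t - t * real j)"
        proof (cases "j = 0")
          case False
          hence j1: "real j \<ge> 1" by linarith
          \<comment> \<open>With a = 2 p j, a - 1 >= 2 p (j - 1) and m <= 4 p^2 / t, the exponent is
            at least t j (j - 1) / 2. This is at least t (j - 1), because (j - 1) (j - 2) >= 0 for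
            integers j >= 1.\<close>
          have "t * (real j - 1) * (real j - 2) \<ge> 0 \<or> j = 1" using j1 t
            by (cases "j = 1") (auto intro!: mult_nonneg_nonneg)
          hence A: "t * (real j - 1) \<le> t * real j * (real j - 1) / 2" using t by (auto simp: algebra_simps)
          have "2 * real p * (real j - 1) \<le> ?a - 1" using elim by (simp add: algebra_simps)
          hence "?a * (2 * real p * (real j - 1)) \<le> ?a * (?a - 1)" by (intro mult_left_mono) auto
          moreover have "t * u * v / 2 * (8 * w ^ 2 / t) = 2 * w * u * (2 * w * v)" for u v w :: real
            using t by (simp add: power2_eq_square)
          ultimately have "t * real j * (real j - 1) / 2 * (8 * real p ^ 2 / t) \<le> ?a * (?a - 1)" by simp
          moreover have "t * real j * (real j - 1) / 2 * (2 * real (m p)) \<le> t * real j * (real j - 1) / 2 * (8 * real p ^ 2 / t)"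
            using m_le[of p] t j1 by (intro mult_left_mono) auto
          ultimately have "t * real j * (real j - 1) / 2 \<le> ?a * (?a - 1) / (2 * real (m p))"
            using elim by (subst pos_le_divide_eq) auto
          with A have "t * (real j - 1) \<le> ?a * (?a - 1) / (2 * real (m p))" by (rule order.trans)
          thus ?thesis by (simp only: exp_le_cancel_iff) (simp only: algebra_simps)
        qed (use t in simp)
        finally show "norm ((-1) ^ j * ?r j p) \<le> exp (t - t * real j)" .
      qed
    qed
    thus "\<forall>\<^sub>F (j, p) in sequentially \<times>\<^sub>F sequentially. norm ((-1) ^ j * ?r j p) \<le> exp (t - t * real j)"
      by (rule eventually_prod_sequentiallyI)
  qed auto
  from tan2 show "(\<lambda>p. \<Sum>j. (-1) ^ j * ?r j p) \<longlonglongrightarrow> (\<Sum>j. (-1) ^ j * exp (- (t * real j ^ 2)))" by blast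
  from tan2 have "summable (\<lambda>j. norm ((-1) ^ j * exp (- (t * real j ^ 2))))" by blast
  thus "summable (\<lambda>j. (-1) ^ j * exp (- (t * real j ^ 2)))" by (rule summable_norm_cancel)
qed

text \<open>Polya's identity divided by 4^m and rescaled by sqrt m / p: one side tends to a multiple
  of the sum of Gaussians, the other to the alternating series with the factor 1 / sqrt pi of the
  central binomial. The two limits must agree.\<close>

lemma theta_transformation:
  fixes t :: real
  assumes t: "t > 0"
  shows "(\<lambda>n. 1 + 2 * (\<Sum>k=1..n. (-1) ^ k * exp (- t) ^ k\<^sup>2)) \<longlonglongrightarrow>
           2 * sqrt (pi / t) * (\<Sum>k. exp (- (pi\<^sup>2 * (real k + 1/2)\<^sup>2 / t)))"
proof -
  define m where "m p = nat \<lfloor>4 * real p ^ 2 / t\<rfloor>" for p :: nat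
  note lims = theta_sides_limits[OF t, folded m_def]
  define r where "r j p = real (2 * m p choose (m p + 2 * p * j)) / real (2 * m p choose m p)" for j p
  let ?c = "\<lambda>k p. cos (pi * (2 * real k + 1) / (4 * real p)) ^ (2 * m p)"
  define C where "C p = (\<Sum>k<p. ?c k p)" for p
  define c where "c p = sqrt (real (m p)) * real (2 * m p choose m p) / 4 ^ m p" for p
  define E where "E = (\<Sum>k. exp (- (pi\<^sup>2 * (real k + 1/2)\<^sup>2 / t)))"
  define T where "T = (\<Sum>j. (-1) ^ j * exp (- (t * real j ^ 2)))"
  have id: "sqrt (real (m p)) / real p * C p = c p * (2 * (\<Sum>j. (-1) ^ j * r j p) - 1)" if p: "p > 0" for p
  proof -
    \<comment> \<open>The angle turns into pi minus itself, and the even exponent removes the sign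
      of the cosine.\<close>
    have refl: "?c (2 * p - 1 - k) p =
        ?c k p" if "k < p" for k
    proof -
      have "pi * (2 * real (2 * p - 1 - k) + 1) / (4 * real p) = pi - pi * (2 * real k + 1) / (4 * real p)"
        using that p by (simp add: of_nat_diff field_simps)
      thus ?thesis by (simp add: power_mult)
    qed
    have refl': "?c (2 * p - 1 - k) p =
        ?c k p" if "p \<le> k" "k < 2 * p" for k
      using refl[of "2 * p - 1 - k"] that by simp
    have "(\<Sum>k<2*p. ?c k p) =
       C p + (\<Sum>k\<in>{p..<2*p}. ?c k p)"
      unfolding C_def by (subst sum.union_disjoint[symmetric]) (auto intro!: sum.cong)
    also have "(\<Sum>k\<in>{p..<2*p}. ?c k p) = C p"
      unfolding C_def
      by (rule sum.reindex_bij_witness[of _ "\<lambda>k. 2 * p - 1 - k" "\<lambda>k. 2 * p - 1 - k"])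
         (use p refl' in auto)
    finally have half: "(\<Sum>k<2*p. ?c k p) = 2 * C p" by simp
    have "(\<Sum>k<2*p. (2 * cos (pi * (2 * real k + 1) / (4 * real p))) ^ (2 * m p)) = 4 ^ m p * (2 * C p)"
      unfolding half[symmetric] sum_distrib_left by (rule sum.cong) (simp_all add: power_mult_distrib power_mult)
    hence eq: "4 ^ m p * (2 * C p) = 2 * real p * (real (2 * m p choose m p) +
        2 * (\<Sum>j=1..m p. (-1) ^ j * real (2 * m p choose (m p + 2 * p * j))))"
      using polya_identity[of "2 * p" "m p"] p by simp
    have Bpos: "real (2 * m p choose m p) > 0" by simp
    have "(\<Sum>j. (-1) ^ j * r j p) = (\<Sum>j\<le>m p. (-1) ^ j * r j p)"
    proof (rule suminf_finite)
      fix j assume "j \<notin> {..m p}"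
      moreover have "j \<le> 2 * p * j" using p by simp
      ultimately have "m p < 2 * p * j" by (meson atMost_iff leD leI order.trans)
      hence "2 * m p < m p + 2 * p * j" by linarith
      thus "(-1) ^ j * r j p = 0" by (simp add: r_def binomial_eq_0)
    qed simp
    also have "\<dots> = 1 + (\<Sum>j=1..m p. (-1) ^ j * r j p)"
      by (simp add: atMost_atLeast0 sum.atLeast_Suc_atMost r_def)
    finally have "2 * (\<Sum>j. (-1) ^ j * r j p) - 1 = 1 + 2 * (\<Sum>j=1..m p. (-1) ^ j * r j p)" by simp
    moreover have "real (2 * m p choose m p) * (1 + 2 * (\<Sum>j=1..m p. (-1) ^ j * r j p)) =
       real (2 * m p choose m p) + 2 * (\<Sum>j=1..m p. (-1) ^ j * real (2 * m p choose (m p + 2 * p * j)))"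
      using Bpos by (simp add: r_def distrib_left sum_distrib_left mult_ac)
    ultimately have "4 ^ m p * (2 * C p) = 2 * real p * (real (2 * m p choose m p) * (2 * (\<Sum>j. (-1) ^ j * r j p) - 1))"
      using eq by (simp only:)
    hence "C p = real p * (real (2 * m p choose m p) * (2 * (\<Sum>j. (-1) ^ j * r j p) - 1)) / 4 ^ m p"
      by (simp add: eq_divide_eq mult.commute)
    thus ?thesis using p by (simp add: c_def)
  qed
  have "(\<lambda>p. sqrt (real (m p)) / real p * C p) \<longlonglongrightarrow> 2 / sqrt t * E"
    unfolding C_def E_def by (intro tendsto_mult lims)
  moreover have "c \<longlonglongrightarrow> 1 / sqrt pi"
    unfolding c_def by (rule filterlim_compose[OF central_binomial_asymp lims(5)])
  hence "(\<lambda>p. c p * (2 * (\<Sum>j. (-1) ^ j * r j p) - 1)) \<longlonglongrightarrow> 1 / sqrt pi * (2 * T - 1)"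
    unfolding r_def T_def by (intro tendsto_intros lims)
  hence "(\<lambda>p. sqrt (real (m p)) / real p * C p) \<longlonglongrightarrow> 1 / sqrt pi * (2 * T - 1)"
    by (rule Lim_transform_eventually) (use eventually_gt_at_top[of 0] in eventually_elim, simp only: id)
  ultimately have "2 / sqrt t * E = 1 / sqrt pi * (2 * T - 1)" by (rule LIMSEQ_unique)
  hence val: "2 * T - 1 = 2 * sqrt (pi / t) * E" using t by (simp add: real_sqrt_divide field_simps)
  have "(\<lambda>n. 2 * (\<Sum>k\<le>n. (-1) ^ k * exp (- (t * real k ^ 2))) - 1) \<longlonglongrightarrow> 2 * T - 1"
    using summable_LIMSEQ'[OF lims(3)] unfolding T_def by (intro tendsto_intros)
  moreover have "2 * (\<Sum>k\<le>n. (-1) ^ k * exp (- (t * real k ^ 2))) - 1 = 1 + 2 * (\<Sum>k=1..n. (-1) ^ k * exp (- t) ^ k\<^sup>2)" for n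
    by (simp add: atMost_atLeast0 sum.atLeast_Suc_atMost mult.commute flip: exp_of_nat_mult)
  ultimately show ?thesis unfolding val E_def by simp
qed

section \<open>The modular relation in the right half-plane\<close>

text \<open>Jacobi's theta_2 of nome w without its factor 2 w^(1/4); splitting off the fractional
  power leaves a function that is single-valued on the disc.\<close>

definition theta_series :: "complex \<Rightarrow> complex" where
  "theta_series w = (\<Sum>k. w ^ (k * (k + 1)))"

lemma theta_series_sums:
  assumes "norm w < 1"
  shows "(\<lambda>k. w ^ (k * (k + 1))) sums theta_series w"
proof -
  have "summable (\<lambda>k. norm (w ^ (k * (k + 1))))"
  proof (rule summable_comparison_test')
    show "summable (\<lambda>k. norm w ^ k)" using assms by (intro summable_geometric) auto
    show "norm (norm (w ^ (k * (k + 1)))) \<le> norm w ^ k" for k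
      using assms power_decreasing[of k "k * (k + 1)" "norm w"] by (simp add: norm_power)
  qed
  thus ?thesis unfolding theta_series_def by (intro summable_sums) (rule summable_norm_cancel)
qed

text \<open>A power series with coefficients 0 and 1: the exponents k (k + 1) are strictly
  increasing, so the sum can be reindexed.\<close>

lemma theta_series_holomorphic: "theta_series holomorphic_on ball 0 1"
proof (rule power_series_holomorphic)
  fix w :: complex assume w: "w \<in> ball 0 1"
  let ?g = "\<lambda>k::nat. k * (k + 1)"
  let ?f = "\<lambda>n. (if n \<in> range ?g then 1 else 0) * (w - 0) ^ n"
  have "(\<lambda>k. ?f (?g k)) sums theta_series w"
    using theta_series_sums[of w] w by simp
  thus "?f sums theta_series w"
    by (subst (asm) sums_mono_reindex) (auto simp: strict_mono_Suc_iff)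
qed

lemma norm_theta_series_minus_1:
  assumes w: "norm w \<le> 1 / 2"
  shows "norm (theta_series w - 1) \<le> 2 * norm w ^ 2"
proof -
  let ?f = "\<lambda>k. w ^ (k * (k + 1))"
  have s: "(\<lambda>k. ?f (Suc k)) sums (theta_series w - 1)"
    using theta_series_sums[of w] w by (subst sums_Suc_iff) auto
  have g: "(\<lambda>k. norm w ^ 2 * norm w ^ k) sums (norm w ^ 2 * (1 / (1 - norm w)))"
    using w by (intro sums_mult geometric_sums) auto
  have le: "norm (?f (Suc k)) \<le> norm w ^ 2 * norm w ^ k" for k
    using w unfolding power_add[symmetric] norm_power by (intro power_decreasing) auto
  have "norm (theta_series w - 1) \<le> norm w ^ 2 * (1 / (1 - norm w))"
    by (rule norm_sums_le[OF s g le])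
  also have "\<dots> \<le> norm w ^ 2 * 2"
    using w by (intro mult_left_mono) (auto simp: field_simps)
  finally show ?thesis by simp
qed

lemma overpart_gf_holomorphic: "overpart_gf holomorphic_on ball 0 1"
  by (rule power_series_holomorphic[where a = "\<lambda>n. of_real (overpart n)"])
     (use overpart_gf_sums in simp)

text \<open>Gauss's identity joined with the theta transformation through (k + 1/2)^2 = k (k + 1) +
  1/4. The product form keeps theta values out of denominators, so that both sides are holomorphic
  when t becomes complex.\<close>

lemma overpart_gf_modular_real:
  fixes t :: real
  assumes t: "t > 0"
  shows "overpart_gf (exp (- of_real t)) *
     (2 * exp (- (of_real (pi\<^sup>2) / (4 * of_real t))) * theta_series (exp (- (of_real (pi\<^sup>2) / of_real t)))) =
     csqrt (of_real t / of_real pi)"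
proof -
  define q where "q = exp (- of_real t :: complex)"
  define w where "w = exp (- (of_real (pi\<^sup>2) / of_real t) :: complex)"
  define E where "E = (\<Sum>k. exp (- (pi\<^sup>2 * (real k + 1/2)\<^sup>2 / t)))"
  have qr: "q = of_real (exp (- t))" by (simp add: q_def flip: exp_of_real)
  have q1: "norm q < 1" using t by (simp add: qr)
  have wr: "w = of_real (exp (- (pi\<^sup>2 / t)))" by (simp add: w_def flip: exp_of_real)
  have w1: "norm w < 1" using t by (simp add: wr)
  have "(\<lambda>n. complex_of_real (1 + 2 * (\<Sum>k=1..n. (-1) ^ k * exp (- t) ^ k\<^sup>2))) \<longlonglongrightarrow>
      complex_of_real (2 * sqrt (pi / t) * E)"
    unfolding E_def by (intro tendsto_of_real theta_transformation t)
  hence "(\<lambda>n. 1 + 2 * (\<Sum>k=1..n. (-1) ^ k * q ^ k\<^sup>2)) \<longlonglongrightarrow> complex_of_real (2 * sqrt (pi / t) * E)"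
    by (simp add: qr)
  from LIMSEQ_unique[OF this gauss_identity[OF q1]]
  have inv: "inverse (overpart_gf q) = complex_of_real (2 * sqrt (pi / t) * E)" by simp
  have "(\<lambda>k. of_real (exp (- (pi\<^sup>2 / (4 * t)))) * w ^ (k * (k + 1))) sums
      (of_real (exp (- (pi\<^sup>2 / (4 * t)))) * theta_series w)"
    by (intro sums_mult theta_series_sums w1)
  moreover have "of_real (exp (- (pi\<^sup>2 / (4 * t)))) * w ^ (k * (k + 1)) =
      complex_of_real (exp (- (pi\<^sup>2 * (real k + 1/2)\<^sup>2 / t)))" for k
  proof -
    have "exp (- (pi\<^sup>2 * (real k + 1/2)\<^sup>2 / t)) = exp (- (pi\<^sup>2 / (4 * t))) * exp (real (k * (k + 1)) * (- (pi\<^sup>2 / t)))"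
      unfolding exp_add[symmetric] using t by (intro arg_cong[of _ _ exp]) (simp add: power2_eq_square field_simps)
    thus ?thesis unfolding exp_of_nat_mult by (simp add: wr)
  qed
  ultimately have s: "(\<lambda>k. complex_of_real (exp (- (pi\<^sup>2 * (real k + 1/2)\<^sup>2 / t)))) sums
      (of_real (exp (- (pi\<^sup>2 / (4 * t)))) * theta_series w)" by simp
  have "summable (\<lambda>k. exp (- (pi\<^sup>2 * (real k + 1/2)\<^sup>2 / t)))"
    using sums_Re[OF s] by (simp only: Re_complex_of_real sums_iff)
  hence "(\<lambda>k. complex_of_real (exp (- (pi\<^sup>2 * (real k + 1/2)\<^sup>2 / t)))) sums of_real E"
    unfolding E_def by (intro sums_of_real summable_sums)
  with s have "complex_of_real E = of_real (exp (- (pi\<^sup>2 / (4 * t)))) * theta_series w"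
    using sums_unique2 by blast
  hence E: "complex_of_real E = exp (- (of_real (pi\<^sup>2) / (4 * of_real t))) * theta_series w"
    by (simp flip: exp_of_real)
  have "overpart_gf q * inverse (overpart_gf q) = 1" using overpart_gf_neq_0[OF q1] by simp
  hence "overpart_gf q * (of_real (sqrt (pi / t)) * (2 * complex_of_real E)) = 1" unfolding inv by (simp add: mult_ac)
  hence "of_real (sqrt (pi / t) * sqrt (t / pi)) * (overpart_gf q * (2 * complex_of_real E)) = complex_of_real (sqrt (t / pi))"
    by (metis (no_types, lifting) mult.assoc mult.commute mult_1 of_real_mult)
  moreover have "sqrt (pi / t) * sqrt (t / pi) = 1"
    using t by (simp flip: real_sqrt_mult)
  moreover have "csqrt (of_real t / of_real pi) = complex_of_real (sqrt (t / pi))"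
    using t by (simp flip: of_real_divide)
  ultimately show ?thesis by (simp add: E q_def w_def mult_ac)
qed

lemma exp_neg_recip_less_1:
  assumes "Re t > 0" "c > 0"
  shows "norm (exp (- (of_real c / t))) < 1"
proof -
  have "Re (1 / t) > 0" using assms by (auto simp: Re_divide sum_power2_gt_zero_iff)
  hence "c * Re (1 / t) > 0" using assms by simp
  also have "c * Re (1 / t) = Re (of_real c * (1 / t))"
    by (simp only: Re_complex_of_real Im_complex_of_real times_complex.sel mult_zero_left diff_zero)
  finally have "Re (of_real c * (1 / t)) > 0" .
  thus ?thesis by simp
qed

text \<open>For Re t > 0 the point t / pi stays off the branch cut of \<open>csqrt\<close>, so both
  sides are holomorphic. They agree on the positive reals, which accumulate at 1.\<close>

lemma overpart_gf_modular:
  assumes t: "Re t > 0"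
  shows "overpart_gf (exp (- t)) *
     (2 * exp (- (of_real (pi\<^sup>2) / (4 * t))) * theta_series (exp (- (of_real (pi\<^sup>2) / t)))) =
     csqrt (t / of_real pi)"
proof -
  define S where "S = {z. Re z > 0}"
  define f where "f = (\<lambda>t. overpart_gf (exp (- t)) *
     (2 * exp (- (of_real (pi\<^sup>2) / (4 * t))) * theta_series (exp (- (of_real (pi\<^sup>2) / t)))) - csqrt (t / of_real pi))"
  have n0: "z \<noteq> 0" if "z \<in> S" for z using that by (auto simp: S_def)
  have h1: "(\<lambda>t. overpart_gf (exp (- t))) holomorphic_on S"
    by (rule holomorphic_on_compose_gen[OF _ overpart_gf_holomorphic, unfolded o_def])
       (auto intro!: holomorphic_intros simp: S_def)
  have h2: "(\<lambda>t. theta_series (exp (- (of_real (pi\<^sup>2) / t)))) holomorphic_on S"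
  proof (rule holomorphic_on_compose_gen[OF _ theta_series_holomorphic, unfolded o_def])
    show "(\<lambda>t. exp (- (of_real (pi\<^sup>2) / t))) holomorphic_on S"
      using n0 by (intro holomorphic_intros) auto
    show "(\<lambda>t. exp (- (of_real (pi\<^sup>2) / t))) ` S \<subseteq> ball 0 1"
      using exp_neg_recip_less_1[of _ "pi\<^sup>2"] by (auto simp: S_def simp del: norm_exp_eq_Re of_real_power)
  qed
  have h3: "(\<lambda>t. csqrt (t / of_real pi)) holomorphic_on S"
    by (intro holomorphic_intros) (auto simp: S_def complex_nonpos_Reals_iff zero_less_divide_iff not_le)
  have hol: "f holomorphic_on S"
    unfolding f_def using n0 by (intro holomorphic_intros h1 h2 h3) auto
  have "f t = 0"
  proof (rule analytic_continuation[OF hol, of "of_real ` {0<..}" 1])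
    show "open S" unfolding S_def by (rule open_halfspace_Re_gt)
    show "connected S" unfolding S_def by (intro convex_connected convex_halfspace_Re_gt)
    show "of_real ` {0<..} \<subseteq> S" "1 \<in> S" "t \<in> S" using t by (auto simp: S_def)
    show "f z = 0" if "z \<in> of_real ` {0<..}" for z
      using that overpart_gf_modular_real by (auto simp: f_def)
    show "(1::complex) islimpt of_real ` {0<..}"
      unfolding islimpt_approachable
    proof (intro allI impI)
      fix e :: real assume e: "e > 0"
      have "of_real (1 + e / 2) \<noteq> (1::complex)" using e
        by (metis add_cancel_right_right divide_eq_0_iff less_irrefl of_real_eq_1_iff zero_neq_numeral)
      moreover have "dist (of_real (1 + e / 2)) (1::complex) < e"
        using e by (simp add: dist_norm del: of_real_divide)
      ultimately show "\<exists>x'\<in>of_real ` {0<..}. x' \<noteq> (1::complex) \<and> dist x' 1 < e"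
        using e by (intro bexI[of _ "of_real (1 + e / 2)"]) (auto simp del: of_real_add)
    qed
  qed
  thus ?thesis by (simp add: f_def)
qed

text \<open>After multiplication by exp (n t), the terms of index below n integrate to exponentials
  of period 2 pi i, and those above n to a function of q = exp (- t). Only the term of index n, a
  constant, integrates to something that is not periodic, namely \<open>overpart n\<close> times
  t.\<close>

lemma overpart_primitive:
  obtains \<Phi> where
    "\<And>t. Re t > 0 \<Longrightarrow> (\<Phi> has_field_derivative overpart_gf (exp (- t)) * exp (of_nat n * t)) (at t)"
    "\<And>t. \<Phi> (t + 2 * of_real pi * \<i>) - \<Phi> t = 2 * of_real pi * \<i> * of_real (overpart n)"
proof -
  define R where "R q = (\<Sum>j. of_real (overpart (j + (n + 1))) * q ^ j :: complex)" for q
  have R: "(\<lambda>j. of_real (overpart (j + (n + 1))) * q ^ j) sums R q" if q: "norm q < 1" for q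
  proof (cases "q = 0")
    case False
    have "summable (\<lambda>j. of_real (overpart (j + (n + 1))) * q ^ (j + (n + 1)))"
      using overpart_gf_sums[OF q] by (subst summable_iff_shift) (simp add: sums_iff)
    from summable_mult[OF this, of "inverse (q ^ (n + 1))"] False
    have "summable (\<lambda>j. of_real (overpart (j + (n + 1))) * q ^ j)"
      by (simp add: power_add field_simps)
    thus ?thesis unfolding R_def by (rule summable_sums)
  qed (simp add: R_def summable_sums)
  have "R holomorphic_on ball 0 1"
    by (rule power_series_holomorphic[where a = "\<lambda>j. of_real (overpart (j + (n + 1)))"]) (use R in simp)
  then obtain G where G: "\<And>q. q \<in> ball 0 1 \<Longrightarrow> (G has_field_derivative R q) (at q within ball 0 1)"
    using holomorphic_convex_primitive'[OF convex_ball open_ball] by blast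
  have G': "(G has_field_derivative R q) (at q)" if "norm q < 1" for q
    using G[of q] that by (simp add: at_within_open[OF _ open_ball])
  have split: "overpart_gf q = (\<Sum>k<n. of_real (overpart k) * q ^ k) + of_real (overpart n) * q ^ n + q ^ (n + 1) * R q"
    if q: "norm q < 1" for q
  proof -
    have "(\<lambda>j. q ^ (n + 1) * (of_real (overpart (j + (n + 1))) * q ^ j)) sums (q ^ (n + 1) * R q)"
      by (intro sums_mult R q)
    hence "(\<lambda>j. of_real (overpart (j + (n + 1))) * q ^ (j + (n + 1))) sums (q ^ (n + 1) * R q)"
      by (simp add: power_add mult_ac)
    moreover have "(\<lambda>j. of_real (overpart (j + (n + 1))) * q ^ (j + (n + 1))) sums
        (overpart_gf q - (\<Sum>k<n+1. of_real (overpart k) * q ^ k))"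
      using overpart_gf_sums[OF q] by (subst sums_iff_shift) simp
    ultimately have "overpart_gf q - (\<Sum>k<n+1. of_real (overpart k) * q ^ k) = q ^ (n + 1) * R q"
      using sums_unique2 by blast
    thus ?thesis by (simp add: algebra_simps)
  qed
  define \<Phi> where "\<Phi> t = of_real (overpart n) * t +
      (\<Sum>k<n. of_real (overpart k) * exp (of_nat (n - k) * t) / of_nat (n - k)) - G (exp (- t))" for t
  show ?thesis
  proof (rule that[of \<Phi>])
    fix t :: complex assume t: "Re t > 0"
    have q: "norm (exp (- t)) < 1" using t by simp
    have "((\<lambda>t. G (exp (- t))) has_field_derivative R (exp (- t)) * (exp (- t) * (- 1))) (at t)"
      by (rule DERIV_chain'[where f = "\<lambda>t. exp (- t)"]) (auto intro!: derivative_eq_intros G' q simp: t)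
    hence "(\<Phi> has_field_derivative (of_real (overpart n) +
       (\<Sum>k<n. of_real (overpart k) * exp (of_nat (n - k) * t)) + R (exp (- t)) * exp (- t))) (at t)"
      unfolding \<Phi>_def
      by - (rule derivative_eq_intros refl | assumption | simp add: mult.commute)+
    moreover have "of_real (overpart n) + (\<Sum>k<n. of_real (overpart k) * exp (of_nat (n - k) * t)) + R (exp (- t)) * exp (- t) =
       overpart_gf (exp (- t)) * exp (of_nat n * t)"
    proof -
      have e: "exp (- t) ^ k * exp (of_nat n * t) = exp (of_nat (n - k) * t)" if "k \<le> n" for k
        unfolding exp_of_nat_mult[symmetric] exp_add[symmetric] using that by (simp add: of_nat_diff algebra_simps)
      have e1: "exp (- t) ^ n * exp (of_nat n * t) = 1" using e[of n] by simp
      have "overpart_gf (exp (- t)) * exp (of_nat n * t) =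
         (\<Sum>k<n. of_real (overpart k) * (exp (- t) ^ k * exp (of_nat n * t))) +
         of_real (overpart n) * (exp (- t) ^ n * exp (of_nat n * t)) + (exp (- t) ^ n * exp (of_nat n * t)) * (exp (- t) * R (exp (- t)))"
      proof -
        have "(A + b * y + z * y * r) * E = A * E + b * (y * E) + (y * E) * (z * r)" for A b y z r E :: complex
          by algebra
        thus ?thesis unfolding split[OF q] by (simp add: sum_distrib_right mult.assoc)
      qed
      also have "(\<Sum>k<n. of_real (overpart k) * (exp (- t) ^ k * exp (of_nat n * t))) =
          (\<Sum>k<n. of_real (overpart k) * exp (of_nat (n - k) * t))"
        by (intro sum.cong refl) (simp add: e)
      finally show ?thesis unfolding e1 by (simp add: algebra_simps)
    qed
    ultimately show "(\<Phi> has_field_derivative overpart_gf (exp (- t)) * exp (of_nat n * t)) (at t)" by simp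
  next
    fix t :: complex
    have p1: "exp (- (t + 2 * of_real pi * \<i>)) = exp (- t)"
      by (simp add: exp_add exp_diff exp_minus mult_ac)
    have p2: "exp (of_nat j * (t + 2 * of_real pi * \<i>)) = exp (of_nat j * t)" for j
      unfolding exp_of_nat_mult by (simp add: exp_add mult_ac)
    show "\<Phi> (t + 2 * of_real pi * \<i>) - \<Phi> t = 2 * of_real pi * \<i> * of_real (overpart n)"
      unfolding \<Phi>_def p1 p2 by (simp add: algebra_simps)
  qed
qed

section \<open>The circle method\<close>

text \<open>The real part of a holomorphic primitive of exp (- z^2), normalised to vanish at 0,
  which makes it odd; its limit at infinity is the Gaussian integral.\<close>

lemma gaussian_primitive:
  obtains G :: "real \<Rightarrow> real" where
    "\<And>u. (G has_real_derivative exp (- u\<^sup>2)) (at u)"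
    "\<And>u. G (- u) = - G u"
    "\<And>u. 1 \<le> u \<Longrightarrow> \<bar>G u - sqrt pi / 2\<bar> \<le> exp (- u\<^sup>2)"
proof -
  have "(\<lambda>z::complex. exp (- z\<^sup>2)) holomorphic_on UNIV" by (intro holomorphic_intros)
  then obtain g :: "complex \<Rightarrow> complex" where g: "\<And>z. (g has_field_derivative exp (- z\<^sup>2)) (at z)"
    by (rule holomorphic_convex_primitive'[OF convex_UNIV open_UNIV]) (simp, blast)
  define G where "G u = Re (g (of_real u)) - Re (g 0)" for u :: real
  have dG: "(G has_real_derivative exp (- u\<^sup>2)) (at u)" for u
  proof -
    have "((\<lambda>u. Re (g (of_real u))) has_vector_derivative Re (exp (- (of_real u)\<^sup>2))) (at u)"
      by (rule bounded_linear.has_vector_derivative[OF bounded_linear_Re has_vector_derivative_real_field[OF g]])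
    also have "Re (exp (- (of_real u)\<^sup>2)) = exp (- u\<^sup>2)"
      by (simp only: of_real_power[symmetric] of_real_minus[symmetric] exp_of_real Re_complex_of_real)
    finally show ?thesis unfolding G_def
      by (auto intro!: derivative_eq_intros simp: has_real_derivative_iff_has_vector_derivative)
  qed
  have odd: "G (- u) = - G u" for u
  proof -
    have "((\<lambda>u. G u + G (- u)) has_real_derivative 0) (at u)" for u
    proof -
      have "((\<lambda>u. G (- u)) has_real_derivative exp (- (- u)\<^sup>2) * (- 1)) (at u)"
        by (rule DERIV_chain2[OF dG]) (auto intro!: derivative_eq_intros)
      from DERIV_add[OF dG this] show ?thesis by simp
    qed
    hence "G u + G (- u) = G 0 + G (- 0)" using DERIV_isconst_all by blast
    thus ?thesis by (simp add: G_def)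
  qed
  have lim: "(G \<longlongrightarrow> sqrt pi / 2) at_top"
  proof -
    let ?f = "\<lambda>x::real. indicator {0..} x *\<^sub>R exp (- x\<^sup>2)"
    have int: "integrable lborel ?f" "integral\<^sup>L lborel ?f = sqrt pi / 2"
      using gaussian_moment_0 by (auto simp: has_bochner_integral_iff)
    have "((\<lambda>y. \<integral>x. indicator {..y} x *\<^sub>R ?f x \<partial>lborel) \<longlongrightarrow> sqrt pi / 2) at_top"
      using tendsto_integral_at_top[OF _ int(1)] unfolding int(2) by simp
    moreover have "\<forall>\<^sub>F y in at_top. (\<integral>x. indicator {..y} x *\<^sub>R ?f x \<partial>lborel) = G y"
      using eventually_ge_at_top[of 0]
    proof eventually_elim
      case (elim y)
      have "(\<integral>x. indicator {..y} x *\<^sub>R ?f x \<partial>lborel) = (\<integral>x. exp (- x\<^sup>2) * indicator {0..y} x \<partial>lborel)"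
        by (intro Bochner_Integration.integral_cong) (auto split: split_indicator)
      also have "\<dots> = G y - G 0"
        using elim dG by (intro integral_FTC_Icc_real) (auto intro!: continuous_intros)
      finally show ?case by (simp add: G_def)
    qed
    ultimately show ?thesis by (rule Lim_transform_eventually)
  qed
  have bound: "\<bar>G u - sqrt pi / 2\<bar> \<le> exp (- u\<^sup>2)" if u: "1 \<le> u" for u
  proof -
    have up: "G u \<le> G v" if "u \<le> v" for v
      using that dG by (intro DERIV_nonneg_imp_nondecreasing[OF that]) (auto intro!: exI[of _ "exp (- _)"])
    have "G u \<le> sqrt pi / 2"
      by (rule tendsto_lowerbound[OF lim]) (rule eventually_mono[OF eventually_ge_at_top up], simp_all)
    \<comment> \<open>The derivative (1 - 2 w) exp (- w^2) is nonpositive from w = 1/2 on.\<close>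
    moreover have down: "G v + exp (- v\<^sup>2) \<le> G u + exp (- u\<^sup>2)" if "u \<le> v" for v
    proof (rule DERIV_nonpos_imp_nonincreasing[OF that])
      fix w assume w: "u \<le> w" "w \<le> v"
      have "((\<lambda>v. G v + exp (- v\<^sup>2)) has_real_derivative (1 - 2 * w) * exp (- w\<^sup>2)) (at w)"
        by (auto intro!: derivative_eq_intros dG simp: algebra_simps)
      moreover have "(1 - 2 * w) * exp (- w\<^sup>2) \<le> 0" using u w by (intro mult_nonpos_nonneg) auto
      ultimately show "\<exists>d. ((\<lambda>v. G v + exp (- v\<^sup>2)) has_real_derivative d) (at w) \<and> d \<le> 0" by blast
    qed
    have "sqrt pi / 2 \<le> G u + exp (- u\<^sup>2)"
    proof (rule tendsto_upperbound[OF lim])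
      have "G v \<le> G u + exp (- u\<^sup>2)" if "u \<le> v" for v
        using down[OF that] exp_ge_zero[of "- v\<^sup>2"] by linarith
      thus "\<forall>\<^sub>F v in at_top. G v \<le> G u + exp (- u\<^sup>2)"
        by (rule eventually_mono[OF eventually_ge_at_top])
    qed simp
    ultimately show ?thesis by (simp add: abs_le_iff)
  qed
  show ?thesis using that[OF dG odd bound] .
qed

text \<open>In the modular relation the theta factor has modulus at least 1/2 and the square root at
  most 1, so only the exponential remains.\<close>

lemma norm_overpart_gf_real_le:
  fixes X :: real
  assumes X: "0 < X" "X \<le> pi" and w: "exp (- (pi\<^sup>2 / X)) \<le> 1 / 2"
  shows "norm (overpart_gf (of_real (exp (- X)))) \<le> exp (pi\<^sup>2 / (4 * X))"
proof -
  define w :: complex where "w = exp (- (of_real (pi\<^sup>2) / of_real X))"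
  have wr: "w = of_real (exp (- (pi\<^sup>2 / X)))" by (simp add: w_def flip: exp_of_real)
  have nw: "norm w \<le> 1 / 2" using assms(3) by (simp add: wr)
  have "norm (theta_series w - 1) \<le> 2 * norm w ^ 2" by (rule norm_theta_series_minus_1[OF nw])
  also have "\<dots> \<le> 2 * (1 / 2) ^ 2" using nw by (intro mult_left_mono power_mono) auto
  finally have "norm (1 - theta_series w) \<le> 1 / 2" by (simp add: norm_minus_commute power2_eq_square)
  hence "1 / 2 \<le> norm (theta_series w)"
    using norm_triangle_ineq2[of 1 "1 - theta_series w"] by simp
  hence th: "1 \<le> 2 * norm (theta_series w)" by simp
  have e: "exp (- (of_real (pi\<^sup>2) / (4 * of_real X))) = complex_of_real (exp (- (pi\<^sup>2 / (4 * X))))"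
    by (simp flip: exp_of_real)
  have "norm (overpart_gf (exp (- of_real X))) * (2 * exp (- (pi\<^sup>2 / (4 * X))) * norm (theta_series w)) =
      norm (csqrt (of_real X / of_real pi))"
  proof -
    have "overpart_gf (exp (- of_real X)) * (2 * of_real (exp (- (pi\<^sup>2 / (4 * X)))) * theta_series w) =
        csqrt (of_real X / of_real pi)"
      using overpart_gf_modular[of "of_real X"] X unfolding w_def[symmetric] e by simp
    from arg_cong[OF this, of norm] show ?thesis by (simp only: norm_mult norm_of_real abs_exp_cancel norm_numeral)
  qed
  also have "csqrt (of_real X / of_real pi) = complex_of_real (sqrt (X / pi))"
    using X by (simp flip: of_real_divide)
  also have "norm \<dots> \<le> 1" using X by simp
  finally have le: "norm (overpart_gf (exp (- of_real X))) * exp (- (pi\<^sup>2 / (4 * X))) * (2 * norm (theta_series w)) \<le> 1"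
    by (simp add: mult_ac)
  have "norm (overpart_gf (exp (- of_real X))) * exp (- (pi\<^sup>2 / (4 * X))) * 1 \<le>
      norm (overpart_gf (exp (- of_real X))) * exp (- (pi\<^sup>2 / (4 * X))) * (2 * norm (theta_series w))"
    by (intro mult_left_mono th) auto
  with le have "norm (overpart_gf (exp (- of_real X))) * exp (- (pi\<^sup>2 / (4 * X))) \<le> 1" by linarith
  thus ?thesis by (simp add: exp_minus field_simps flip: exp_of_real)
qed

text \<open>On the part of the vertical line beyond the arc, the first term of the Lambert-type series for
  \<open>ln |P(q)|\<close> alone already saves enough.\<close>

lemma overpart_gf_minor_arc:
  fixes X y :: real
  assumes X: "0 < X" "X \<le> 1 / 8" and w: "exp (- (pi\<^sup>2 / X)) \<le> 1 / 2"
    and y: "sqrt 3 * X \<le> \<bar>y\<bar>" "\<bar>y\<bar> \<le> pi"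
  shows "norm (overpart_gf (exp (- Complex X y))) \<le> exp (pi\<^sup>2 / (4 * X) + 2 - 94 / 100 / X)"
proof -
  let ?t = "Complex X y"
  let ?q = "exp (- ?t)"
  have nq: "norm ?q = exp (- X)" by simp
  have "?q / (1 - ?q) = 1 / (exp ?t - 1)"
  proof -
    have "norm ?q \<noteq> 1" using X by simp
    hence "?q \<noteq> 1" by (metis norm_one)
    hence "1 - ?q \<noteq> 0" by simp
    moreover have "exp ?t * ?q = 1" by (simp flip: exp_add)
    hence "exp ?t - 1 = (1 - ?q) / ?q" by (simp add: field_simps)
    ultimately show ?thesis by simp
  qed
  hence "Re (?q / (1 - ?q)) \<le> norm (1 / (exp ?t - 1))" using complex_Re_le_cmod by simp
  also have "\<dots> \<le> 53 / 100 / X"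
  proof -
    \<comment> \<open>Half of the smallest admissible |y|; sin (|y| / 2) >= sin u because |y| / 2
      lies between u and pi / 2.\<close>
    define u where "u = sqrt 3 * X / 2"
    have "sqrt 3 \<le> 2" by (rule real_le_lsqrt) auto
    hence "sqrt 3 * X \<le> 2 * X" using X by (intro mult_right_mono) auto
    hence u: "u \<le> 1 / 8" using X unfolding u_def by linarith
    have u0: "0 \<le> u" using X by (simp add: u_def)
    have pi3: "3 < pi" using pi_approx by simp
    have "sin u \<le> u" using u u0 by (intro sin_x_le_x)
    moreover have "0 \<le> sin u" using u u0 pi3 by (intro sin_ge_zero) auto
    ultimately have "(sin u)\<^sup>2 \<le> (1 / 8)\<^sup>2" using u u0 by (intro power_mono) auto
    hence "19 / 20 \<le> (cos u)\<^sup>2" unfolding cos_squared_eq by (simp add: power_divide)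
    also have "(cos u)\<^sup>2 \<le> cos u * 1"
      unfolding power2_eq_square using u u0 pi3 by (intro mult_left_mono cos_ge_zero) auto
    finally have "19 / 20 * u \<le> u * cos u" using u0 mult_left_mono[of "19 / 20" "cos u" u] by simp
    also have "\<dots> \<le> sin u" using u u0 pi3 by (intro mult_cos_le_sin) auto
    also have "\<dots> \<le> sin (\<bar>y\<bar> / 2)" using y u u0 by (intro sin_monotone_2pi_le) (auto simp: u_def)
    finally have "(19 / 20 * u)\<^sup>2 \<le> (sin (\<bar>y\<bar> / 2))\<^sup>2" using u u0 by (intro power_mono) auto
    moreover have "(sin (\<bar>y\<bar> / 2))\<^sup>2 = (sin (y / 2))\<^sup>2" by (cases "y \<ge> 0") auto
    moreover have "u\<^sup>2 = 3 / 4 * X\<^sup>2" by (simp add: u_def power_mult_distrib power_divide)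
    moreover have "(19 / 20 * u)\<^sup>2 = 361 / 400 * u\<^sup>2" by (simp add: power_mult_distrib power_divide)
    \<comment> \<open>The constant is 4 * (361/400) * (3/4) = 2.7075, rounded down. Since 1 + 2.706
      >= 1 / 0.53^2, it leads to the constant 53/100.\<close>
    ultimately have s: "2706 / 1000 * X\<^sup>2 \<le> 4 * (sin (y / 2))\<^sup>2"
      using zero_le_power2[of X] by linarith
    have c: "1 - cos y = 2 * (sin (y / 2))\<^sup>2" using cos_double_sin[of "y / 2"] by simp
    have "(norm (exp ?t - 1))\<^sup>2 = (exp X * cos y - 1)\<^sup>2 + (exp X * sin y)\<^sup>2"
      by (simp add: cmod_power2 Re_exp Im_exp)
    also have "\<dots> = (exp X)\<^sup>2 * ((cos y)\<^sup>2 + (sin y)\<^sup>2) - 2 * exp X * cos y + 1"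
      by algebra
    also have "\<dots> = (exp X - 1)\<^sup>2 + 2 * exp X * (1 - cos y)"
      by (simp add: power2_eq_square algebra_simps)
    also have "\<dots> \<ge> X\<^sup>2 + 4 * (sin (y / 2))\<^sup>2"
    proof (intro add_mono power_mono)
      show "X \<le> exp X - 1" using exp_ge_add_one_self[of X] by linarith
      show "4 * (sin (y / 2))\<^sup>2 \<le> 2 * exp X * (1 - cos y)"
        unfolding c using X by (simp add: mult_right_mono[of 1 "exp X"] mult.assoc[symmetric]
            mult_le_cancel_right1)
    qed (use X in auto)
    finally have ge: "X\<^sup>2 + 4 * (sin (y / 2))\<^sup>2 \<le> (norm (exp ?t - 1))\<^sup>2" .
    have "(X / (53 / 100))\<^sup>2 \<le> (norm (exp ?t - 1))\<^sup>2"
    proof -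
      have "(X / (53 / 100))\<^sup>2 = 10000 / 2809 * X\<^sup>2" by (simp add: power_divide)
      thus ?thesis using ge s zero_le_power2[of X] by linarith
    qed
    hence "X / (53 / 100) \<le> norm (exp ?t - 1)" by (rule power2_le_imp_le) simp
    moreover have "X / (53 / 100) > 0" using X by simp
    ultimately have "1 / norm (exp ?t - 1) \<le> 1 / (X / (53 / 100))" by (intro frac_le) auto
    thus ?thesis by (simp add: norm_divide)
  qed
  finally have 1: "Re (?q / (1 - ?q)) \<le> 53 / 100 / X" .
  have 2: "1 / X - 1 \<le> exp (- X) / (1 - exp (- X))"
  proof -
    have "(1 - X) \<le> exp (- X)" using exp_ge_add_one_self[of "- X"] by simp
    hence "(1 - X) * (1 - exp (- X)) \<le> X * exp (- X)" by (simp add: algebra_simps)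
    moreover have "1 - exp (- X) > 0" using X by simp
    ultimately show ?thesis using X by (simp add: field_simps)
  qed
  \<comment> \<open>The factor gained has exponent 2 (0.53 / X - 1 / X + 1) = 2 - 0.94 / X.\<close>
  have "norm (overpart_gf ?q) \<le> norm (overpart_gf (of_real (exp (- X)))) *
      exp (2 * (Re (?q / (1 - ?q)) - exp (- X) / (1 - exp (- X))))"
    using norm_overpart_gf_le[of ?q] X by simp
  also have "\<dots> \<le> exp (pi\<^sup>2 / (4 * X)) * exp (2 * (53 / 100 / X - (1 / X - 1)))"
    using X w 1 2 pi_approx by (intro mult_mono norm_overpart_gf_real_le) auto
  also have "\<dots> = exp (pi\<^sup>2 / (4 * X) + 2 - 94 / 100 / X)"
    unfolding exp_add[symmetric] using X by (intro arg_cong[of _ _ exp]) (simp add: field_simps)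
  finally show ?thesis .
qed

text \<open>On the circle, n t and pi^2 / (4 t) are (S / 2) exp (2 i phi) and (S / 2) exp (- 2 i
  phi), with sum S cos (2 phi); the factor 2 i t is the derivative of t in phi. The theta factor
  differs from 1 by O(exp (- 2 S)), because its argument has modulus at most exp (- S), and
  multiplied by exp S this leaves exp (- S).\<close>

lemma overpart_gf_arc:
  fixes n :: nat and S x \<phi> :: real
  assumes S: "S = pi * sqrt (real n)" "20 \<le> S" and x: "x = pi\<^sup>2 / (2 * S)"
    and \<phi>: "\<bar>\<phi>\<bar> \<le> pi / 6"
  defines "t \<equiv> of_real x * exp (2 * \<i> * of_real \<phi>)"
  shows "norm (overpart_gf (exp (- t)) * exp (of_nat n * t) * (2 * \<i> * t) -
           \<i> * of_real (x * sqrt (x / pi)) * exp (3 * \<i> * of_real \<phi>) * of_real (exp (S * cos (2 * \<phi>))))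
         \<le> 4 * (x * sqrt (x / pi)) * exp (- S)"
proof -
  have S0: "S > 0" using S by simp
  have x0: "x > 0" using S0 by (simp add: x)
  have n: "real n = S\<^sup>2 / pi\<^sup>2" using S by (simp add: power_mult_distrib)
  have nx: "real n * x = S / 2" "pi\<^sup>2 / (4 * x) = S / 2" "pi\<^sup>2 / x = 2 * S"
    using S0 by (simp_all add: n x power2_eq_square field_simps)
  define c where "c = exp (2 * \<i> * of_real \<phi>)"
  have cc: "c * exp (- (2 * \<i> * of_real \<phi>)) = 1" unfolding c_def by (simp flip: exp_add)
  have c0: "c \<noteq> 0" by (simp add: c_def)
  have invc: "1 / c = exp (- (2 * \<i> * of_real \<phi>))" using cc c0 by (simp add: field_simps)
  have c_cis: "c = cis (2 * \<phi>)" by (simp add: c_def cis_conv_exp mult_ac)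
  have c_cis': "1 / c = cis (- (2 * \<phi>))" unfolding invc by (simp add: cis_conv_exp mult_ac)
  have e_cis: "exp (\<i> * of_real \<phi>) = cis \<phi>" by (simp add: cis_conv_exp)
  have t: "t = of_real x * c" by (simp add: t_def c_def)
  have cos12: "1 / 2 \<le> cos (2 * \<phi>)"
  proof -
    have "cos (pi / 3) \<le> cos \<bar>2 * \<phi>\<bar>" using \<phi> by (intro cos_monotone_0_pi_le) auto
    thus ?thesis by (simp add: cos_60)
  qed
  have Ret: "Re t > 0" using x0 cos12 by (simp add: t c_cis)
  \<comment> \<open>The principal root halves the angle 2 phi, because cos phi > 0 on the
    arc.\<close>
  have sq: "csqrt (t / of_real pi) = of_real (sqrt (x / pi)) * exp (\<i> * of_real \<phi>)"
  proof (rule csqrt_unique)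
    have "(exp (\<i> * of_real \<phi>))\<^sup>2 = c" unfolding c_def power2_eq_square exp_add[symmetric] by (simp add: algebra_simps)
    moreover have "(complex_of_real (sqrt (x / pi)))\<^sup>2 = of_real (x / pi)"
      using x0 by (simp flip: of_real_power)
    ultimately show "(of_real (sqrt (x / pi)) * exp (\<i> * of_real \<phi>))\<^sup>2 = t / of_real pi"
      by (simp add: power_mult_distrib t)
    have "\<phi> < pi / 2" using abs_le_D1[OF \<phi>] pi_gt_zero by linarith
    moreover have "- (pi / 2) < \<phi>" using abs_le_D2[OF \<phi>] pi_gt_zero by linarith
    ultimately have "cos \<phi> > 0" by (intro cos_gt_zero_pi)
    hence "Re (of_real (sqrt (x / pi)) * exp (\<i> * of_real \<phi>)) > 0"
      using x0 by (simp add: e_cis del: cis_conv_exp)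
    thus "0 < Re (of_real (sqrt (x / pi)) * exp (\<i> * of_real \<phi>)) \<or>
        Re (of_real (sqrt (x / pi)) * exp (\<i> * of_real \<phi>)) = 0 \<and> 0 \<le> Im (of_real (sqrt (x / pi)) * exp (\<i> * of_real \<phi>))"
      by blast
  qed
  define w where "w = exp (- (of_real (pi\<^sup>2) / t))"
  define \<Psi> where "\<Psi> = theta_series w"
  have inv_t: "of_real (pi\<^sup>2) / t = of_real (2 * S) * (1 / c)"
    unfolding nx(3)[symmetric] t by simp
  have "norm w = exp (- (2 * S * cos (2 * \<phi>)))"
    unfolding w_def inv_t c_cis' by simp
  also have "\<dots> \<le> exp (- S)" using cos12 S0 mult_left_mono[of "1/2" "cos (2 * \<phi>)" "2 * S"] by simp
  finally have nw: "norm w \<le> exp (- S)" .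
  have eS: "exp (- S) \<le> 1 / 2"
  proof -
    have "2 \<le> exp S" using exp_ge_add_one_self[of S] S by linarith
    thus ?thesis by (simp add: exp_minus field_simps)
  qed
  have "norm (\<Psi> - 1) \<le> 2 * norm w ^ 2"
    unfolding \<Psi>_def using nw eS by (intro norm_theta_series_minus_1) simp
  also have "\<dots> \<le> 2 * exp (- S) ^ 2" using nw by (intro mult_left_mono power_mono) auto
  finally have P1: "norm (\<Psi> - 1) \<le> 2 * exp (- S) ^ 2" .
  also have "\<dots> \<le> 2 * (1 / 2) ^ 2" using eS by (intro mult_left_mono power_mono) auto
  finally have "norm (1 - \<Psi>) \<le> 1 / 2" by (simp add: norm_minus_commute power2_eq_square)
  hence P2: "1 / 2 \<le> norm \<Psi>" using norm_triangle_ineq2[of 1 "1 - \<Psi>"] by simp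
  hence P0: "\<Psi> \<noteq> 0" by auto
  have P3: "norm (1 / \<Psi> - 1) \<le> 4 * exp (- S) ^ 2"
  proof -
    have "norm (1 / \<Psi> - 1) = norm (\<Psi> - 1) / norm \<Psi>"
    proof -
      have "1 / \<Psi> - 1 = (1 - \<Psi>) / \<Psi>" using P0 by (simp add: diff_divide_distrib)
      thus ?thesis by (simp add: norm_divide norm_minus_commute)
    qed
    also have "\<dots> \<le> (2 * exp (- S) ^ 2) / (1 / 2)" using P1 P2 by (intro frac_le) auto
    finally show ?thesis by simp
  qed
  define E where "E = exp (of_real (pi\<^sup>2) / (4 * t))"
  have gf1: "overpart_gf (exp (- t)) * (2 * exp (- (of_real (pi\<^sup>2) / (4 * t))) * \<Psi>) = of_real (sqrt (x / pi)) * exp (\<i> * of_real \<phi>)"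
    using overpart_gf_modular[OF Ret] unfolding sq w_def \<Psi>_def .
  have E1: "E * exp (- (of_real (pi\<^sup>2) / (4 * t))) = 1" unfolding E_def by (simp flip: exp_add)
  have gf: "overpart_gf (exp (- t)) = of_real (sqrt (x / pi)) * exp (\<i> * of_real \<phi>) * E / 2 * (1 / \<Psi>)"
  proof -
    have "A * (2 * p) = r * f" if "A * (2 * e * p) = r" "f * e = 1" for A p r e f :: complex
    proof -
      have "r * f = A * (2 * p) * (f * e)" unfolding that(1)[symmetric] by (simp only: mult_ac)
      thus ?thesis unfolding that(2) by simp
    qed
    hence "overpart_gf (exp (- t)) * (2 * \<Psi>) = of_real (sqrt (x / pi)) * exp (\<i> * of_real \<phi>) * E"
      using gf1 E1 by blast
    thus ?thesis using P0 by (simp add: divide_simps)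
  qed
  have EE: "E * exp (of_nat n * t) = of_real (exp (S * cos (2 * \<phi>)))"
  proof -
    have "of_real (pi\<^sup>2) / (4 * t) = of_real (S / 2) * (1 / c)"
      unfolding nx(2)[symmetric] t by simp
    moreover have "of_nat n * t = of_real (S / 2) * c"
      unfolding nx(1)[symmetric] t by simp
    ultimately have "E * exp (of_nat n * t) = exp (of_real (S / 2) * (cis (- (2 * \<phi>)) + cis (2 * \<phi>)))"
      unfolding E_def exp_add[symmetric] c_cis[symmetric] c_cis'[symmetric] by (simp only: distrib_left)
    also have "cis (- (2 * \<phi>)) + cis (2 * \<phi>) = of_real (2 * cos (2 * \<phi>))" by (simp add: complex_eq_iff)
    also have "of_real (S / 2) * of_real (2 * cos (2 * \<phi>)) = complex_of_real (S * cos (2 * \<phi>))"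
      by simp
    finally show ?thesis by (simp only: exp_of_real)
  qed
  define M where "M = \<i> * of_real (x * sqrt (x / pi)) * exp (3 * \<i> * of_real \<phi>) * of_real (exp (S * cos (2 * \<phi>)))"
  have e3: "exp (\<i> * of_real \<phi>) * c = exp (3 * \<i> * of_real \<phi>)" unfolding c_def exp_add[symmetric] by (simp add: algebra_simps)
  have "overpart_gf (exp (- t)) * exp (of_nat n * t) * (2 * \<i> * t) =
     \<i> * of_real (x * sqrt (x / pi)) * (exp (\<i> * of_real \<phi>) * c) * (E * exp (of_nat n * t)) * (1 / \<Psi>)"
    unfolding gf by (simp add: t mult_ac)
  also have "\<dots> = M * (1 / \<Psi>)" unfolding e3 EE M_def ..
  finally have diff: "overpart_gf (exp (- t)) * exp (of_nat n * t) * (2 * \<i> * t) - M = M * (1 / \<Psi> - 1)"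
    by (simp add: algebra_simps)
  have "norm M \<le> x * sqrt (x / pi) * exp S"
  proof -
    have "norm M = x * sqrt (x / pi) * exp (S * cos (2 * \<phi>))"
      unfolding M_def using x0 by (simp add: norm_mult norm_divide)
    also have "\<dots> \<le> x * sqrt (x / pi) * exp S"
      using x0 S0 by (intro mult_left_mono) auto
    finally show ?thesis .
  qed
  hence "norm (M * (1 / \<Psi> - 1)) \<le> (x * sqrt (x / pi) * exp S) * (4 * exp (- S) ^ 2)"
    unfolding norm_mult using P3 x0 by (intro mult_mono) auto
  also have "\<dots> = 4 * (x * sqrt (x / pi)) * (exp S * exp (- S) ^ 2)" by (simp only: mult_ac)
  also have "exp S * exp (- S) ^ 2 = exp (- S)" by (simp add: power2_eq_square exp_minus)
  finally show ?thesis using diff unfolding M_def by (simp only:)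
qed

text \<open>No contour integral is evaluated: increments of primitives are bounded by mean value
  inequalities. Imaginary parts suffice, since the increment over the period is purely
  imaginary.\<close>

lemma overpart_estimate:
  fixes n :: nat and S :: real
  assumes S: "S = pi * sqrt (real n)" "20 \<le> S"
  shows "\<bar>overpart n - exp S / (8 * real n) * (1 - 1 / S)\<bar> \<le> 20 * exp (87 / 100 * S)"
proof -
  let ?main = "exp S / (8 * real n) * (1 - 1 / S)"
  obtain \<Phi> where d\<Phi>: "\<And>t. Re t > 0 \<Longrightarrow> (\<Phi> has_field_derivative overpart_gf (exp (- t)) * exp (of_nat n * t)) (at t)"
    and per: "\<And>t. \<Phi> (t + 2 * of_real pi * \<i>) - \<Phi> t = 2 * of_real pi * \<i> * of_real (overpart n)"
    using overpart_primitive by blast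
  obtain G :: "real \<Rightarrow> real" where dG: "\<And>u. (G has_real_derivative exp (- u\<^sup>2)) (at u)"
    and oddG: "\<And>u. G (- u) = - G u" and limG: "\<And>u. 1 \<le> u \<Longrightarrow> \<bar>G u - sqrt pi / 2\<bar> \<le> exp (- u\<^sup>2)"
    using gaussian_primitive by blast
  have S0: "S > 0" using S by simp
  have n: "real n = S\<^sup>2 / pi\<^sup>2" using S by (simp add: power_mult_distrib)
  define x where "x = pi\<^sup>2 / (2 * S)"
  \<comment> \<open>The real part x cos (pi / 3) of both ends of the arc; their imaginary parts are
    sqrt 3 * X and its negative.\<close>
  define X where "X = x / 2"
  define K where "K = x * sqrt (x / pi)"
  define E where "E = exp (87 / 100 * S)"
  have pi3: "3 < pi" using pi_approx by simp
  have pi32: "pi < 32 / 10" using pi_approx by simp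
  have pisq: "pi\<^sup>2 \<le> 989 / 100"
  proof -
    have "pi\<^sup>2 \<le> (3142 / 1000)\<^sup>2" using pi_approx by (intro power_mono) auto
    thus ?thesis by (simp add: power2_eq_square)
  qed
  have x0: "x > 0" using S0 by (simp add: x_def)
  have xle: "x \<le> 1 / 4" using S pisq by (simp add: x_def field_simps)
  have X0: "X > 0" "X \<le> 1 / 8" using x0 xle by (simp_all add: X_def)
  have Xeq: "pi\<^sup>2 / (4 * X) = S" "real n * X = S / 4" "pi\<^sup>2 / X = 4 * S" "94 / 100 / X = 376 / 100 * S / pi\<^sup>2"
    using S0 by (simp_all add: n X_def x_def power2_eq_square field_simps)
  have K0: "0 \<le> K" using x0 by (simp add: K_def)
  have K1: "K \<le> 1"
  proof -
    have "sqrt (x / pi) \<le> 1" using x0 xle pi3 by simp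
    hence "x * sqrt (x / pi) \<le> 1 * 1" using x0 xle by (intro mult_mono) auto
    thus ?thesis by (simp add: K_def)
  qed
  have w2: "exp (- (pi\<^sup>2 / X)) \<le> 1 / 2"
  proof -
    have "2 \<le> exp (4 * S)" using exp_ge_add_one_self[of "4 * S"] S by linarith
    thus ?thesis unfolding Xeq by (simp add: exp_minus field_simps)
  qed
  \<comment> \<open>Exponents: S from the bound on the real axis, S / 4 from n X, and a gain of 3.76
    S / pi^2 >= 0.38 S by pi^2 <= 9.89. This leaves 0.87 S; the remaining constant e^2 is at most
    9.\<close>
  have vert: "norm (overpart_gf (exp (- z)) * exp (of_nat n * z)) \<le> 9 * E"
    if z: "Re z = X" "sqrt 3 * X \<le> \<bar>Im z\<bar>" "\<bar>Im z\<bar> \<le> pi" for z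
  proof -
    have zc: "z = Complex X (Im z)" using z by (simp add: complex_eq_iff)
    have nP: "norm (overpart_gf (exp (- z))) \<le> exp (pi\<^sup>2 / (4 * X) + 2 - 94 / 100 / X)"
      by (subst zc) (rule overpart_gf_minor_arc[OF X0 w2 z(2,3)])
    have nE: "norm (exp (of_nat n * z)) = exp (S / 4)" using z Xeq(2) by simp
    have "norm (overpart_gf (exp (- z)) * exp (of_nat n * z)) \<le>
        exp (pi\<^sup>2 / (4 * X) + 2 - 94 / 100 / X) * exp (S / 4)"
      unfolding norm_mult nE by (rule mult_right_mono[OF nP]) simp
    also have "\<dots> = exp (S + 2 - 376 / 100 * S / pi\<^sup>2 + S / 4)" unfolding Xeq exp_add[symmetric] by simp
    also have "\<dots> \<le> exp (2 + 87 / 100 * S)"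
    proof -
      have "38 / 100 * S * pi\<^sup>2 \<le> 376 / 100 * S"
        using mult_left_mono[OF pisq, of "38 / 100 * S"] S0 by simp
      hence "38 / 100 * S \<le> 376 / 100 * S / pi\<^sup>2" by (simp add: pos_le_divide_eq)
      thus ?thesis by simp
    qed
    also have "\<dots> = (exp 1 * exp 1) * E" unfolding E_def exp_add[symmetric] by simp
    also have "\<dots> \<le> (3 * 3) * E" using exp_le by (intro mult_right_mono mult_mono) (auto simp: E_def)
    finally show ?thesis by simp
  qed
  define \<tau> where "\<tau> z = of_real x * exp (2 * \<i> * z)" for z :: complex
  \<comment> \<open>a primitive of \<open>exp S (1 - 4 v\<^sup>2) exp (- 2 S v\<^sup>2)\<close>, where
    \<open>cos (3 \<phi>) = (1 - 4 sin\<^sup>2 \<phi>) cos \<phi>\<close> and \<open>cos (2 \<phi>) = 1 - 2 sin\<^sup>2 \<phi>\<close>\<close>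
  define H where "H v = exp S * (v * exp (- (2 * S * v\<^sup>2)) / S + (1 - 1 / S) * (G (sqrt (2 * S) * v) / sqrt (2 * S)))" for v
  have dH: "(H has_real_derivative exp S * ((1 - 4 * v\<^sup>2) * exp (- (2 * S * v\<^sup>2)))) (at v)" for v
  proof -
    have s: "sqrt (2 * S) \<noteq> 0" "(sqrt (2 * S) * v)\<^sup>2 = 2 * S * v\<^sup>2" using S0 by (simp_all add: power_mult_distrib)
    have "((\<lambda>v. G (sqrt (2 * S) * v)) has_real_derivative exp (- (sqrt (2 * S) * v)\<^sup>2) * sqrt (2 * S)) (at v)"
      by (rule DERIV_chain2[OF dG]) (auto intro!: derivative_eq_intros)
    from DERIV_cdivide[OF this, of "sqrt (2 * S)"] s
    have 1: "((\<lambda>v. G (sqrt (2 * S) * v) / sqrt (2 * S)) has_real_derivative exp (- (2 * S * v\<^sup>2))) (at v)" by simp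
    have 2: "((\<lambda>v. v * exp (- (2 * S * v\<^sup>2)) / S) has_real_derivative
        (1 - 4 * S * v\<^sup>2) * exp (- (2 * S * v\<^sup>2)) / S) (at v)"
      using S0 by (auto intro!: derivative_eq_intros simp: power2_eq_square field_simps)
    have "(1 - 4 * S * v\<^sup>2) * e / S + (1 - 1 / S) * e = (1 - 4 * v\<^sup>2) * e" for e
      using S0 by (simp add: field_simps)
    with DERIV_cmult[OF DERIV_add[OF 2 DERIV_cmult[OF 1, of "1 - 1 / S"]], of "exp S"]
    show ?thesis unfolding H_def by simp
  qed
  \<comment> \<open>A difference of two primitives along the arc. Its derivative is tiny, so the
    true increment and that of the explicit primitive, from sin phi = -1/2 to 1/2, nearly
    agree.\<close>
  define D where "D \<phi> = Im (\<Phi> (\<tau> (of_real \<phi>))) - K * H (sin \<phi>)" for \<phi>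
  have arc: "norm (D (pi / 6) - D (- (pi / 6))) \<le> 4 * K * exp (- S) * norm (pi / 6 - - (pi / 6))"
  proof (rule field_differentiable_bound[where S = "{- (pi / 6)..pi / 6}"])
    fix \<phi> assume \<phi>: "\<phi> \<in> {- (pi / 6)..pi / 6}"
    hence a\<phi>: "\<bar>\<phi>\<bar> \<le> pi / 6" by auto
    let ?t = "\<tau> (of_real \<phi>)"
    let ?M = "\<i> * of_real K * exp (3 * \<i> * of_real \<phi>) * of_real (exp (S * cos (2 * \<phi>)))"
    let ?g = "overpart_gf (exp (- ?t)) * exp (of_nat n * ?t) * (2 * \<i> * ?t)"
    have "cos (pi / 3) \<le> cos \<bar>2 * \<phi>\<bar>" using a\<phi> by (intro cos_monotone_0_pi_le) auto
    hence "cos (2 * \<phi>) > 0" by (simp add: cos_60)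
    moreover have "exp (2 * \<i> * of_real \<phi>) = cis (2 * \<phi>)" by (simp add: cis_conv_exp mult_ac)
    ultimately have "Re ?t > 0" using x0 by (simp add: \<tau>_def)
    hence "((\<lambda>z. \<Phi> (\<tau> z)) has_field_derivative ?g) (at (of_real \<phi>))"
      by (intro DERIV_chain2[OF d\<Phi>]) (auto intro!: derivative_eq_intros simp: \<tau>_def)
    hence "((\<lambda>u. Im (\<Phi> (\<tau> (of_real u)))) has_vector_derivative Im ?g) (at \<phi>)"
      by (intro bounded_linear.has_vector_derivative[OF bounded_linear_Im] has_vector_derivative_real_field)
    hence 1: "((\<lambda>u. Im (\<Phi> (\<tau> (of_real u)))) has_real_derivative Im ?g) (at \<phi>)"
      by (simp add: has_real_derivative_iff_has_vector_derivative)
    have 2: "((\<lambda>u. H (sin u)) has_real_derivative exp S * ((1 - 4 * (sin \<phi>)\<^sup>2) * exp (- (2 * S * (sin \<phi>)\<^sup>2))) * cos \<phi>) (at \<phi>)"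
      by (rule DERIV_chain2[OF dH]) (auto intro!: derivative_eq_intros)
    have ImM: "Im ?M = K * (cos (3 * \<phi>) * exp (S * cos (2 * \<phi>)))"
    proof -
      have "exp (3 * \<i> * of_real \<phi>) = cis (3 * \<phi>)" by (simp add: cis_conv_exp mult_ac)
      thus ?thesis by simp
    qed
    have "exp S * ((1 - 4 * (sin \<phi>)\<^sup>2) * exp (- (2 * S * (sin \<phi>)\<^sup>2))) * cos \<phi> = cos (3 * \<phi>) * exp (S * cos (2 * \<phi>))"
    proof -
      have "cos (3 * \<phi>) = (1 - 4 * (sin \<phi>)\<^sup>2) * cos \<phi>"
        unfolding cos_treble_cos sin_squared_eq by (simp add: power3_eq_cube power2_eq_square algebra_simps)
      moreover have "exp (S * cos (2 * \<phi>)) = exp S * exp (- (2 * S * (sin \<phi>)\<^sup>2))"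
        unfolding cos_double_sin exp_add[symmetric] by (simp add: algebra_simps)
      ultimately show ?thesis by simp
    qed
    hence "K * (exp S * ((1 - 4 * (sin \<phi>)\<^sup>2) * exp (- (2 * S * (sin \<phi>)\<^sup>2))) * cos \<phi>) = Im ?M"
      using ImM by (simp only:)
    hence "(D has_real_derivative Im (?g - ?M)) (at \<phi>)"
      unfolding D_def minus_complex.sel(2) using DERIV_diff[OF 1 DERIV_cmult[OF 2, of K]] by (simp only:)
    thus "(D has_real_derivative Im (?g - ?M)) (at \<phi> within {- (pi / 6)..pi / 6})"
      by (rule has_field_derivative_at_within)
    have "\<bar>Im (?g - ?M)\<bar> \<le> norm (?g - ?M)" by (rule abs_Im_le_cmod)
    also have "\<dots> \<le> 4 * K * exp (- S)"
      using overpart_gf_arc[OF S x_def a\<phi>] unfolding \<tau>_def K_def .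
    finally show "norm (Im (?g - ?M)) \<le> 4 * K * exp (- S)" by simp
  qed auto
  have ends: "\<tau> (of_real (pi / 6)) = Complex X (sqrt 3 * X)" "\<tau> (of_real (- (pi / 6))) = Complex X (- (sqrt 3 * X))"
  proof -
    have "exp (2 * \<i> * of_real (pi / 6)) = cis (pi / 3)" "exp (2 * \<i> * of_real (- (pi / 6))) = cis (- (pi / 3))"
      by (simp_all add: cis_conv_exp mult_ac)
    thus "\<tau> (of_real (pi / 6)) = Complex X (sqrt 3 * X)" "\<tau> (of_real (- (pi / 6))) = Complex X (- (sqrt 3 * X))"
      unfolding \<tau>_def by (simp_all add: complex_eq_iff X_def cos_60 sin_60)
  qed
  have s3X: "sqrt 3 * X \<le> pi" "0 \<le> sqrt 3 * X"
  proof -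
    have "sqrt 3 \<le> 2" by (rule real_le_lsqrt) auto
    hence "sqrt 3 * X \<le> 2 * X" using X0 by (intro mult_right_mono) auto
    thus "sqrt 3 * X \<le> pi" using X0 pi3 by linarith
  qed (use X0 in simp)
  have seg: "norm (\<Phi> (Complex X a) - \<Phi> (Complex X b)) \<le> 9 * E * pi"
    if ab: "b \<le> a" "a - b \<le> pi" "\<And>y. b \<le> y \<Longrightarrow> y \<le> a \<Longrightarrow> sqrt 3 * X \<le> \<bar>y\<bar> \<and> \<bar>y\<bar> \<le> pi" for a b
  proof -
    define V where "V = {z. Re z \<le> X} \<inter> {z. Re z \<ge> X} \<inter> {z. Im z \<ge> b} \<inter> {z. Im z \<le> a}"
    have "norm (\<Phi> (Complex X a) - \<Phi> (Complex X b)) \<le> 9 * E * norm (Complex X a - Complex X b)"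
    proof (rule field_differentiable_bound[where S = V])
      show "convex V" unfolding V_def
        by (intro convex_Int convex_halfspace_Im_ge convex_halfspace_Im_le
            convex_halfspace_Re_le convex_halfspace_Re_ge)
      show "(\<Phi> has_field_derivative overpart_gf (exp (- z)) * exp (of_nat n * z)) (at z within V)" if "z \<in> V" for z
        by (rule has_field_derivative_at_within[OF d\<Phi>]) (use that X0 in \<open>auto simp: V_def\<close>)
      show "norm (overpart_gf (exp (- z)) * exp (of_nat n * z)) \<le> 9 * E" if "z \<in> V" for z
        using that ab(3)[of "Im z"] by (intro vert) (auto simp: V_def)
    qed (use ab in \<open>auto simp: V_def\<close>)
    also have "Complex X a - Complex X b = of_real (a - b) * \<i>" by (simp add: complex_eq_iff)
    also have "9 * E * norm (of_real (a - b) * \<i>) \<le> 9 * E * pi"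
      using ab(1,2) by (intro mult_left_mono) (simp_all only: norm_mult norm_of_real norm_ii, simp_all add: E_def)
    finally show ?thesis .
  qed
  have up: "norm (\<Phi> (Complex X pi) - \<Phi> (Complex X (sqrt 3 * X))) \<le> 9 * E * pi"
    using s3X by (intro seg) auto
  have lo: "norm (\<Phi> (Complex X (- (sqrt 3 * X))) - \<Phi> (Complex X (- pi))) \<le> 9 * E * pi"
    using s3X by (intro seg) auto
  have "Complex X (- pi) + 2 * of_real pi * \<i> = Complex X pi" by (simp add: complex_eq_iff)
  hence "\<Phi> (Complex X pi) - \<Phi> (Complex X (- pi)) = 2 * of_real pi * \<i> * of_real (overpart n)"
    using per[of "Complex X (- pi)"] by simp
  hence "Im (\<Phi> (Complex X pi) - \<Phi> (Complex X (- pi))) = Im (2 * of_real pi * \<i> * of_real (overpart n))"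
    by (rule arg_cong)
  hence tot: "2 * pi * overpart n = Im (\<Phi> (Complex X pi)) - Im (\<Phi> (Complex X (- pi)))" by simp
  \<comment> \<open>The main term appears once \<open>G\<close> is replaced by its limit sqrt pi /
    2. The factor 1 - 1 / S is the mean of 1 - 4 v^2 under the Gaussian weight exp (- 2 S v^2),
    whose variance is 1 / (4 S).\<close>
  have Hdiff: "\<bar>K * (H (1 / 2) - H (- (1 / 2))) - 2 * pi * (?main)\<bar> \<le> E"
  proof -
    define r where "r = sqrt (2 * S)"
    define u where "u = r / 2"
    have r: "r\<^sup>2 = 2 * S" "6 \<le> r" using S by (auto simp: r_def intro!: real_le_rsqrt)
    have u: "u\<^sup>2 = S / 2" "1 \<le> u" using r by (auto simp: u_def power_divide)
  let ?tail = "2 * (G u - sqrt pi / 2) / r"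
    have "H (1 / 2) - H (- (1 / 2)) = exp S * (exp (- (S / 2)) / S + (1 - 1 / S) * (2 * G u / r))"
    proof -
      have "sqrt (2 * S) * (1 / 2) = u" "sqrt (2 * S) * (- (1 / 2)) = - u" by (simp_all add: u_def r_def)
      thus ?thesis unfolding H_def r_def[symmetric] by (simp add: oddG power_divide field_simps)
    qed
    moreover have "2 * G u / r = sqrt pi / r + ?tail"
      by (simp add: diff_divide_distrib right_diff_distrib)
    ultimately have "K * (H (1 / 2) - H (- (1 / 2))) =
        K * exp S * (1 - 1 / S) * (sqrt pi / r) + K * exp S * (exp (- (S / 2)) / S + (1 - 1 / S) * (?tail))"
      by (simp only:) (simp only: distrib_left mult.assoc add_ac)
    moreover have Kr: "K * (sqrt pi / r) = 2 * pi / (8 * real n)"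
    proof -
      have "x / pi = pi / r\<^sup>2" unfolding r(1) x_def by (simp add: power2_eq_square)
      hence "sqrt (x / pi) = sqrt pi / r" using r(2) by (simp only: real_sqrt_divide) simp
      hence "K * (sqrt pi / r) = x * (sqrt pi * sqrt pi) / r\<^sup>2" by (simp add: K_def power2_eq_square)
      also have "\<dots> = 2 * pi / (8 * real n)" unfolding r(1) n x_def using S0 by (simp add: power2_eq_square field_simps)
      finally show ?thesis .
    qed
    have "K * exp S * d * q = K * q * (exp S * d)" "2 * pi / m * (exp S * d) = 2 * pi * (exp S / m * d)"
      for d q m :: real by simp_all
    hence "K * exp S * (1 - 1 / S) * (sqrt pi / r) = 2 * pi * (?main)"
      using Kr by (simp only:)
    ultimately have "\<bar>K * (H (1 / 2) - H (- (1 / 2))) - 2 * pi * (?main)\<bar> =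
       \<bar>K * exp S * (exp (- (S / 2)) / S + (1 - 1 / S) * (?tail))\<bar>" by simp
    also have "\<dots> = K * exp S * \<bar>exp (- (S / 2)) / S + (1 - 1 / S) * (?tail)\<bar>"
      using K0 by (simp add: abs_mult)
    also have "\<dots> \<le> 1 * exp S * exp (- (S / 2))"
    proof (intro mult_mono)
      have "\<bar>(1 - 1 / S) * (?tail)\<bar> = (1 - 1 / S) * (2 * \<bar>G u - sqrt pi / 2\<bar> / r)"
        using S(2) r(2) by (simp only: abs_mult abs_divide) simp
      also have "\<dots> \<le> 1 * (2 * exp (- (S / 2)) / 6)"
        using S r limG[OF u(2)] unfolding u(1) by (intro mult_mono frac_le mult_left_mono) auto
      finally have b: "\<bar>(1 - 1 / S) * (?tail)\<bar> \<le> exp (- (S / 2)) / 3" by simp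
      have a: "\<bar>exp (- (S / 2)) / S\<bar> \<le> exp (- (S / 2)) / 20"
        using S(2) frac_le[of "exp (- (S / 2))" "exp (- (S / 2))" 20 S] by simp
      show "\<bar>exp (- (S / 2)) / S + (1 - 1 / S) * (?tail)\<bar> \<le> exp (- (S / 2))"
      proof -
        have "\<bar>a + b\<bar> \<le> e" if "\<bar>b\<bar> \<le> e / 3" "\<bar>a\<bar> \<le> e / 20" "0 < e" for a b e :: real
          using that by linarith
        thus ?thesis using a b exp_gt_zero by blast
      qed
    qed (use K0 K1 in auto)
    also have "\<dots> \<le> E" unfolding E_def by (simp flip: exp_add) (use S0 in simp)
    finally show ?thesis .
  qed
  have "\<bar>2 * pi * overpart n - 2 * pi * (?main)\<bar> \<le> 9 * E * pi + 9 * E * pi + 8 * E + E"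
  proof -
    have "\<bar>Im (\<Phi> (Complex X pi)) - Im (\<Phi> (Complex X (sqrt 3 * X)))\<bar> \<le> 9 * E * pi"
      using order.trans[OF abs_Im_le_cmod up] by simp
    moreover have "\<bar>Im (\<Phi> (Complex X (- (sqrt 3 * X)))) - Im (\<Phi> (Complex X (- pi)))\<bar> \<le> 9 * E * pi"
      using order.trans[OF abs_Im_le_cmod lo] by simp
    moreover have "\<bar>D (pi / 6) - D (- (pi / 6))\<bar> \<le> 8 * E"
    proof -
      have "\<bar>D (pi / 6) - D (- (pi / 6))\<bar> \<le> 4 * K * exp (- S) * (pi / 3)" using arc by simp
      also have "\<dots> \<le> 4 * 1 * E * 2" using K0 K1 S0 pi32 by (intro mult_mono) (auto simp: E_def)
      finally show ?thesis by simp
    qed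
    moreover have "D (pi / 6) - D (- (pi / 6)) = Im (\<Phi> (Complex X (sqrt 3 * X))) - Im (\<Phi> (Complex X (- (sqrt 3 * X)))) -
        K * (H (1 / 2) - H (- (1 / 2)))"
      unfolding D_def ends by (simp add: sin_30 right_diff_distrib)
    moreover have "\<bar>p - q - m\<bar> \<le> B + B + C + F"
      if "\<bar>p - p'\<bar> \<le> B" "\<bar>q' - q\<bar> \<le> B" "\<bar>d\<bar> \<le> C" "d = p' - q' - h" "\<bar>h - m\<bar> \<le> F"
      for p q m p' q' d h B C F :: real
      using that by linarith
    ultimately show ?thesis unfolding tot using Hdiff by blast
  qed
  \<comment> \<open>That is, 18 pi + 9 <= 40 pi.\<close>
  also have "\<dots> \<le> 2 * pi * (20 * E)"
  proof -
    have "3 * E \<le> pi * E" using pi3 by (intro mult_right_mono) (auto simp: E_def)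
    moreover have "0 < E" by (simp add: E_def)
    ultimately have "9 * E \<le> 22 * (pi * E)" by linarith
    thus ?thesis by (simp add: algebra_simps)
  qed
  finally have "2 * pi * \<bar>overpart n - ?main\<bar> \<le> 2 * pi * (20 * E)"
    by (simp only: right_diff_distrib[symmetric] abs_mult) simp
  thus ?thesis unfolding E_def by simp
qed

section \<open>Expansion of the logarithm\<close>

text \<open>Up to the constant - ln (8 n), the expanded function is the logarithm of the main term
  at n (1 + u), with S taken at n. Cauchy's inequality on |u| = 1/3, where the function is at most 4
  S, bounds all coefficients; the first two are computed exactly because they yield the prescribed
  data.\<close>

lemma main_term_expansion:
  fixes S :: real
  assumes S: "20 \<le> S"
  obtains a :: "nat \<Rightarrow> real" where
    "a 1 = (S - 2 + 1 / (S - 1)) / 2"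
    "a 2 = (6 - S ^ 3 / (S - 1)\<^sup>2) / 8"
    "\<And>k. \<bar>a k\<bar> \<le> 4 * S * 3 ^ k"
    "\<And>u. \<bar>u\<bar> \<le> 1 / 4 \<Longrightarrow>
       (\<lambda>k. a k * u ^ k) sums (S * sqrt (1 + u) - ln (1 + u) + ln (1 - 1 / (S * sqrt (1 + u))))"
proof -
  \<comment> \<open>The radius 3/4 gives |1 + u| >= 1/4, hence |\<open>c u\<close>| >= 1/2 and |1 /
    (s * c u)| <= 1/10, which avoids the cuts of the root and of both logarithms.\<close>
  define B where "B = ball (0 :: complex) (3 / 4)"
  define s where "s = complex_of_real S"
  define c where "c u = csqrt (1 + u)" for u :: complex
  define f where "f u = s * c u - Ln (1 + u) + Ln (1 - 1 / (s * c u))" for u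
  \<comment> \<open>The derivative of \<open>f\<close>, written through \<open>c\<close> alone so
    that it can be differentiated once more at 0.\<close>
  define g where "g u = s / (2 * c u) - 1 / (c u)\<^sup>2 + 1 / (2 * (c u)\<^sup>2 * (s * c u - 1))" for u
  have s0: "s \<noteq> 0" "norm s = S" using S by (auto simp: s_def)
  have nonpos: "1 + u \<notin> \<real>\<^sub>\<le>\<^sub>0" if "u \<in> B" for u
  proof
    assume "1 + u \<in> \<real>\<^sub>\<le>\<^sub>0"
    hence "Re u \<le> -1" by (auto simp: complex_nonpos_Reals_iff)
    hence "1 \<le> norm u" using abs_Re_le_cmod[of u] by linarith
    thus False using that by (simp add: B_def)
  qed
  have c2: "(c u)\<^sup>2 = 1 + u" for u by (simp add: c_def)
  have nc: "1 / 2 \<le> norm (c u)" if "u \<in> B" for u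
  proof -
    have "1 / 4 \<le> norm (1 + u)" using that norm_diff_ineq[of 1 u] by (simp add: B_def)
    hence "sqrt (1 / 4) \<le> norm (c u)" unfolding c_def by simp
    thus ?thesis by (simp add: real_sqrt_divide)
  qed
  have c0: "c u \<noteq> 0" if "u \<in> B" for u using nc[OF that] by auto
  have w: "norm (1 / (s * c u)) \<le> 1 / 10" if "u \<in> B" for u
  proof -
    have "10 \<le> S * norm (c u)" using mult_mono[of 20 S "1 / 2" "norm (c u)"] S nc[OF that] by simp
    thus ?thesis using s0 by (simp add: norm_divide norm_mult field_simps)
  qed
  have sc1: "s * c u - 1 \<noteq> 0" if "u \<in> B" for u
  proof
    assume "s * c u - 1 = 0"
    hence "1 / (s * c u) = 1" by simp
    thus False using w[OF that] by simp
  qed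
  have nonpos2: "1 - 1 / (s * c u) \<notin> \<real>\<^sub>\<le>\<^sub>0" if "u \<in> B" for u
  proof
    assume "1 - 1 / (s * c u) \<in> \<real>\<^sub>\<le>\<^sub>0"
    hence "1 \<le> Re (1 / (s * c u))" by (auto simp: complex_nonpos_Reals_iff)
    hence "1 \<le> norm (1 / (s * c u))" using complex_Re_le_cmod[of "1 / (s * c u)"] by linarith
    thus False using w[OF that] by simp
  qed
  have dc: "(c has_field_derivative 1 / (2 * c u)) (at u)" if "u \<in> B" for u
    unfolding c_def using nonpos[OF that]
    by (auto intro!: derivative_eq_intros simp: inverse_eq_divide)
  have df: "(f has_field_derivative g u) (at u)" if u: "u \<in> B" for u
  proof -
    have 1: "((\<lambda>u. Ln (1 + u)) has_field_derivative 1 / (c u)\<^sup>2) (at u)"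
      unfolding c2 using nonpos[OF u] by (auto intro!: derivative_eq_intros simp: inverse_eq_divide)
    have 2: "((\<lambda>u. 1 - 1 / (s * c u)) has_field_derivative (1 / (2 * c u)) / (s * (c u)\<^sup>2)) (at u)"
      using c0[OF u] s0 by (auto intro!: derivative_eq_intros dc[OF u] simp: power2_eq_square field_simps)
    have 3: "((\<lambda>u. Ln (1 - 1 / (s * c u))) has_field_derivative
        inverse (1 - 1 / (s * c u)) * ((1 / (2 * c u)) / (s * (c u)\<^sup>2))) (at u)"
      by (rule DERIV_chain2[OF has_field_derivative_Ln[OF nonpos2[OF u]] 2])
    have "1 - 1 / (s * c u) = (s * c u - 1) / (s * c u)" using s0 c0[OF u] by (simp add: field_simps)
    hence "inverse (1 - 1 / (s * c u)) * ((1 / (2 * c u)) / (s * (c u)\<^sup>2)) = 1 / (2 * (c u)\<^sup>2 * (s * c u - 1))"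
      using s0 c0[OF u] sc1[OF u] by (simp add: power2_eq_square)
    moreover have "s * (1 / (2 * c u)) = s / (2 * c u)" by simp
    ultimately show ?thesis unfolding f_def g_def
      using DERIV_add[OF DERIV_diff[OF DERIV_cmult[OF dc[OF u], of s] 1] 3] by simp
  qed
  have openB: "open B" and B0: "0 \<in> B" by (auto simp: B_def)
  have holf: "f holomorphic_on B"
    using df by (auto simp: holomorphic_on_open[OF openB])
  have c00: "c 0 = 1" by (simp add: c_def)
  have d1: "deriv f u = g u" if "u \<in> B" for u using df[OF that] by (rule DERIV_imp_deriv)
  define g' where "g' = - (s / 4) + 1 - (3 * s - 2) / (4 * (s - 1)\<^sup>2)"
  have s1: "s - 1 \<noteq> 0" using sc1[OF B0] by (simp add: c00)
  have dg: "(g has_field_derivative g') (at 0)"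
  proof -
    have p1: "((\<lambda>u. s / (2 * c u)) has_field_derivative - (s / 4)) (at 0)"
      by (auto intro!: derivative_eq_intros dc[OF B0] simp: c00 power2_eq_square)
    have p2: "((\<lambda>u. 1 / (c u)\<^sup>2) has_field_derivative - 1) (at 0)"
      by (auto intro!: derivative_eq_intros dc[OF B0] simp: c00 power2_eq_square)
    have p3: "((\<lambda>u. 2 * (c u)\<^sup>2 * (s * c u - 1)) has_field_derivative (3 * s - 2)) (at 0)"
      by (auto intro!: derivative_eq_intros dc[OF B0] simp: c00 power2_eq_square algebra_simps)
    have "(2 * s - 2) * (2 * s - 2) = 4 * ((s - 1) * (s - 1))" by (simp add: algebra_simps)
    with DERIV_divide[OF DERIV_const[of 1] p3] s1
    have p4: "((\<lambda>u. 1 / (2 * (c u)\<^sup>2 * (s * c u - 1))) has_field_derivative - ((3 * s - 2) / (4 * (s - 1)\<^sup>2))) (at 0)"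
      by (simp add: power2_eq_square minus_divide_left c00)
    show ?thesis unfolding g_def g'_def using DERIV_add[OF DERIV_diff[OF p1 p2] p4] by simp
  qed
  have d2: "deriv (deriv f) 0 = g'"
  proof -
    have "(deriv f has_field_derivative g') (at 0)"
      by (rule has_field_derivative_transform_within_open[OF dg openB B0]) (simp add: d1)
    thus ?thesis by (rule DERIV_imp_deriv)
  qed
  \<comment> \<open>At most 2 S from the root term, 2/3 and 1/5 from the two logarithms.\<close>
  have bound: "norm (f u) \<le> 4 * S" if u: "norm u \<le> 1 / 3" for u
  proof -
    have uB: "u \<in> B" using u by (simp add: B_def)
    have "norm (c u) \<le> 2"
    proof -
      have "norm (1 + u) \<le> 4" using norm_triangle_ineq[of 1 u] u by simp
      hence "sqrt (norm (1 + u)) \<le> 2" by (intro real_le_lsqrt) auto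
      thus ?thesis unfolding c_def by simp
    qed
    hence "norm (s * c u) \<le> S * 2" unfolding norm_mult s0 using S by (intro mult_left_mono) auto
    moreover have "norm (Ln (1 + u)) \<le> 2 * norm u" using u by (intro norm_Ln_le) simp
    moreover have "norm (Ln (1 + - (1 / (s * c u)))) \<le> 2 * norm (- (1 / (s * c u)))"
      using w[OF uB] by (intro norm_Ln_le) (simp del: norm_mult)
    moreover have "norm (f u) \<le> norm (s * c u) + norm (Ln (1 + u)) + norm (Ln (1 + - (1 / (s * c u))))"
      unfolding f_def by (intro order.trans[OF norm_triangle_ineq] add_mono norm_triangle_ineq4) simp
    ultimately show ?thesis using u w[OF uB] S by simp
  qed
  define a where "a k = Re ((deriv ^^ k) f 0 / fact k)" for k
  show ?thesis
  proof (rule that[of a])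
    have "g 0 = of_real ((S - 2 + 1 / (S - 1)) / 2)" using s1 by (simp add: g_def c00 s_def field_simps)
    thus "a 1 = (S - 2 + 1 / (S - 1)) / 2" unfolding a_def by (simp add: d1[OF B0] del: of_real_divide of_real_add of_real_diff)
    have "g' / 2 = of_real ((6 - S ^ 3 / (S - 1)\<^sup>2) / 8)"
    proof -
      have "g' / 2 = (6 - s ^ 3 / (s - 1)\<^sup>2) / 8"
        using s1 by (simp add: g'_def divide_simps) (simp add: power2_eq_square power3_eq_cube algebra_simps)
      thus ?thesis by (simp add: s_def)
    qed
    thus "a 2 = (6 - S ^ 3 / (S - 1)\<^sup>2) / 8"
      unfolding a_def by (simp add: numeral_2_eq_2 d2 fact_numeral del: of_real_divide of_real_diff)
    show "\<bar>a k\<bar> \<le> 4 * S * 3 ^ k" for k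
    proof -
      have "norm ((deriv ^^ k) f 0) \<le> fact k * (4 * S) / (1 / 3) ^ k"
      proof (rule Cauchy_inequality)
        show "f holomorphic_on ball 0 (1 / 3)" by (rule holomorphic_on_subset[OF holf]) (auto simp: B_def)
        show "continuous_on (cball 0 (1 / 3)) f"
          by (rule holomorphic_on_imp_continuous_on[OF holomorphic_on_subset[OF holf]]) (auto simp: B_def)
        show "norm (f z) \<le> 4 * S" if "norm (0 - z) = 1 / 3" for z using that by (intro bound) simp
      qed simp
      hence "norm ((deriv ^^ k) f 0 / fact k) \<le> 4 * S * 3 ^ k"
        by (simp add: norm_divide field_simps power_divide)
      thus ?thesis unfolding a_def using abs_Re_le_cmod order.trans by blast
    qed
    fix u :: real assume u: "\<bar>u\<bar> \<le> 1 / 4"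
    have "(\<lambda>k. Re ((deriv ^^ k) f 0 / fact k * (of_real u - 0) ^ k)) sums Re (f (of_real u))"
      using holf u unfolding B_def by (intro sums_Re holomorphic_power_series) auto
    moreover have "Re ((deriv ^^ k) f 0 / fact k * (of_real u - 0) ^ k) = a k * u ^ k" for k
    proof -
      have "(deriv ^^ k) f 0 / fact k * (of_real u - 0) ^ k = (deriv ^^ k) f 0 / fact k * of_real (u ^ k)" by simp
      thus ?thesis unfolding a_def by (simp only: times_complex.sel Re_complex_of_real Im_complex_of_real mult_zero_right diff_zero)
    qed
    moreover have "f (of_real u) = of_real (S * sqrt (1 + u) - ln (1 + u) + ln (1 - 1 / (S * sqrt (1 + u))))"
    proof -
      have cu: "c (of_real u) = of_real (sqrt (1 + u))" unfolding c_def using u by simp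
      have l1: "Ln (1 + of_real u) = of_real (ln (1 + u))" using u Ln_of_real[of "1 + u"] by simp
      have "norm (1 / (s * c (of_real u))) \<le> 1 / 10" using u by (intro w) (simp add: B_def)
      moreover have "1 / (s * c (of_real u)) = of_real (1 / (S * sqrt (1 + u)))" unfolding cu s_def by simp
      ultimately have "\<bar>1 / (S * sqrt (1 + u))\<bar> \<le> 1 / 10" by (simp only: norm_of_real)
      hence "1 - 1 / (S * sqrt (1 + u)) > 0" by linarith
      hence l2: "Ln (1 - 1 / (s * c (of_real u))) = of_real (ln (1 - 1 / (S * sqrt (1 + u))))"
        using Ln_of_real[of "1 - 1 / (S * sqrt (1 + u))"] unfolding cu s_def by simp
      show ?thesis unfolding f_def l1 l2 by (simp add: cu s_def)
    qed
    ultimately show "(\<lambda>k. a k * u ^ k) sums (S * sqrt (1 + u) - ln (1 + u) + ln (1 - 1 / (S * sqrt (1 + u))))"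
      by (simp only: Re_complex_of_real)
  qed
qed

definition ln_main :: "nat \<Rightarrow> real" where
  "ln_main n = S_op n - ln (8 * real n) + ln (1 - 1 / S_op n)"

lemma S_op_ge_20: "\<forall>\<^sub>F n in sequentially. 20 \<le> S_op n"
  unfolding S_op_def by real_asymp

text \<open>The error 20 exp (0.87 S) relative to the main term: the constant 320 in the proof is 20
  * 8 * 2, with the 2 for 1 - 1 / S >= 1/2, and taking the logarithm doubles it once more.\<close>

lemma ln_overpart_asymp:
  "(\<lambda>n. ln (overpart n) - ln_main n) \<in> O(\<lambda>n. real n * exp (- (13 / 100 * S_op n)))"
proof (rule bigoI)
  have "(\<lambda>n. 320 * (real n * exp (- (13 / 100 * S_op n)))) \<longlonglongrightarrow> 0"
    unfolding S_op_def by real_asymp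
  hence "\<forall>\<^sub>F n in sequentially. 320 * (real n * exp (- (13 / 100 * S_op n))) < 1 / 2"
    by (rule order_tendstoD) simp
  thus "\<forall>\<^sub>F n in sequentially. norm (ln (overpart n) - ln_main n) \<le> 640 * norm (real n * exp (- (13 / 100 * S_op n)))"
    using S_op_ge_20 eventually_gt_at_top[of 0]
  proof eventually_elim
    case (elim n)
    define S where "S = S_op n"
    define e where "e = real n * exp (- (13 / 100 * S))"
    define M where "M = exp S / (8 * real n) * (1 - 1 / S)"
    have S: "20 \<le> S" and e: "320 * e < 1 / 2" "0 \<le> e" using elim by (auto simp: S_def e_def)
    have n: "real n > 0" using elim by simp
    have S1: "1 / S \<le> 1 / 20" using S by simp
    have M0: "M > 0" unfolding M_def using n S1 by simp
    have lM: "ln M = ln_main n"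
    proof -
      have "ln M = ln (exp S / (8 * real n)) + ln (1 - 1 / S)"
        unfolding M_def by (rule ln_mult_pos) (use n S1 in auto)
      also have "ln (exp S / (8 * real n)) = S - ln (8 * real n)"
        using n by (subst ln_divide_pos) auto
      finally show ?thesis by (simp add: ln_main_def S_def)
    qed
    define y where "y = overpart n / M - 1"
    have "\<bar>overpart n - M\<bar> \<le> 20 * exp (87 / 100 * S)"
      unfolding M_def by (rule overpart_estimate) (use S in \<open>auto simp: S_def S_op_def\<close>)
    also have "\<dots> \<le> 320 * e * M"
    proof -
      have "exp (87 / 100 * S) = exp (- (13 / 100 * S)) * exp S" unfolding exp_add[symmetric] by simp
      hence "320 * e * M = 40 * (1 - 1 / S) * exp (87 / 100 * S)" using n by (simp add: e_def M_def)
      moreover have "20 * exp (87 / 100 * S) \<le> 40 * (1 - 1 / S) * exp (87 / 100 * S)"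
        using S1 by (intro mult_right_mono) auto
      ultimately show ?thesis by simp
    qed
    finally have "\<bar>overpart n - M\<bar> / M \<le> 320 * e" using M0 by (simp add: pos_divide_le_eq)
    moreover have "\<bar>overpart n - M\<bar> / M = \<bar>y\<bar>"
    proof -
      have "y = (overpart n - M) / M" using M0 by (simp add: y_def diff_divide_distrib)
      thus ?thesis using M0 by (simp add: abs_divide)
    qed
    ultimately have y: "\<bar>y\<bar> \<le> 320 * e" by simp
    hence y2: "\<bar>y\<bar> \<le> 1 / 2" using e by linarith
    have "overpart n = M * (1 + y)" using M0 by (simp add: y_def)
    hence "ln (overpart n) - ln_main n = ln (1 + y)"
      using M0 y2 by (simp add: ln_mult lM[symmetric])
    moreover have "\<bar>ln (1 + y) - y\<bar> \<le> 2 * y\<^sup>2" by (rule abs_ln_one_plus_x_minus_x_bound[OF y2])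
    moreover have "2 * y\<^sup>2 \<le> \<bar>y\<bar>"
      using mult_right_mono[OF y2, of "2 * \<bar>y\<bar>"] by (simp add: power2_eq_square)
    ultimately have "\<bar>ln (overpart n) - ln_main n\<bar> \<le> 2 * (320 * e)" using y by linarith
    thus ?case using e(2) by (simp add: e_def S_def)
  qed
qed

text \<open>Passing from n to n + j is the substitution u = j / n. The tail is dominated by a
  geometric series of ratio 3 u, which is at most 1/2 because 6 j <= n; summing it turns 4 S into 8
  S.\<close>

lemma ln_main_expansion:
  fixes n j m :: nat and S :: real and a :: "nat \<Rightarrow> real"
  assumes S: "S = S_op n" "20 \<le> S" and n: "0 < n" "6 * j \<le> n"
    and a: "\<And>k. \<bar>a k\<bar> \<le> 4 * S * 3 ^ k"
       "\<And>u. \<bar>u\<bar> \<le> 1 / 4 \<Longrightarrow>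
          (\<lambda>k. a k * u ^ k) sums (S * sqrt (1 + u) - ln (1 + u) + ln (1 - 1 / (S * sqrt (1 + u))))"
  shows "\<bar>ln_main (n + j) - ln_main n - (\<Sum>k=1..m. a k * (real j / real n) ^ k)\<bar> \<le> 8 * S * (3 * real j / real n) ^ (m + 1)"
proof -
  define u where "u = real j / real n"
  have "6 * real j \<le> real n" using n(2) by (metis of_nat_le_iff of_nat_mult of_nat_numeral)
  hence u: "0 \<le> u" "6 * u \<le> 1" using n by (auto simp: u_def field_simps)
  define f where "f u = S * sqrt (1 + u) - ln (1 + u) + ln (1 - 1 / (S * sqrt (1 + u)))" for u
  have f: "(\<lambda>k. a k * v ^ k) sums f v" if "\<bar>v\<bar> \<le> 1 / 4" for v unfolding f_def by (rule a(2)[OF that])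
  have nj: "real (n + j) = real n * (1 + u)" using n by (simp add: u_def field_simps)
  have "S_op (n + j) = S * sqrt (1 + u)" unfolding S S_op_def nj by (simp add: real_sqrt_mult)
  moreover have "ln (8 * real (n + j)) = ln (8 * real n) + ln (1 + u)"
    unfolding nj using n u by (subst ln_mult_pos[symmetric]) (auto simp: mult_ac)
  ultimately have 1: "ln_main (n + j) = f u - ln (8 * real n)" by (simp add: ln_main_def f_def)
  have 2: "ln_main n = f 0 - ln (8 * real n)" by (simp add: ln_main_def f_def S)
  have "f 0 = a 0" using sums_unique2[OF f[of 0] powser_sums_zero] by simp
  moreover have "(\<lambda>k. a (k + (m + 1)) * u ^ (k + (m + 1))) sums (f u - (\<Sum>k<m+1. a k * u ^ k))"
    using f[of u] u by (subst sums_iff_shift) auto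
  moreover have "(\<Sum>k<m+1. a k * u ^ k) = a 0 + (\<Sum>k=1..m. a k * u ^ k)"
    by (simp add: lessThan_Suc_atMost atMost_atLeast0 sum.atLeast_Suc_atMost)
  ultimately have s: "(\<lambda>k. a (k + (m + 1)) * u ^ (k + (m + 1))) sums (ln_main (n + j) - ln_main n - (\<Sum>k=1..m. a k * u ^ k))"
    unfolding 1 2 by (simp add: diff_diff_eq)
  have g: "(\<lambda>k. 4 * S * (3 * u) ^ (m + 1) * (3 * u) ^ k) sums (4 * S * (3 * u) ^ (m + 1) * (1 / (1 - 3 * u)))"
    using u by (intro sums_mult geometric_sums) auto
  have "norm (a (k + (m + 1)) * u ^ (k + (m + 1))) \<le> 4 * S * (3 * u) ^ (m + 1) * (3 * u) ^ k" for k
  proof -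
    have "\<bar>a (k + (m + 1))\<bar> * u ^ (k + (m + 1)) \<le> (4 * S * 3 ^ (k + (m + 1))) * u ^ (k + (m + 1))"
      using u by (intro mult_right_mono a) auto
    also have "\<dots> = 4 * S * (3 * u) ^ (m + 1) * (3 * u) ^ k" by (simp add: power_mult_distrib power_add)
    finally show ?thesis using u by (simp add: abs_mult power_abs)
  qed
  from norm_sums_le[OF s g this]
  have "\<bar>ln_main (n + j) - ln_main n - (\<Sum>k=1..m. a k * u ^ k)\<bar> \<le> 4 * S * (3 * u) ^ (m + 1) * (1 / (1 - 3 * u))" by simp
  also have "\<dots> \<le> 4 * S * (3 * u) ^ (m + 1) * 2"
    using u S by (intro mult_left_mono) (auto simp: field_simps)
  finally show ?thesis by (simp add: u_def)
qed

text \<open>Here \<open>b k n\<close> is the k-th Taylor coefficient in j / n, divided by n^k. The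
  factor S in the coefficient bounds costs n^(1/2), so the remainder after degree m has order n^(1/2
  - (m + 1)); replacing \<open>ln_main\<close> by the true logarithm costs less than any power of
  n.\<close>

lemma overpart_log_expansion:
  obtains b :: "nat \<Rightarrow> nat \<Rightarrow> real" where
    "\<forall>\<^sub>F n in sequentially. b 1 n = A_op n"
    "\<forall>\<^sub>F n in sequentially. b 2 n = - (delta_op n)\<^sup>2"
    "\<And>k. b k \<in> O(\<lambda>n. real n powr (1 / 2 - real k))"
    "\<And>m j. (\<lambda>n. ln (overpart (n + j) / overpart n) - (\<Sum>k=1..m. b k n * real j ^ k))
        \<in> O(\<lambda>n. real n powr (- 1 / 2 - real m))"
proof -
  define good where "good n a \<longleftrightarrow> (let S = S_op n in
     a 1 = (S - 2 + 1 / (S - 1)) / 2 \<and> a 2 = (6 - S ^ 3 / (S - 1)\<^sup>2) / 8 \<and> (\<forall>k. \<bar>a k\<bar> \<le> 4 * S * 3 ^ k) \<and>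
     (\<forall>u. \<bar>u\<bar> \<le> 1 / 4 \<longrightarrow> (\<lambda>k. a k * u ^ k) sums (S * sqrt (1 + u) - ln (1 + u) + ln (1 - 1 / (S * sqrt (1 + u))))))"
    for n and a :: "nat \<Rightarrow> real"
  \<comment> \<open>Suitable coefficients are provided for S >= 20; for the finitely many other n
    the choice is arbitrary.\<close>
  define a where "a n = (SOME a. good n a)" for n
  have good: "good n (a n)" if S20: "20 \<le> S_op n" for n
  proof -
    obtain a where "a 1 = (S_op n - 2 + 1 / (S_op n - 1)) / 2" "a 2 = (6 - S_op n ^ 3 / (S_op n - 1)\<^sup>2) / 8"
      "\<And>k. \<bar>a k\<bar> \<le> 4 * S_op n * 3 ^ k"
      "\<And>u. \<bar>u\<bar> \<le> 1 / 4 \<Longrightarrow> (\<lambda>k. a k * u ^ k) sums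
         (S_op n * sqrt (1 + u) - ln (1 + u) + ln (1 - 1 / (S_op n * sqrt (1 + u))))"
      using main_term_expansion[OF S20] by blast
    hence "good n a" unfolding good_def Let_def by blast
    hence "\<exists>a. good n a" by (rule exI[of _ a])
    thus ?thesis unfolding a_def by (rule someI_ex)
  qed
  define b where "b k n = a n k / real n ^ k" for k n
  show ?thesis
  proof (rule that[of b])
    show "\<forall>\<^sub>F n in sequentially. b 1 n = A_op n"
      using S_op_ge_20 eventually_gt_at_top[of 0]
    proof eventually_elim
      case (elim n)
      define S where "S = S_op n"
      have S: "20 \<le> S" using elim by (simp add: S_def)
      have n: "real n = S\<^sup>2 / pi\<^sup>2" by (simp add: S_def S_op_def power_mult_distrib)
      have "a n 1 = (S - 2 + 1 / (S - 1)) / 2" using good[OF elim(1)] by (simp add: good_def S_def Let_def)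
      also have "\<dots> = S\<^sup>2 / 2 * (1 / (S - 1) - 3 / S\<^sup>2)"
        using S by (simp add: divide_simps) (simp add: power2_eq_square algebra_simps)
      finally have "b 1 n = S\<^sup>2 / 2 * (1 / (S - 1) - 3 / S\<^sup>2) / (S\<^sup>2 / pi\<^sup>2)"
        by (simp only: b_def n power_one_right)
      also have "\<dots> = pi\<^sup>2 / 2 * (1 / (S - 1) - 3 / S\<^sup>2)"
      proof -
        have "S\<^sup>2 / 2 * X / (S\<^sup>2 / pi\<^sup>2) = pi\<^sup>2 / 2 * X" for X using S by simp
        thus ?thesis .
      qed
      finally show ?case by (simp add: A_op_def S_def)
    qed
    show "\<forall>\<^sub>F n in sequentially. b 2 n = - (delta_op n)\<^sup>2"
      using S_op_ge_20 eventually_gt_at_top[of 0]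
    proof eventually_elim
      case (elim n)
      define S where "S = S_op n"
      define X where "X = 1 / (2 * S * (S - 1)\<^sup>2) - 3 / S ^ 4"
      have S: "20 \<le> S" using elim by (simp add: S_def)
      have n: "real n = S\<^sup>2 / pi\<^sup>2" by (simp add: S_def S_op_def power_mult_distrib)
      \<comment> \<open>Needed for the square of \<open>sqrt X\<close> to be X.\<close>
      have Xpos: "0 \<le> X"
      proof -
        have "6 * (S - 1)\<^sup>2 \<le> S * S\<^sup>2" using S by (intro mult_mono power_mono) auto
        hence "3 * (2 * S * (S - 1)\<^sup>2) \<le> S ^ 4" using S mult_left_mono[of "6 * (S - 1)\<^sup>2" "S * S\<^sup>2" S]
          by (simp add: power2_eq_square power4_eq_xxxx algebra_simps)
        hence "3 / S ^ 4 \<le> 1 / (2 * S * (S - 1)\<^sup>2)" using S by (simp add: divide_simps)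
        thus ?thesis by (simp add: X_def)
      qed
      have "a n 2 = (6 - S ^ 3 / (S - 1)\<^sup>2) / 8" using good[OF elim(1)] by (simp add: good_def S_def Let_def)
      also have "\<dots> = - (S ^ 4 / 4 * X)"
        using S unfolding X_def by (simp add: divide_simps) (simp add: power2_eq_square power3_eq_cube power4_eq_xxxx algebra_simps)
      finally have "b 2 n = - (S ^ 4 / 4 * X) / (S\<^sup>2 / pi\<^sup>2)\<^sup>2" by (simp add: b_def n)
      also have "\<dots> = - (pi ^ 4 / 4 * X)" using S by (simp add: power_divide flip: power_mult)
      also have "pi ^ 4 / 4 * X = (pi\<^sup>2 / 2 * sqrt X)\<^sup>2"
        using Xpos by (simp add: power_mult_distrib power_divide flip: power_mult)
      finally show ?case by (simp add: delta_op_def S_def X_def)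
    qed
    show "b k \<in> O(\<lambda>n. real n powr (1 / 2 - real k))" for k
    proof (rule bigoI)
      show "\<forall>\<^sub>F n in sequentially. norm (b k n) \<le> 4 * pi * 3 ^ k * norm (real n powr (1 / 2 - real k))"
        using S_op_ge_20 eventually_gt_at_top[of 0]
      proof eventually_elim
        case (elim n)
        have "\<bar>a n k\<bar> \<le> 4 * S_op n * 3 ^ k" using good[OF elim(1)] by (simp add: good_def Let_def)
        hence "\<bar>a n k\<bar> / real n ^ k \<le> 4 * S_op n * 3 ^ k / real n ^ k" by (intro divide_right_mono) auto
        also have "\<dots> = 4 * pi * 3 ^ k * (real n powr (1 / 2) / real n powr real k)"
          using elim by (simp add: S_op_def powr_half_sqrt powr_realpow)
        finally show ?case using elim by (simp add: b_def powr_diff)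
      qed
    qed
    fix m j
    let ?L = "\<lambda>n. ln_main (n + j) - ln_main n - (\<Sum>k=1..m. b k n * real j ^ k)"
    let ?P = "\<lambda>n. real n powr (- 1 / 2 - real m)"
    have O1: "(\<lambda>n. ?L n) \<in> O(?P)"
    proof (rule bigoI)
      show "\<forall>\<^sub>F n in sequentially. norm (?L n) \<le>
          (8 * pi * (3 * real j) ^ (m + 1)) * norm (?P n)"
        using S_op_ge_20 eventually_gt_at_top[of 0] eventually_ge_at_top[of "6 * j"]
      proof eventually_elim
        case (elim n)
        have sc: "(\<Sum>k=1..m. b k n * real j ^ k) = (\<Sum>k=1..m. a n k * (real j / real n) ^ k)"
          by (simp add: b_def power_divide)
        have "\<bar>ln_main (n + j) - ln_main n - (\<Sum>k=1..m. a n k * (real j / real n) ^ k)\<bar> \<le>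
           8 * S_op n * (3 * real j / real n) ^ (m + 1)"
          using good[OF elim(1)] elim by (intro ln_main_expansion) (auto simp: good_def Let_def)
        also have "\<dots> = 8 * pi * (3 * real j) ^ (m + 1) * (real n powr (1 / 2) / real n powr real (m + 1))"
          using elim by (simp only: power_divide S_op_def powr_half_sqrt powr_realpow of_nat_0_less_iff) simp
        also have "real n powr (1 / 2) / real n powr real (m + 1) = ?P n"
          using elim by (simp flip: powr_diff)
        finally show ?case unfolding sc using elim by simp
      qed
    qed
    have small: "(\<lambda>n. ln (overpart (n + i)) - ln_main (n + i)) \<in> O(?P)" for i
    proof -
      have "(\<lambda>n. ln (overpart (n + i)) - ln_main (n + i)) \<in> O(\<lambda>n. real (n + i) * exp (- (13 / 100 * S_op (n + i))))"
        by (rule landau_o.big.compose[OF ln_overpart_asymp]) (simp add: filterlim_add_const_nat_at_top)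
      also have "(\<lambda>n. real (n + i) * exp (- (13 / 100 * S_op (n + i)))) \<in> O(?P)"
        unfolding S_op_def by real_asymp
      finally show ?thesis .
    qed
    have "(\<lambda>n. (?L n) +
        ((ln (overpart (n + j)) - ln_main (n + j)) - (ln (overpart n) - ln_main n))) \<in> O(?P)"
      using sum_in_bigo(1)[OF O1 sum_in_bigo(2)[OF small[of j] small[of 0]]] by simp
    also have "(\<lambda>n. (?L n) +
        ((ln (overpart (n + j)) - ln_main (n + j)) - (ln (overpart n) - ln_main n))) =
        (\<lambda>n. ln (overpart (n + j) / overpart n) - (\<Sum>k=1..m. b k n * real j ^ k))"
      by (simp add: fun_eq_iff ln_divide_pos[OF overpart_pos overpart_pos])
    finally show "(\<lambda>n. ln (overpart (n + j) / overpart n) - (\<Sum>k=1..m. b k n * real j ^ k)) \<in> O(?P)" .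
  qed
qed

section \<open>Limits of Jensen polynomials\<close>

text \<open>An r-th difference lowers degrees by r. The induction uses Pascal's rule and the
  binomial expansion of (y + 1)^i - y^i. The offset x is general because the two Jensen polynomials
  lead to different offsets.\<close>

lemma alternating_sum_powers:
  fixes x :: real
  shows "i < r \<Longrightarrow> (\<Sum>s\<le>r. (-1) ^ s * real (r choose s) * (x + real s) ^ i) = 0"
    and "(\<Sum>s\<le>r. (-1) ^ s * real (r choose s) * (x + real s) ^ r) = (-1) ^ r * fact r"
proof -
  define T where "T r i x = (\<Sum>s\<le>r. (-1) ^ s * real (r choose s) * (x + real s) ^ i)" for r i and x :: real
  have rec: "T (Suc r) i x = - (\<Sum>l<i. real (i choose l) * T r l x)" for r i x
  proof -
    have "T (Suc r) i x = (\<Sum>s\<le>Suc r. (-1) ^ s * real (r choose s) * (x + real s) ^ i) +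
        (\<Sum>s\<in>{1..Suc r}. (-1) ^ s * real (r choose (s - 1)) * (x + real s) ^ i)"
    proof -
      have "(-1) ^ s * real (Suc r choose s) * (x + real s) ^ i = (-1) ^ s * real (r choose s) * (x + real s) ^ i +
          (if s \<ge> 1 then (-1) ^ s * real (r choose (s - 1)) * (x + real s) ^ i else 0)" for s
        by (cases s) (auto simp: algebra_simps)
      hence "T (Suc r) i x = (\<Sum>s\<le>Suc r. (-1) ^ s * real (r choose s) * (x + real s) ^ i) +
          (\<Sum>s\<le>Suc r. if s \<ge> 1 then (-1) ^ s * real (r choose (s - 1)) * (x + real s) ^ i else 0)"
        unfolding T_def by (simp only: sum.distrib)
      also have "(\<Sum>s\<le>Suc r. if s \<ge> 1 then (-1) ^ s * real (r choose (s - 1)) * (x + real s) ^ i else 0) =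
          (\<Sum>s\<in>{1..Suc r}. (-1) ^ s * real (r choose (s - 1)) * (x + real s) ^ i)"
        by (intro sum.mono_neutral_cong_right) auto
      finally show ?thesis .
    qed
    also have "(\<Sum>s\<le>Suc r. (-1) ^ s * real (r choose s) * (x + real s) ^ i) = T r i x" by (simp add: T_def)
    also have "(\<Sum>s\<in>{1..Suc r}. (-1) ^ s * real (r choose (s - 1)) * (x + real s) ^ i) =
        (\<Sum>s\<le>r. - ((-1) ^ s * real (r choose s) * (x + real s + 1) ^ i))"
      by (rule sum.reindex_bij_witness[of _ Suc "\<lambda>s. s - 1"]) (auto simp: add_ac Suc_le_eq gr0_conv_Suc)
    also have "T r i x + \<dots> = (\<Sum>s\<le>r. - ((-1) ^ s * real (r choose s) * ((x + real s + 1) ^ i - (x + real s) ^ i)))"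
      unfolding T_def sum.distrib[symmetric] by (intro sum.cong refl) (simp add: algebra_simps)
    also have "\<dots> = (\<Sum>s\<le>r. - ((-1) ^ s * real (r choose s) * (\<Sum>l<i. real (i choose l) * (x + real s) ^ l)))"
    proof -
      have "(y + 1) ^ i - y ^ i = (\<Sum>l<i. real (i choose l) * y ^ l)" for y :: real
        by (subst binomial_ring) (simp add: lessThan_Suc_atMost[symmetric])
      thus ?thesis by simp
    qed
    also have "\<dots> = - (\<Sum>l<i. real (i choose l) * T r l x)"
      unfolding T_def sum_negf sum_distrib_left
      by (subst sum.swap) (simp add: mult_ac)
    finally show ?thesis .
  qed
  have "(\<forall>i<r. T r i x = 0) \<and> T r r x = (-1) ^ r * fact r" for r x
  proof (induction r arbitrary: x)
    case 0
    show ?case by (simp add: T_def)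
  next
    case (Suc r)
    have "T (Suc r) i x = 0" if "i < Suc r" for i
      unfolding rec using that Suc by (intro neg_equal_0_iff_equal[THEN iffD2] sum.neutral) auto
    moreover have "T (Suc r) (Suc r) x = (-1) ^ Suc r * fact (Suc r)"
      unfolding rec using Suc by (simp add: algebra_simps)
    ultimately show ?case by blast
  qed
  hence all: "(\<forall>i<r. T r i x = 0)" "T r r x = (-1) ^ r * fact r" by simp_all
  thus "i < r \<Longrightarrow> (\<Sum>s\<le>r. (-1) ^ s * real (r choose s) * (x + real s) ^ i) = 0"
    and "(\<Sum>s\<le>r. (-1) ^ s * real (r choose s) * (x + real s) ^ r) = (-1) ^ r * fact r"
    unfolding T_def by simp_all
qed

lemma tendsto_coeff_power:
  fixes p :: "'a \<Rightarrow> real poly"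
  assumes "\<And>i. ((\<lambda>n. coeff (p n) i) \<longlongrightarrow> coeff P i) F"
  shows "((\<lambda>n. coeff (p n ^ l) i) \<longlongrightarrow> coeff (P ^ l) i) F"
proof (induction l arbitrary: i)
  case (Suc l)
  show ?case unfolding power_Suc coeff_mult by (intro tendsto_intros assms Suc)
qed simp

lemma exp_taylor_bound:
  fixes x :: real
  shows "\<bar>exp x - (\<Sum>l<n. x ^ l / fact l)\<bar> \<le> exp \<bar>x\<bar> * \<bar>x\<bar> ^ n"
proof -
  obtain t where t: "\<bar>t\<bar> \<le> \<bar>x\<bar>" "exp x = (\<Sum>l<n. x ^ l / fact l) + exp t / fact n * x ^ n"
    using Maclaurin_exp_le by blast
  have "\<bar>exp x - (\<Sum>l<n. x ^ l / fact l)\<bar> = exp t / fact n * \<bar>x\<bar> ^ n"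
    unfolding t(2) by (simp add: abs_mult power_abs)
  also have "exp t / fact n \<le> exp \<bar>x\<bar> / 1"
    using t(1) by (intro frac_le) (auto simp: fact_ge_1)
  finally show ?thesis by (simp add: mult_right_mono)
qed

text \<open>The coefficients of H_d(X / 2): halving the argument cancels the powers of 2 in H_d, and
  k = d - 2 l forces d - k to be even.\<close>

definition hj_coeff :: "nat \<Rightarrow> nat \<Rightarrow> real" where
  "hj_coeff d k = (if k \<le> d \<and> even (d - k)
     then fact d * (-1) ^ ((d - k) div 2) / (fact ((d - k) div 2) * fact k) else 0)"

lemma coeff_hj_limit: "coeff (hj_limit d (-1)) k = of_real (hj_coeff d k)"
proof -
  have "coeff (hermite d) k = (\<Sum>l\<le>d div 2. if d - 2 * l = k then
      fact d * (-1) ^ l * 2 ^ (d - 2 * l) / (fact l * fact (d - 2 * l)) else 0)"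
    unfolding hermite_def coeff_sum by (simp add: coeff_monom)
  also have "\<dots> = 2 ^ k * of_real (hj_coeff d k)"
  proof (cases "k \<le> d \<and> even (d - k)")
    case True
    then obtain l where l: "d - k = 2 * l" by blast
    have "(\<Sum>l'\<le>d div 2. if d - 2 * l' = k then
        fact d * (-1) ^ l' * 2 ^ (d - 2 * l') / (fact l' * fact (d - 2 * l')) else (0::complex)) =
      (\<Sum>l'\<in>{l}. fact d * (-1) ^ l' * 2 ^ (d - 2 * l') / (fact l' * fact (d - 2 * l')))"
      using True l by (intro sum.mono_neutral_cong_right) auto
    moreover have "d - 2 * l = k" using True l by linarith
    ultimately show ?thesis using True l by (simp add: hj_coeff_def)
  next
    case False
    have "(if d - 2 * l' = k then
        fact d * (-1) ^ l' * 2 ^ (d - 2 * l') / (fact l' * fact (d - 2 * l')) else (0::complex)) = 0" if "l' \<le> d div 2" for l'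
      using that False by auto
    thus ?thesis using False by (simp add: hj_coeff_def)
  qed
  finally show ?thesis by (simp add: hj_limit_def coeff_pcompose_linear power_divide)
qed

text \<open>One formula for both Jensen polynomials, with exponents j and d - j.\<close>

lemma coeff_pcompose_monom_sum:
  fixes a :: "nat \<Rightarrow> real"
  shows "coeff (pcompose (\<Sum>j\<le>d. monom (a j) (e j)) [:u, v:]) k =
           (\<Sum>j\<le>d. a j * (real (e j choose k) * v ^ k * u ^ (e j - k)))"
proof -
  have pm: "pcompose (monom c n) p = smult c (p ^ n)" for c :: real and n p
    by (induction n) (simp_all add: monom_0 monom_Suc pcompose_pCons mult.commute)
  have cp: "coeff ([:u, v:] ^ n) k = real (n choose k) * v ^ k * u ^ (n - k)" for n
  proof (cases "k \<le> n")
    case False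
    have "degree ([:u, v:] ^ n) \<le> n * degree [:u, v:]" using degree_power_le[of "[:u, v:]" n] by (simp add: mult.commute)
    also have "\<dots> \<le> n * 1" by (intro mult_left_mono) auto
    finally show ?thesis using False by (simp add: coeff_eq_0 binomial_eq_0)
  qed (rule coeff_linear_poly_power)
  show ?thesis by (simp only: pcompose_sum pm coeff_sum coeff_smult cp)
qed

text \<open>Up to o(delta^d), exp (y j n) is a polynomial in delta * j whose coefficients tend to
  those of a truncation of exp (- x^2). The weights kill all powers of j below r, so after division
  by delta^r only the coefficient of degree r, times mu, survives.\<close>

lemma finite_difference_exp_limit:
  fixes \<delta> :: "nat \<Rightarrow> real" and c y :: "nat \<Rightarrow> nat \<Rightarrow> real" and w :: "nat \<Rightarrow> real"
  assumes \<delta>: "\<delta> \<longlonglongrightarrow> 0" "\<forall>\<^sub>F n in sequentially. 0 < \<delta> n"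
    and m: "2 \<le> m" and r: "r \<le> d" and d: "1 \<le> d"
    and c: "\<And>k. k \<in> {1..m} \<Longrightarrow> c k \<longlonglongrightarrow> (if k = 2 then -1 else 0)"
    and y: "\<And>j. j \<le> d \<Longrightarrow> (\<lambda>n. (y j n - (\<Sum>k=1..m. c k n * (\<delta> n * real j) ^ k)) / \<delta> n ^ d) \<longlonglongrightarrow> 0"
    and w: "\<And>i. i < r \<Longrightarrow> (\<Sum>j\<le>d. w j * real j ^ i) = 0" "(\<Sum>j\<le>d. w j * real j ^ r) = \<mu>"
  shows "(\<lambda>n. (\<Sum>j\<le>d. w j * exp (y j n)) / \<delta> n ^ r) \<longlonglongrightarrow>
           \<mu> * (if even r then (-1) ^ (r div 2) / fact (r div 2) else 0)"
proof -
  have ne: "\<forall>\<^sub>F n in sequentially. \<delta> n \<noteq> 0" using \<delta>(2) by eventually_elim simp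
  define p where "p n = (\<Sum>k=1..m. monom (c k n) k)" for n
  \<comment> \<open>The exponential may be cut after the d-th power: at each point delta * j the
    inner polynomial is o(delta), so the rest is o(delta^d).\<close>
  define Q where "Q n = (\<Sum>l\<le>d. smult (1 / fact l) (p n ^ l))" for n
  define P where "P = (monom (-1) 2 :: real poly)"
  define q where "q = (\<Sum>l\<le>d. smult (1 / fact l) (P ^ l))"
  define z where "z j n = poly (p n) (\<delta> n * real j)" for j n
  have coeff_p: "coeff (p n) i = (if i \<in> {1..m} then c i n else 0)" for n i
    by (simp add: p_def coeff_sum coeff_monom)
  have "(\<lambda>n. coeff (p n) i) \<longlonglongrightarrow> coeff P i" for i
  proof (cases "i \<in> {1..m}")
    case True
    thus ?thesis unfolding coeff_p P_def coeff_monom using c[OF True] by (auto simp: eq_commute[of 2])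
  next
    case False
    hence "i \<noteq> 2" using m by auto
    thus ?thesis unfolding coeff_p P_def coeff_monom by (simp only: False if_False) simp
  qed
  hence Qlim: "(\<lambda>n. coeff (Q n) i) \<longlonglongrightarrow> coeff q i" for i
    unfolding Q_def q_def coeff_sum coeff_smult by (intro tendsto_intros tendsto_coeff_power)
  have poly_Q: "poly (Q n) x = (\<Sum>l<Suc d. poly (p n) x ^ l / fact l)" for n x
    by (simp add: Q_def poly_sum lessThan_Suc_atMost)
  have zsum: "z j n = (\<Sum>k=1..m. c k n * (\<delta> n * real j) ^ k)" for j n
    by (simp add: z_def p_def poly_sum poly_monom)
  have zd: "(\<lambda>n. z j n / \<delta> n) \<longlonglongrightarrow> 0" for j
  proof -
    have "(\<lambda>n. \<Sum>k=1..m. c k n * (real j ^ k * \<delta> n ^ (k - 1))) \<longlonglongrightarrow>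
        (\<Sum>k=1..m. (if k = 2 then -1 else 0) * (real j ^ k * 0 ^ (k - 1)))"
      by (intro tendsto_intros c \<delta>(1)) auto
    also have "(\<Sum>k=1..m. (if k = 2 then -1 else 0) * (real j ^ k * 0 ^ (k - 1))) = 0"
      by (intro sum.neutral) auto
    finally show ?thesis
    proof (rule Lim_transform_eventually)
      show "\<forall>\<^sub>F n in sequentially. (\<Sum>k=1..m. c k n * (real j ^ k * \<delta> n ^ (k - 1))) = z j n / \<delta> n"
        using ne
      proof eventually_elim
        case (elim n)
        have "c k n * (real j ^ k * \<delta> n ^ (k - 1)) = c k n * (\<delta> n * real j) ^ k / \<delta> n" if "k \<in> {1..m}" for k
          using elim that by (cases k) (auto simp: power_mult_distrib)
        thus ?case unfolding zsum sum_divide_distrib by (intro sum.cong) auto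
      qed
    qed
  qed
  have z0: "(\<lambda>n. z j n) \<longlonglongrightarrow> 0" for j
  proof -
    have "(\<lambda>n. z j n / \<delta> n * \<delta> n) \<longlonglongrightarrow> 0 * 0" by (intro tendsto_mult zd \<delta>(1))
    moreover have "\<forall>\<^sub>F n in sequentially. z j n / \<delta> n * \<delta> n = z j n" using ne by eventually_elim simp
    ultimately show ?thesis by (simp add: Lim_transform_eventually)
  qed
  let ?P = "\<lambda>j n. poly (Q n) (\<delta> n * real j)"
  let ?F = "\<lambda>j n. exp (y j n) - poly (Q n) (\<delta> n * real j)"
  let ?G = "\<lambda>j n. exp (z j n) - poly (Q n) (\<delta> n * real j)"
  let ?H = "\<lambda>j n. exp (y j n) - exp (z j n)"
  have W: "(\<lambda>n. (?F j n) / \<delta> n ^ d) \<longlonglongrightarrow> 0" if j: "j \<le> d" for j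
  proof -
    define e where "e n = y j n - z j n" for n
    have ed: "(\<lambda>n. e n / \<delta> n ^ d) \<longlonglongrightarrow> 0" using y[OF j] by (simp add: e_def zsum)
    have e0: "e \<longlonglongrightarrow> 0"
    proof -
      have "(\<lambda>n. e n / \<delta> n ^ d * \<delta> n ^ d) \<longlonglongrightarrow> 0 * 0 ^ d" by (intro tendsto_intros ed \<delta>(1))
      moreover have "\<forall>\<^sub>F n in sequentially. e n / \<delta> n ^ d * \<delta> n ^ d = e n" using ne by eventually_elim simp
      ultimately show ?thesis using d by (simp add: Lim_transform_eventually)
    qed
    have E1: "(\<lambda>n. (?H j n) / \<delta> n ^ d) \<longlonglongrightarrow> 0"
    proof (rule Lim_null_comparison)
      have "(\<lambda>n. exp (z j n) * exp \<bar>e n\<bar> * \<bar>e n / \<delta> n ^ d\<bar>) \<longlonglongrightarrow> exp 0 * exp \<bar>0\<bar> * \<bar>0\<bar>"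
        by (intro tendsto_intros z0 e0 ed)
      thus "(\<lambda>n. exp (z j n) * exp \<bar>e n\<bar> * \<bar>e n / \<delta> n ^ d\<bar>) \<longlonglongrightarrow> 0" by simp
      show "\<forall>\<^sub>F n in sequentially. norm ((?H j n) / \<delta> n ^ d) \<le> exp (z j n) * exp \<bar>e n\<bar> * \<bar>e n / \<delta> n ^ d\<bar>"
      proof (intro always_eventually allI)
        fix n
        have "?H j n = exp (z j n) * (exp (e n) - 1)"
          by (simp add: e_def right_diff_distrib flip: exp_add)
        hence "\<bar>?H j n\<bar> = exp (z j n) * \<bar>exp (e n) - 1\<bar>" by (simp add: abs_mult)
        also have "\<bar>exp (e n) - 1\<bar> \<le> exp \<bar>e n\<bar> * \<bar>e n\<bar>" using exp_taylor_bound[of "e n" 1] by simp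
        finally have "\<bar>?H j n\<bar> \<le> exp (z j n) * (exp \<bar>e n\<bar> * \<bar>e n\<bar>)" by simp
        hence "\<bar>?H j n\<bar> / \<bar>\<delta> n ^ d\<bar> \<le> exp (z j n) * (exp \<bar>e n\<bar> * \<bar>e n\<bar>) / \<bar>\<delta> n ^ d\<bar>"
          by (intro divide_right_mono) auto
        thus "norm ((?H j n) / \<delta> n ^ d) \<le> exp (z j n) * exp \<bar>e n\<bar> * \<bar>e n / \<delta> n ^ d\<bar>"
          by (simp add: mult.assoc)
      qed
    qed
    have E2: "(\<lambda>n. (?G j n) / \<delta> n ^ d) \<longlonglongrightarrow> 0"
    proof (rule Lim_null_comparison)
      have "(\<lambda>n. exp \<bar>z j n\<bar> * \<bar>z j n\<bar> * \<bar>z j n / \<delta> n\<bar> ^ d) \<longlonglongrightarrow> exp \<bar>0\<bar> * \<bar>0\<bar> * \<bar>0\<bar> ^ d"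
        by (intro tendsto_intros z0 zd)
      thus "(\<lambda>n. exp \<bar>z j n\<bar> * \<bar>z j n\<bar> * \<bar>z j n / \<delta> n\<bar> ^ d) \<longlonglongrightarrow> 0" by simp
      show "\<forall>\<^sub>F n in sequentially. norm ((?G j n) / \<delta> n ^ d) \<le>
          exp \<bar>z j n\<bar> * \<bar>z j n\<bar> * \<bar>z j n / \<delta> n\<bar> ^ d"
      proof (intro always_eventually allI)
        fix n
        have "\<bar>?G j n\<bar> \<le> exp \<bar>z j n\<bar> * \<bar>z j n\<bar> ^ Suc d"
          unfolding poly_Q z_def[symmetric] by (rule exp_taylor_bound)
        hence "\<bar>?G j n\<bar> / \<bar>\<delta> n ^ d\<bar> \<le> exp \<bar>z j n\<bar> * \<bar>z j n\<bar> ^ Suc d / \<bar>\<delta> n ^ d\<bar>"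
          by (intro divide_right_mono) auto
        thus "norm ((?G j n) / \<delta> n ^ d) \<le>
          exp \<bar>z j n\<bar> * \<bar>z j n\<bar> * \<bar>z j n / \<delta> n\<bar> ^ d"
          by (simp add: power_divide power_abs mult.assoc)
      qed
    qed
    from tendsto_add[OF E1 E2] show ?thesis by (simp add: diff_divide_distrib)
  qed
  \<comment> \<open>A degree bound common to all \<open>Q n\<close>; the summand r makes it plain
    that r is an index of the sum.\<close>
  define D where "D = m * d + r"
  define M where "M i = (\<Sum>j\<le>d. w j * real j ^ i)" for i
  have degQ: "degree (Q n) \<le> D" for n
  proof -
    have "degree (p n) \<le> m"
      unfolding p_def by (intro degree_sum_le) (auto intro: order.trans[OF degree_monom_le])
    hence "degree (p n ^ l) \<le> m * d" if "l \<le> d" for l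
      using degree_power_le[of "p n" l] mult_mono[of "degree (p n)" m l d] that by linarith
    hence "degree (Q n) \<le> m * d"
      unfolding Q_def by (intro degree_sum_le) (auto intro: order.trans[OF degree_smult_le])
    thus ?thesis by (simp add: D_def)
  qed
  have polyD: "poly (Q n) x = (\<Sum>i\<le>D. coeff (Q n) i * x ^ i)" for n x
    unfolding poly_altdef using degQ[of n] by (intro sum.mono_neutral_left) (auto simp: coeff_eq_0)
  have "(\<lambda>n. (\<Sum>i\<le>D. coeff (Q n) i * M i * (if i < r then 0 else \<delta> n ^ (i - r))) +
      (\<Sum>j\<le>d. w j * ((?F j n) / \<delta> n ^ d)) * \<delta> n ^ (d - r)) \<longlonglongrightarrow>
      (\<Sum>i\<le>D. coeff q i * M i * (if i < r then 0 else 0 ^ (i - r))) + (\<Sum>j\<le>d. w j * 0) * 0 ^ (d - r)"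
    by (intro tendsto_add tendsto_sum tendsto_mult tendsto_const Qlim W tendsto_power \<delta>(1)) (auto intro!: tendsto_power \<delta>(1))
  also have "(\<Sum>i\<le>D. coeff q i * M i * (if i < r then 0 else 0 ^ (i - r))) = (\<Sum>i\<in>{r}. coeff q i * M i)"
    by (intro sum.mono_neutral_cong_right) (auto simp: D_def)
  also have "(\<Sum>i\<in>{r}. coeff q i * M i) + (\<Sum>j\<le>d. w j * 0) * 0 ^ (d - r) = \<mu> * coeff q r"
    by (simp add: M_def w(2) mult.commute)
  also have "coeff q r = (if even r then (-1) ^ (r div 2) / fact (r div 2) else 0)"
  proof -
    have "coeff q r = (\<Sum>l\<le>d. if 2 * l = r then (-1) ^ l / fact l else 0)"
      unfolding q_def P_def coeff_sum coeff_smult monom_power coeff_monom by (intro sum.cong) auto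
    also have "\<dots> = (if even r then (-1) ^ (r div 2) / fact (r div 2) else 0)"
    proof (cases "even r")
      case True
      then obtain s where s: "r = 2 * s" by blast
      have "(\<Sum>l\<le>d. if 2 * l = r then (-1) ^ l / fact l else 0 :: real) = (\<Sum>l\<in>{s}. (-1) ^ l / fact l)"
        using s r by (intro sum.mono_neutral_cong_right) auto
      thus ?thesis using s by simp
    next
      case False
      thus ?thesis by (auto intro!: sum.neutral)
    qed
    finally show ?thesis .
  qed
  finally show ?thesis
  proof (rule Lim_transform_eventually)
    show "\<forall>\<^sub>F n in sequentially. (\<Sum>i\<le>D. coeff (Q n) i * M i * (if i < r then 0 else \<delta> n ^ (i - r))) +
      (\<Sum>j\<le>d. w j * ((?F j n) / \<delta> n ^ d)) * \<delta> n ^ (d - r) =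
      (\<Sum>j\<le>d. w j * exp (y j n)) / \<delta> n ^ r"
      using ne
    proof eventually_elim
      case (elim n)
      have "(\<Sum>j\<le>d. w j * ?P j n) = (\<Sum>j\<le>d. \<Sum>i\<le>D. coeff (Q n) i * \<delta> n ^ i * (w j * real j ^ i))"
        unfolding polyD by (simp add: sum_distrib_left power_mult_distrib mult_ac)
      also have "\<dots> = (\<Sum>i\<le>D. coeff (Q n) i * \<delta> n ^ i * M i)"
        unfolding M_def sum_distrib_left by (rule sum.swap)
      finally have "(\<Sum>j\<le>d. w j * ?P j n) / \<delta> n ^ r = (\<Sum>i\<le>D. coeff (Q n) i * \<delta> n ^ i * M i / \<delta> n ^ r)"
        by (simp add: sum_divide_distrib)
      also have "\<dots> = (\<Sum>i\<le>D. coeff (Q n) i * M i * (if i < r then 0 else \<delta> n ^ (i - r)))"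
        using w(1) elim by (intro sum.cong refl) (auto simp: M_def power_diff)
      finally have 1: "(\<Sum>i\<le>D. coeff (Q n) i * M i * (if i < r then 0 else \<delta> n ^ (i - r))) =
         (\<Sum>j\<le>d. w j * ?P j n) / \<delta> n ^ r" by simp
      have "\<delta> n ^ (d - r) / \<delta> n ^ d = 1 / \<delta> n ^ r" using elim r by (simp add: power_diff)
      hence "X / \<delta> n ^ d * \<delta> n ^ (d - r) = X / \<delta> n ^ r" for X
        by (metis times_divide_eq_left times_divide_eq_right mult.right_neutral mult.commute)
      moreover have "(\<Sum>j\<le>d. w j * ((?F j n) / \<delta> n ^ d)) =
         (\<Sum>j\<le>d. w j * (?F j n)) / \<delta> n ^ d"
        by (simp add: sum_divide_distrib)
      ultimately have 2: "(\<Sum>j\<le>d. w j * ((?F j n) / \<delta> n ^ d)) * \<delta> n ^ (d - r) =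
         (\<Sum>j\<le>d. w j * (?F j n)) / \<delta> n ^ r" by simp
      show ?case unfolding 1 2 add_divide_distrib[symmetric] sum.distrib[symmetric]
        by (simp add: right_diff_distrib)
    qed
  qed
qed

text \<open>By C(d, j) C(j, k) = C(d, k) C(r, j - k) the weights are those of an r-th difference: at
  offset k for the first polynomial and, after reflecting the binomials, at offset 0 for the
  reversed one.\<close>

lemma jensen_weight_moments:
  fixes d k :: nat
  assumes k: "k \<le> d"
  defines "r \<equiv> d - k"
  shows "(\<Sum>j\<le>d. (real (d choose j) * real (j choose k) * (-1) ^ (j - k)) * real j ^ i) =
           real (d choose k) * (\<Sum>s\<le>r. (-1) ^ s * real (r choose s) * (real k + real s) ^ i)"
    and "(\<Sum>j\<le>d. (real (d choose j) * real (d - j choose k) * (-1) ^ (d - j - k)) * real j ^ i) =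
           real (d choose k) * (-1) ^ r * (\<Sum>s\<le>r. (-1) ^ s * real (r choose s) * (0 + real s) ^ i)"
proof -
  let ?a = "\<lambda>j. (real (d choose j) * real (j choose k) * (-1) ^ (j - k)) * real j ^ i"
  let ?b = "\<lambda>j. (real (d choose j) * real (d - j choose k) * (-1) ^ (d - j - k)) * real j ^ i"
  let ?R = "real (d choose k) * (\<Sum>s\<le>r. (-1) ^ s * real (r choose s) * (real k + real s) ^ i)"
  let ?R' = "real (d choose k) * (-1) ^ r * (\<Sum>s\<le>r. (-1) ^ s * real (r choose s) * (0 + real s) ^ i)"
  have "(\<Sum>j\<le>d. ?a j) =
      (\<Sum>j\<in>{k..d}. ?a j)"
    by (intro sum.mono_neutral_right) (auto simp: binomial_eq_0)
  also have "\<dots> = (\<Sum>s\<le>r. real (d choose k) * ((-1) ^ s * real (r choose s) * (real k + real s) ^ i))"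
  proof (rule sum.reindex_bij_witness[of _ "\<lambda>s. k + s" "\<lambda>j. j - k"])
    fix j assume j: "j \<in> {k..d}"
    have "real (d choose j) * real (j choose k) = real (d choose k) * real (r choose (j - k))"
      using choose_mult[of k j d] j unfolding r_def by (simp flip: of_nat_mult)
    moreover have "real k + real (j - k) = real j" using j by simp
    ultimately show "real (d choose k) * ((-1) ^ (j - k) * real (r choose (j - k)) * (real k + real (j - k)) ^ i) =
       ?a j" by simp
  qed (use k in \<open>auto simp: r_def\<close>)
  finally show "(\<Sum>j\<le>d. ?a j) =
           ?R"
    by (simp add: sum_distrib_left)
  have "(\<Sum>j\<le>d. ?b j) =
      (\<Sum>j\<le>r. ?b j)"
    by (intro sum.mono_neutral_right) (auto simp: binomial_eq_0 r_def)
  also have "\<dots> = (\<Sum>j\<le>r. real (d choose k) * (-1) ^ r * ((-1) ^ j * real (r choose j) * (0 + real j) ^ i))"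
  proof (rule sum.cong[OF refl])
    fix j assume "j \<in> {..r}"
    hence j: "j \<le> r" "j \<le> d" "k \<le> d - j" using k by (auto simp: r_def)
    have "(d choose (d - j)) * (d - j choose k) = (d choose k) * (d - k choose (d - j - k))"
      using j by (intro choose_mult) auto
    moreover have "d choose (d - j) = d choose j" using j binomial_symmetric[of j d] by simp
    moreover have "d - k choose (d - j - k) = r choose j"
      using j binomial_symmetric[of j r] by (simp add: r_def add.commute)
    ultimately have "(d choose j) * (d - j choose k) = (d choose k) * (r choose j)" by simp
    hence "real (d choose j) * real (d - j choose k) = real (d choose k) * real (r choose j)"
      by (simp flip: of_nat_mult)
    moreover have "(-1 :: real) ^ (d - j - k) = (-1) ^ r * (-1) ^ j"
    proof -
      have "r = (d - j - k) + j" using j by (simp add: r_def)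
      hence "(-1 :: real) ^ r * (-1) ^ j = (-1) ^ (d - j - k) * ((-1) ^ j * (-1) ^ j)"
        by (simp only: power_add mult.assoc)
      thus ?thesis by (simp flip: power_mult_distrib)
    qed
    ultimately show "?b j =
       real (d choose k) * (-1) ^ r * ((-1) ^ j * real (r choose j) * (0 + real j) ^ i)" by simp
  qed
  finally show "(\<Sum>j\<le>d. ?b j) =
           ?R'"
    by (simp add: sum_distrib_left)
qed

lemma hj_coeff_eq:
  assumes "k \<le> d"
  shows "real (d choose k) * fact (d - k) * (if even (d - k) then (-1) ^ ((d - k) div 2) / fact ((d - k) div 2) else 0) = hj_coeff d k"
  using assms by (simp add: hj_coeff_def binomial_fact)

text \<open>In the coefficient of X^k the powers of exp (A n) combine so that alpha(n + j) /
  alpha(n) appears with the factor exp (- A j). What remains is a combination of these quantities,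
  with weights independent of n, divided by delta^(d - k).\<close>

lemma hermite_jensen_of_expansion:
  fixes \<alpha> A \<delta> :: "nat \<Rightarrow> real" and c :: "nat \<Rightarrow> nat \<Rightarrow> real"
  assumes pos: "\<And>n. 0 < \<alpha> n"
    and \<delta>: "\<delta> \<longlonglongrightarrow> 0" "\<forall>\<^sub>F n in sequentially. 0 < \<delta> n"
    and m: "2 \<le> m" and d: "1 \<le> d"
    and c: "\<And>k. k \<in> {1..m} \<Longrightarrow> c k \<longlonglongrightarrow> (if k = 2 then -1 else 0)"
    and y: "\<And>j. j \<le> d \<Longrightarrow> (\<lambda>n. (ln (\<alpha> (n + j) / \<alpha> n) - A n * real j -
              (\<Sum>k=1..m. c k n * (\<delta> n * real j) ^ k)) / \<delta> n ^ d) \<longlonglongrightarrow> 0"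
  shows "hermite_jensen d \<alpha> A (-1) \<delta>"
proof -
  have ne: "\<forall>\<^sub>F n in sequentially. \<delta> n \<noteq> 0" using \<delta>(2) by eventually_elim simp
  define Y where "Y j n = ln (\<alpha> (n + j) / \<alpha> n) - A n * real j" for j n
  have expY: "exp (Y j n) = \<alpha> (n + j) / \<alpha> n / exp (A n) ^ j" for j n
    using pos[of n] pos[of "n + j"] by (simp add: Y_def exp_diff mult.commute flip: exp_of_nat_mult)
  have lim: "(\<lambda>n. (\<Sum>j\<le>d. w j * exp (Y j n)) / \<delta> n ^ r) \<longlonglongrightarrow>
      \<mu> * (if even r then (-1) ^ (r div 2) / fact (r div 2) else 0)"
    if "r \<le> d" "\<And>i. i < r \<Longrightarrow> (\<Sum>j\<le>d. w j * real j ^ i) = 0" "(\<Sum>j\<le>d. w j * real j ^ r) = \<mu>" for r w \<mu>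
    by (rule finite_difference_exp_limit[OF \<delta> m that(1) d c _ that(2,3)]) (use y in \<open>auto simp: Y_def\<close>)
  let ?J = "\<lambda>k n. coeff (smult (inverse (\<delta> n ^ d)) (smult (inverse (\<alpha> n))
          (pcompose (jensen_poly \<alpha> d n) [: - inverse (exp (A n)), \<delta> n / exp (A n) :]))) k"
  let ?K = "\<lambda>k n. coeff (smult (inverse ((exp (A n) * \<delta> n) ^ d)) (smult (inverse (\<alpha> n))
          (pcompose (jensen_poly_rev \<alpha> d n) [: - exp (A n), exp (A n) * \<delta> n :]))) k"
  let ?e = "\<lambda>r. (if even r then (-1) ^ (r div 2) / fact (r div 2) else 0) :: real"
  have J: "(\<lambda>n. ?J k n) \<longlonglongrightarrow> hj_coeff d k" for k
  proof (cases "k \<le> d")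
    case False
    thus ?thesis unfolding jensen_poly_def coeff_smult coeff_pcompose_monom_sum
      by (simp add: binomial_eq_0 hj_coeff_def)
  next
    case True
    define r where "r = d - k"
    define w where "w j = real (d choose j) * real (j choose k) * (-1) ^ (j - k)" for j
    have mom: "(\<Sum>j\<le>d. w j * real j ^ i) = real (d choose k) * (\<Sum>s\<le>r. (-1) ^ s * real (r choose s) * (real k + real s) ^ i)" for i
      unfolding w_def r_def by (rule jensen_weight_moments[OF True])
    have "(\<lambda>n. (\<Sum>j\<le>d. w j * exp (Y j n)) / \<delta> n ^ r) \<longlonglongrightarrow>
      real (d choose k) * ((-1) ^ r * fact r) * ?e r"
      by (rule lim) (simp_all add: r_def[symmetric] mom alternating_sum_powers, simp add: r_def)
    \<comment> \<open>The last factor vanishes for odd r, so the sign (-1)^r disappears.\<close>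
    also have "real (d choose k) * ((-1) ^ r * fact r) * ?e r = hj_coeff d k"
      unfolding hj_coeff_eq[OF True, symmetric] r_def by (cases "even (d - k)") auto
    finally show ?thesis
    proof (rule Lim_transform_eventually)
      show "\<forall>\<^sub>F n in sequentially. (\<Sum>j\<le>d. w j * exp (Y j n)) / \<delta> n ^ r =
         ?J k n"
        using ne
      proof eventually_elim
        case (elim n)
        define E where "E = exp (A n)"
        have E0: "E \<noteq> 0" by (simp add: E_def)
        have a0: "\<alpha> n \<noteq> 0" using pos[of n] by simp
        have dk: "\<delta> n ^ d = \<delta> n ^ r * \<delta> n ^ k" using True by (simp add: r_def flip: power_add)
        have "w j * exp (Y j n) / \<delta> n ^ r = inverse (\<delta> n ^ d) * (inverse (\<alpha> n) *
            (real (d choose j) * \<alpha> (n + j) * (real (j choose k) * (\<delta> n / E) ^ k * (- inverse E) ^ (j - k))))" for j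
        proof (cases "k \<le> j")
          case True
          have "(- inverse E) ^ (j - k) = (-1) ^ (j - k) * inverse E ^ (j - k)" by (simp flip: power_mult_distrib)
          moreover have "E ^ j = E ^ (j - k) * E ^ k" using True by (simp flip: power_add)
          ultimately show ?thesis unfolding w_def expY E_def[symmetric] dk using E0 a0 elim
            by (simp add: power_divide power_inverse field_simps)
        qed (simp add: w_def binomial_eq_0)
        thus ?case unfolding jensen_poly_def coeff_smult coeff_pcompose_monom_sum E_def
          by (simp add: sum_distrib_left sum_divide_distrib)
      qed
    qed
  qed
  have K: "(\<lambda>n. ?K k n) \<longlonglongrightarrow> hj_coeff d k" for k
  proof (cases "k \<le> d")
    case False
    thus ?thesis unfolding jensen_poly_rev_def coeff_smult coeff_pcompose_monom_sum
      by (simp add: binomial_eq_0 hj_coeff_def)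
  next
    case True
    define r where "r = d - k"
    define w where "w j = real (d choose j) * real (d - j choose k) * (-1) ^ (d - j - k)" for j
    have mom: "(\<Sum>j\<le>d. w j * real j ^ i) = real (d choose k) * (-1) ^ r * (\<Sum>s\<le>r. (-1) ^ s * real (r choose s) * (0 + real s) ^ i)" for i
      unfolding w_def r_def by (rule jensen_weight_moments[OF True])
    have "(\<lambda>n. (\<Sum>j\<le>d. w j * exp (Y j n)) / \<delta> n ^ r) \<longlonglongrightarrow>
      real (d choose k) * (-1) ^ r * ((-1) ^ r * fact r) * ?e r"
      by (rule lim) (simp_all only: mom alternating_sum_powers, simp_all add: r_def)
    also have "real (d choose k) * (-1) ^ r * ((-1) ^ r * fact r) * ?e r = hj_coeff d k"
      unfolding hj_coeff_eq[OF True, symmetric] r_def by (cases "even (d - k)") auto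
    finally show ?thesis
    proof (rule Lim_transform_eventually)
      show "\<forall>\<^sub>F n in sequentially. (\<Sum>j\<le>d. w j * exp (Y j n)) / \<delta> n ^ r =
         ?K k n"
        using ne
      proof eventually_elim
        case (elim n)
        define E where "E = exp (A n)"
        have E0: "E \<noteq> 0" by (simp add: E_def)
        have a0: "\<alpha> n \<noteq> 0" using pos[of n] by simp
        have dk: "\<delta> n ^ d = \<delta> n ^ r * \<delta> n ^ k" using True by (simp add: r_def flip: power_add)
        have "w j * exp (Y j n) / \<delta> n ^ r = inverse ((E * \<delta> n) ^ d) * (inverse (\<alpha> n) *
            (real (d choose j) * \<alpha> (n + j) * (real (d - j choose k) * (E * \<delta> n) ^ k * (- E) ^ (d - j - k))))" if j: "j \<le> d" for j
        proof (cases "k \<le> d - j")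
          case True
          have "(- E) ^ (d - j - k) = (-1) ^ (d - j - k) * E ^ (d - j - k)" by (simp flip: power_mult_distrib)
          moreover have "E ^ d = E ^ j * (E ^ (d - j - k) * E ^ k)" using True j by (simp flip: power_add)
          ultimately show ?thesis unfolding w_def expY E_def[symmetric] power_mult_distrib dk using E0 a0 elim
            by (simp add: field_simps)
        qed (simp add: w_def binomial_eq_0)
        hence "(\<Sum>j\<le>d. w j * exp (Y j n) / \<delta> n ^ r) = (\<Sum>j\<le>d. inverse ((E * \<delta> n) ^ d) * (inverse (\<alpha> n) *
            (real (d choose j) * \<alpha> (n + j) * (real (d - j choose k) * (E * \<delta> n) ^ k * (- E) ^ (d - j - k)))))"
          by (intro sum.cong) auto
        thus ?case unfolding jensen_poly_rev_def coeff_smult coeff_pcompose_monom_sum E_def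
          by (simp add: sum_distrib_left sum_divide_distrib)
      qed
    qed
  qed
  show ?thesis
    unfolding hermite_jensen_def coeffwise_tendsto_def coeff_hj_limit
    by (intro conjI allI tendsto_of_real J K) (use d pos in auto)
qed

section \<open>Overpartitions: orders of magnitude and conclusion\<close>

lemma bigtheta_power_powr:
  assumes "\<delta> \<in> \<Theta>(\<lambda>n::nat. real n powr (- 3 / 4))"
  shows "(\<lambda>n. \<delta> n ^ k) \<in> \<Theta>(\<lambda>n. real n powr (- (3 / 4 * real k)))"
proof -
  have "(\<lambda>n. \<delta> n ^ k) \<in> \<Theta>(\<lambda>n. (real n powr (- 3 / 4)) ^ k)"
  proof (induction k)
    case (Suc k)
    show ?case unfolding power_Suc by (rule landau_theta.mult[OF assms Suc])
  qed simp
  also have "(\<lambda>n. (real n powr (- 3 / 4)) ^ k) \<in> \<Theta>(\<lambda>n. real n powr (- (3 / 4 * real k)))"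
    by (rule bigthetaI_cong, use eventually_gt_at_top[of 0] in eventually_elim)
       (simp add: powr_power mult.commute)
  finally show ?thesis .
qed

lemma bigo_powr_imp_smallo_power:
  assumes "\<delta> \<in> \<Theta>(\<lambda>n::nat. real n powr (- 3 / 4))"
    and "f \<in> O(\<lambda>n. real n powr p)" and "p < - (3 / 4 * real k)"
  shows "f \<in> o(\<lambda>n. \<delta> n ^ k)"
proof -
  note assms(2)
  also have "(\<lambda>n. real n powr p) \<in> o(\<lambda>n. real n powr (- (3 / 4 * real k)))"
    using assms(3) by (subst powr_smallo_iff) (auto intro: filterlim_real_sequentially)
  also have "(\<lambda>n. real n powr (- (3 / 4 * real k))) \<in> \<Theta>(\<lambda>n. \<delta> n ^ k)"
    using bigtheta_power_powr[OF assms(1)] by (subst bigtheta_sym)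
  finally show ?thesis .
qed

text \<open>Both sets of data are covered at once: the deviation of \<open>A\<close> from
  \<open>A_op\<close> is absorbed into \<open>c 1\<close> and the ratio of the two deltas into
  \<open>c 2\<close>. For k >= 3 the exponent 1/2 - k lies below - 3 k / 4, so \<open>c k\<close>
  tends to 0 and only the quadratic term survives.\<close>

lemma hermite_jensen_overpart:
  fixes A \<delta> :: "nat \<Rightarrow> real"
  assumes d: "1 \<le> d"
    and \<delta>: "\<delta> \<in> \<Theta>(\<lambda>n. real n powr (- 3 / 4))" "\<delta> \<longlonglongrightarrow> 0" "\<forall>\<^sub>F n in sequentially. 0 < \<delta> n"
    and A: "(\<lambda>n. (A_op n - A n) / \<delta> n) \<longlonglongrightarrow> 0"
    and \<delta>_op: "(\<lambda>n. (delta_op n / \<delta> n)\<^sup>2) \<longlonglongrightarrow> 1"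
  shows "hermite_jensen d overpart A (-1) \<delta>"
proof -
  obtain b :: "nat \<Rightarrow> nat \<Rightarrow> real" where b1: "\<forall>\<^sub>F n in sequentially. b 1 n = A_op n"
    and b2: "\<forall>\<^sub>F n in sequentially. b 2 n = - (delta_op n)\<^sup>2"
    and bk: "\<And>k. b k \<in> O(\<lambda>n. real n powr (1 / 2 - real k))"
    and exp: "\<And>m j. (\<lambda>n. ln (overpart (n + j) / overpart n) - (\<Sum>k=1..m. b k n * real j ^ k))
        \<in> O(\<lambda>n. real n powr (- 1 / 2 - real m))"
    using overpart_log_expansion by blast
  \<comment> \<open>The remainder exponent - 1/2 - m is then below - 3 d / 4, and m >= 2 as the
    limit criterion requires.\<close>
  define m where "m = d + 2"
  define c where "c k n = (b k n - (if k = 1 then A n else 0)) / \<delta> n ^ k" for k n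
  show ?thesis
  proof (rule hermite_jensen_of_expansion[where m = m and c = c])
    show "c k \<longlonglongrightarrow> (if k = 2 then -1 else 0)" if k: "k \<in> {1..m}" for k
    proof -
      consider "k = 1" | "k = 2" | "3 \<le> k" by atomize_elim (use k in auto)
      thus ?thesis
      proof cases
        case 1
        have "\<forall>\<^sub>F n in sequentially. (A_op n - A n) / \<delta> n = c 1 n"
          using b1 by eventually_elim (simp add: c_def)
        from Lim_transform_eventually[OF A this] show ?thesis using 1 by simp
      next
        case 2
        have "\<forall>\<^sub>F n in sequentially. - ((delta_op n / \<delta> n)\<^sup>2) = c 2 n"
          using b2 by eventually_elim (simp add: c_def power_divide)
        from Lim_transform_eventually[OF tendsto_minus[OF \<delta>_op] this] show ?thesis using 2 by simp
      next
        case 3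
        have "b k \<in> o(\<lambda>n. \<delta> n ^ k)"
          using 3 by (intro bigo_powr_imp_smallo_power[OF \<delta>(1) bk]) simp
        hence "(\<lambda>n. b k n / \<delta> n ^ k) \<longlonglongrightarrow> 0" by (rule smalloD_tendsto)
        thus ?thesis using 3 by (simp add: c_def[abs_def])
      qed
    qed
    fix j assume "j \<le> d"
    have "(\<lambda>n. ln (overpart (n + j) / overpart n) - (\<Sum>k=1..m. b k n * real j ^ k)) \<in> o(\<lambda>n. \<delta> n ^ d)"
      by (intro bigo_powr_imp_smallo_power[OF \<delta>(1) exp]) (simp add: m_def)
    hence "(\<lambda>n. (ln (overpart (n + j) / overpart n) - (\<Sum>k=1..m. b k n * real j ^ k)) / \<delta> n ^ d) \<longlonglongrightarrow> 0"
      by (rule smalloD_tendsto)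
    moreover have "\<forall>\<^sub>F n in sequentially.
        (ln (overpart (n + j) / overpart n) - (\<Sum>k=1..m. b k n * real j ^ k)) / \<delta> n ^ d =
        (ln (overpart (n + j) / overpart n) - A n * real j - (\<Sum>k=1..m. c k n * (\<delta> n * real j) ^ k)) / \<delta> n ^ d"
      using \<delta>(3)
    proof eventually_elim
      case (elim n)
      have "(\<Sum>k=1..m. c k n * (\<delta> n * real j) ^ k) = (\<Sum>k=1..m. b k n * real j ^ k - (if k = 1 then A n * real j else 0))"
        using elim by (intro sum.cong refl) (auto simp: c_def power_mult_distrib field_simps)
      also have "\<dots> = (\<Sum>k=1..m. b k n * real j ^ k) - A n * real j"
        by (simp add: sum_subtractf m_def)
      finally show ?case by simp
    qed
    ultimately show "(\<lambda>n. (ln (overpart (n + j) / overpart n) - A n * real j -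
        (\<Sum>k=1..m. c k n * (\<delta> n * real j) ^ k)) / \<delta> n ^ d) \<longlonglongrightarrow> 0"
      by (rule Lim_transform_eventually)
  qed (use d \<delta> overpart_pos in \<open>auto simp: m_def\<close>)
qed

lemma delta_op_bigtheta: "delta_op \<in> \<Theta>(\<lambda>n. real n powr (- 3 / 4))"
  unfolding delta_op_def[abs_def] S_op_def by real_asymp

lemma delta_op_pos: "\<forall>\<^sub>F n in sequentially. 0 < delta_op n"
  unfolding delta_op_def S_op_def by real_asymp

lemma delta_op_tendsto_0: "delta_op \<longlonglongrightarrow> 0"
  unfolding delta_op_def[abs_def] S_op_def by real_asymp

lemma delta_star_bigtheta: "delta_star \<in> \<Theta>(\<lambda>n. real n powr (- 3 / 4))"
  unfolding delta_star_def[abs_def] by real_asymp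

lemma delta_star_pos: "\<forall>\<^sub>F n in sequentially. 0 < delta_star n"
  unfolding delta_star_def by real_asymp

lemma delta_star_tendsto_0: "delta_star \<longlonglongrightarrow> 0"
  unfolding delta_star_def[abs_def] by real_asymp

text \<open>\<open>A_star\<close> is pi^2 / (2 S), the leading term of \<open>A_op\<close>. The
  difference is O(1 / n), whereas \<open>delta_star\<close> has order n^(-3/4).\<close>

lemma A_op_minus_A_star: "(\<lambda>n. (A_op n - A_star n) / delta_star n) \<longlonglongrightarrow> 0"
proof -
  \<comment> \<open>Writing 1 / (S - 1) - 1 / S as 1 / (S (S - 1)) removes the cancellation of
    leading terms before the limit is computed.\<close>
  have "(\<lambda>n. pi\<^sup>2 / 2 * (1 / (pi * sqrt (real n) * (pi * sqrt (real n) - 1)) - 3 / (pi * sqrt (real n))\<^sup>2) / delta_star n)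
      \<longlonglongrightarrow> 0"
    unfolding delta_star_def by real_asymp
  thus ?thesis
  proof (rule Lim_transform_eventually)
    show "\<forall>\<^sub>F n in sequentially.
        pi\<^sup>2 / 2 * (1 / (pi * sqrt (real n) * (pi * sqrt (real n) - 1)) - 3 / (pi * sqrt (real n))\<^sup>2) / delta_star n =
        (A_op n - A_star n) / delta_star n"
      using S_op_ge_20
    proof eventually_elim
      case (elim n)
      define S where "S = S_op n"
      have S: "20 \<le> S" using elim by (simp add: S_def)
      have "A_star n = pi\<^sup>2 / 2 * (1 / S)"
        by (simp add: A_star_def S_def S_op_def power2_eq_square)
      moreover have "1 / (S * (S - 1)) = 1 / (S - 1) - 1 / S" using S by (simp add: field_simps)
      ultimately have "A_op n - A_star n = pi\<^sup>2 / 2 * (1 / (S * (S - 1)) - 3 / S\<^sup>2)"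
        unfolding A_op_def S_def[symmetric] by (simp only: right_diff_distrib)
      thus ?case unfolding S_def S_op_def by (simp only:)
    qed
  qed
qed

text \<open>Both squares are asymptotic to pi / (8 n^(3/2)).\<close>

lemma delta_op_delta_star: "(\<lambda>n. (delta_op n / delta_star n)\<^sup>2) \<longlonglongrightarrow> 1"
  unfolding delta_op_def delta_star_def S_op_def
  by real_asymp (simp add: powr_half_sqrt power_mult_distrib power_divide power_inverse field_simps flip: sqrt_def, simp add: power4_eq_xxxx power2_eq_square)

text \<open>The Taylor coefficients of degree k >= 3 serve as g_k; those of degree 1 and 2
  eventually equal the prescribed data exactly.\<close>

lemma log_polynomial_overpart:
  assumes m: "2 \<le> m"
  shows "log_polynomial m overpart A_op (-1) delta_op"
proof -
  obtain b :: "nat \<Rightarrow> nat \<Rightarrow> real" where b1: "\<forall>\<^sub>F n in sequentially. b 1 n = A_op n"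
    and b2: "\<forall>\<^sub>F n in sequentially. b 2 n = - (delta_op n)\<^sup>2"
    and bk: "\<And>k. b k \<in> O(\<lambda>n. real n powr (1 / 2 - real k))"
    and exp: "\<And>m j. (\<lambda>n. ln (overpart (n + j) / overpart n) - (\<Sum>k=1..m. b k n * real j ^ k))
        \<in> O(\<lambda>n. real n powr (- 1 / 2 - real m))"
    using overpart_log_expansion by blast
  have "b k \<in> o(\<lambda>n. delta_op n ^ k)" if "k \<in> {3..m}" for k
    using that by (intro bigo_powr_imp_smallo_power[OF delta_op_bigtheta bk]) simp
  moreover have "(\<lambda>n. ln (overpart (n + j) / overpart n) - (A_op n * real j + real_of_int (-1) * delta_op n ^ 2 * real j ^ 2
      + (\<Sum>k=3..m. b k n * real j ^ k))) \<in> o(\<lambda>n. delta_op n ^ (m + 1))" for j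
  proof -
    have "(\<lambda>n. ln (overpart (n + j) / overpart n) - (\<Sum>k=1..m. b k n * real j ^ k)) \<in> o(\<lambda>n. delta_op n ^ (m + 1))"
    proof (rule bigo_powr_imp_smallo_power[OF delta_op_bigtheta exp])
      \<comment> \<open>The inequality of exponents is equivalent to m > 1.\<close>
      have "2 \<le> real m" using m by simp
      thus "- 1 / 2 - real m < - (3 / 4 * real (m + 1))" by (simp only: of_nat_add of_nat_1 distrib_left)
    qed
    also have "?this \<longleftrightarrow> ?thesis"
    proof (rule landau_o.small.in_cong)
      show "\<forall>\<^sub>F n in sequentially. ln (overpart (n + j) / overpart n) - (\<Sum>k=1..m. b k n * real j ^ k) =
          ln (overpart (n + j) / overpart n) - (A_op n * real j + real_of_int (-1) * delta_op n ^ 2 * real j ^ 2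
      + (\<Sum>k=3..m. b k n * real j ^ k))"
        using b1 b2
      proof eventually_elim
        case (elim n)
        have "{1..m} = insert 1 (insert 2 {3..m})" using m by auto
        hence "(\<Sum>k=1..m. b k n * real j ^ k) = b 1 n * real j + (b 2 n * real j ^ 2 + (\<Sum>k=3..m. b k n * real j ^ k))"
          by simp
        thus ?case unfolding elim by simp
      qed
    qed
    finally show ?thesis .
  qed
  ultimately show ?thesis
    unfolding log_polynomial_def using m overpart_pos delta_op_pos delta_op_tendsto_0 by blast
qed

theorem theorem7p2:
  shows "(\<forall>m\<ge>2. log_polynomial m overpart A_op (-1) delta_op)
       \<and> (\<forall>d\<ge>1. hermite_jensen d overpart A_op (-1) delta_op)
       \<and> (\<forall>d\<ge>1. hermite_jensen d overpart A_star (-1) delta_star)"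
proof (intro conjI allI impI)
  fix m :: nat assume "2 \<le> m"
  thus "log_polynomial m overpart A_op (-1) delta_op" by (rule log_polynomial_overpart)
next
  fix d :: nat assume d: "1 \<le> d"
  \<comment> \<open>Since 0 / 0 = 0, the quotient is 1 only where \<open>delta_op\<close> is
    nonzero, which eventual positivity ensures.\<close>
  have "\<forall>\<^sub>F n in sequentially. (delta_op n / delta_op n)\<^sup>2 = 1"
    using delta_op_pos by eventually_elim simp
  hence "(\<lambda>n. (delta_op n / delta_op n)\<^sup>2) \<longlonglongrightarrow> 1" by (rule tendsto_eventually)
  thus "hermite_jensen d overpart A_op (-1) delta_op"
    by (intro hermite_jensen_overpart d delta_op_bigtheta delta_op_tendsto_0 delta_op_pos) simp_all
next
  fix d :: nat assume d: "1 \<le> d"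
  show "hermite_jensen d overpart A_star (-1) delta_star"
    by (intro hermite_jensen_overpart d delta_star_bigtheta delta_star_tendsto_0 delta_star_pos
        A_op_minus_A_star delta_op_delta_star)
qed

end
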